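(* Let $\mathbb{K}\in\{\mathbb{Q},\mathbb{R},\mathbb{C}\}$, let $n,k$ be positive integers, and let $\mathcal{L}$ be the free Lie algebra of rank $n$ over $\mathbb{Q}$ with lower central series $\mathcal{L}=\mathcal{L}_1\supset\mathcal{L}_2\supset\cdots$. If $\Phi\in\mathrm{Aut}_{\mathrm{Lie}}(\mathcal{L}/\mathcal{L}_k\otimes\mathbb{K})$ is such that every eigenvalue of $p_k(\Phi)$ is one, then $\Phi\in\mathcal{M}^\circ_{k,\mathbb{K}}$. Moreover, if $\mathbb{K}=\mathbb{C}$, then $\mathrm{Log}(\Phi)=\ln(\Phi)$ in $\mathrm{Der}(\mathcal{L}/\mathcal{L}_k\otimes\mathbb{C})$. The same statement holds in the inverse limit $k\to\infty$: if $\Phi\in\mathrm{Aut}_{\mathrm{Lie}}(\varprojlim_k\mathcal{L}/\mathcal{L}_k\otimes\mathbb{K})$ induces on the abelianization $\mathcal{L}/\mathcal{L}_2\otimes\mathbb{K}$ a map all of whose eigenvalues are one, then $\Phi\in\mathcal{M}^\circ_{\infty,\mathbb{K}}$, and if $\mathbb{K}=\mathbb{C}$, then $\mathrm{Log}(\Phi)=\ln(\Phi)$.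
   Context: $\mathrm{Aut}_{\mathrm{Lie}}$ denotes the group of $\mathbb{K}$-linear Lie algebra automorphisms and $\mathrm{Der}$ the Lie algebra of $\mathbb{K}$-linear derivations. With $\mathfrak{g}=\mathcal{L}/\mathcal{L}_k\otimes\mathbb{K}$ and $\mathfrak{g}_{\mathrm{ab}}=\mathfrak{g}/[\mathfrak{g},\mathfrak{g}]$, the maps $p_k:\mathrm{Aut}_{\mathrm{Lie}}(\mathfrak{g})\to\mathrm{GL}(\mathfrak{g}_{\mathrm{ab}})$ and $p_k:\mathrm{Der}(\mathfrak{g})\to\mathrm{End}(\mathfrak{g}_{\mathrm{ab}})$ are induced by the projection $\mathfrak{g}\to\mathfrak{g}_{\mathrm{ab}}$. $\mathrm{Log}(\Phi):=-\sum_{i=1}^\infty(\mathrm{id}-\Phi)^i/i$ is a formal sum; $\mathcal{M}^\circ_{k,\mathbb{K}}$ is the set of $\Phi\in\mathrm{Aut}_{\mathrm{Lie}}(\mathcal{L}/\mathcal{L}_k\otimes\mathbb{K})$ for which $\mathrm{Log}(\Phi)$ converges to an element of $\mathrm{Der}(\mathcal{L}/\mathcal{L}_k\otimes\mathbb{K})$. $\mathcal{M}^\circ_{\infty,\mathbb{K}}:=\varprojlim_k\mathcal{M}^\circ_{k,\mathbb{K}}\subset\mathrm{Aut}_{\mathrm{Lie}}(\varprojlim_k\mathcal{L}/\mathcal{L}_k\otimes\mathbb{K})$, i.e. the set of automorphisms whose induced automorphism of $\mathcal{L}/\mathcal{L}_k\otimes\mathbb{K}$ lies in $\mathcal{M}^\circ_{k,\mathbb{K}}$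 for every $k$. In the inverse limit, $\mathrm{Log}(\Phi)$ and $\ln(\Phi)$ are the inverse limits of $\mathrm{Log}$ and $\ln$ of the automorphisms induced on the quotients $\mathcal{L}/\mathcal{L}_k\otimes\mathbb{K}$. Definition of $\ln(\Phi)$ (for $\mathbb{K}=\mathbb{C}$). For $z\in\mathbb{C}^\times$ let $\ln z=\ln|z|+\sqrt{-1}\arg z$ with $-\pi<\arg z\le\pi$. For an invertible complex matrix $A$ conjugate to a single Jordan block of size $\ell$ with eigenvalue $\lambda$, $\ln(A):=\ln(\lambda)I_\ell+\sum_{1\le i<\ell}(-1)^{i-1}(\lambda^{-1}A-I_\ell)^i/i$; for general invertible $A=g(J_{\lambda_1}(\ell_1)\oplus\cdots\oplus J_{\lambda_m}(\ell_m))g^{-1}$ (Jordan form), $\ln(A):=g(\ln J_{\lambda_1}(\ell_1)\oplus\cdots\oplus\ln J_{\lambda_m}(\ell_m))g^{-1}$. An invertible complex matrix $A$ is exponential solvable if the multiplicative group generated by its eigenvalues and their complex conjugates meets the unit circle only in $1$ (in particular this holds if all eigenvalues are one). For $\Phi\in\mathrm{Aut}_{\mathrm{Lie}}(\mathcal{L}/\mathcal{L}_k\otimes\mathbb{C})$ with $p_k(\Phi)$ exponential solvable, $\ln(\Phi)$ is the unique derivation $D\in\mathrm{Der}(\mathcal{L}/\mathcal{L}_k\otimes\mathbb{C})$ with $\exp(D)=\sum_{j\ge0}D^j/j!=\Phi$ and $p_k(D)=\ln(p_k(\Phi))$. *)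

theory Defs
  imports
    "HOL-Analysis.Complex_Transcendental"
    "HOL-Algebra.QuotRing"
    "HOL-Algebra.Generated_Groups"
    "HOL-Algebra.Multiplicative_Group"
    "HOL-Algebra.Bij"
    "Jordan_Normal_Form.Jordan_Normal_Form_Existence"
    "Jordan_Normal_Form.VS_Connect"
begin

hide_const (open) Multiset.mult
hide_const (open) Polynomial.smult
hide_const (open) Modules.module

section \<open>Lie algebras over subfields of the complex numbers\<close>

text \<open>
  The ground fields are subsets of \<^typ>\<open>complex\<close>: the rational numbers, the real numbers and
  \<^term>\<open>UNIV\<close>. A (not necessarily associative) algebra is a \<^typ>\<open>('a, 'b) module\<close> record whose
  \<^const>\<open>mult\<close> component is the bilinear product, as in the locale \<^locale>\<open>algebra\<close>; for
  Lie algebras \<^const>\<open>mult\<close> is the bracket. The component \<^const>\<open>one\<close> carries no meaning.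
\<close>

definition cfield :: "complex set \<Rightarrow> complex ring" where
  "cfield K = \<lparr>carrier = K, mult = (*), one = 1, zero = 0, add = (+)\<rparr>"

type_synonym 'a calg = "(complex, 'a) module"

abbreviation lspan :: "complex set \<Rightarrow> 'a calg \<Rightarrow> 'a set \<Rightarrow> 'a set" where
  "lspan K V \<equiv> LinearCombinations.module.span (cfield K) V"

abbreviation lbasis :: "complex set \<Rightarrow> 'a calg \<Rightarrow> 'a set \<Rightarrow> bool" where
  "lbasis K V \<equiv> VectorSpace.vectorspace.basis (cfield K) V"

definition bracket_span :: "complex set \<Rightarrow> 'a calg \<Rightarrow> 'a set \<Rightarrow> 'a set \<Rightarrow> 'a set" where
  "bracket_span K A U W = lspan K A {x \<otimes>\<^bsub>A\<^esub> y | x y. x \<in> U \<and> y \<in> W}"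

text \<open>The lower central series is indexed from 1, as usual; the value at 0 is a dummy.\<close>

primrec lower_central :: "complex set \<Rightarrow> 'a calg \<Rightarrow> nat \<Rightarrow> 'a set" where
  "lower_central K A 0 = carrier A"
| "lower_central K A (Suc k) =
     (if k = 0 then carrier A else bracket_span K A (carrier A) (lower_central K A k))"

definition alg_ideal :: "complex set \<Rightarrow> 'a calg \<Rightarrow> 'a set \<Rightarrow> bool" where
  "alg_ideal K A I \<longleftrightarrow> additive_subgroup I A \<and>
     (\<forall>c\<in>K. \<forall>x\<in>I. c \<odot>\<^bsub>A\<^esub> x \<in> I) \<and>
     (\<forall>a\<in>carrier A. \<forall>x\<in>I. a \<otimes>\<^bsub>A\<^esub> x \<in> I \<and> x \<otimes>\<^bsub>A\<^esub> a \<in> I)"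

definition ideal_generated :: "complex set \<Rightarrow> 'a calg \<Rightarrow> 'a set \<Rightarrow> 'a set" where
  "ideal_generated K A S = \<Inter>{I. alg_ideal K A I \<and> S \<subseteq> I}"

definition quot_alg :: "'a calg \<Rightarrow> 'a set \<Rightarrow> 'a set calg" where
  "quot_alg A I = ring.extend (A Quot I)
     \<lparr>smult = (\<lambda>c X. \<Union>x\<in>X. I +>\<^bsub>A\<^esub> (c \<odot>\<^bsub>A\<^esub> x))\<rparr>"

text \<open>The map of quotients \<open>A/I \<rightarrow> B/J\<close> induced by a map \<open>f : A \<rightarrow> B\<close> taking \<open>I\<close> into \<open>J\<close>.\<close>

definition quot_map :: "'a calg \<Rightarrow> 'a set \<Rightarrow> 'b calg \<Rightarrow> 'b set \<Rightarrow> ('a \<Rightarrow> 'b) \<Rightarrow> 'a set \<Rightarrow> 'b set" where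
  "quot_map A I B J f = (\<lambda>X\<in>carrier (quot_alg A I). \<Union>x\<in>X. J +>\<^bsub>B\<^esub> f x)"

section \<open>Free Lie algebras and extension of scalars\<close>

text \<open>
  The magma algebra: the vector space over \<open>K\<close> with basis \<open>M\<close> (finitely supported functions),
  with the bilinear product that extends a binary operation \<open>m\<close> on \<open>M\<close>.
\<close>

definition magma_alg :: "complex set \<Rightarrow> 'm set \<Rightarrow> ('m \<Rightarrow> 'm \<Rightarrow> 'm) \<Rightarrow> ('m \<Rightarrow> complex) calg" where
  "magma_alg K M m =
    \<lparr>carrier = {f. finite {x. f x \<noteq> 0} \<and> {x. f x \<noteq> 0} \<subseteq> M \<and> range f \<subseteq> K},
     mult = (\<lambda>f g u. \<Sum>(v, w) | f v \<noteq> 0 \<and> g w \<noteq> 0 \<and> m v w = u. f v * g w),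
     one = (\<lambda>_. 0), zero = (\<lambda>_. 0), add = (\<lambda>f g x. f x + g x),
     smult = (\<lambda>c f x. c * f x)\<rparr>"

datatype 'x free_magma = Gen 'x | Br "'x free_magma" "'x free_magma"

definition free_nonassoc :: "complex set \<Rightarrow> nat \<Rightarrow> (nat free_magma \<Rightarrow> complex) calg" where
  "free_nonassoc K n = magma_alg K {t. set_free_magma t \<subseteq> {..<n}} Br"

definition lie_relators :: "'a calg \<Rightarrow> 'a set" where
  "lie_relators A = {x \<otimes>\<^bsub>A\<^esub> x | x. x \<in> carrier A} \<union>
     {x \<otimes>\<^bsub>A\<^esub> (y \<otimes>\<^bsub>A\<^esub> z) \<oplus>\<^bsub>A\<^esub> y \<otimes>\<^bsub>A\<^esub> (z \<otimes>\<^bsub>A\<^esub> x) \<oplus>\<^bsub>A\<^esub> z \<otimes>\<^bsub>A\<^esub> (x \<otimes>\<^bsub>A\<^esub> y) | x y z.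
        x \<in> carrier A \<and> y \<in> carrier A \<and> z \<in> carrier A}"

definition free_lie :: "complex set \<Rightarrow> nat \<Rightarrow> (nat free_magma \<Rightarrow> complex) set calg" where
  "free_lie K n = quot_alg (free_nonassoc K n)
     (ideal_generated K (free_nonassoc K n) (lie_relators (free_nonassoc K n)))"

text \<open>
  Extension of scalars \<open>V \<otimes> K\<close> over the rational numbers: the vector space over \<open>K\<close> freely
  generated by symbols \<open>v \<otimes> 1\<close> (the indicator functions) for \<open>v \<in> V\<close>, modulo additivity and
  rational homogeneity in \<open>v\<close>. The bracket satisfies \<open>[v \<otimes> 1, w \<otimes> 1] = [v, w] \<otimes> 1\<close>.
\<close>

definition tensor_pre :: "complex set \<Rightarrow> 'v calg \<Rightarrow> ('v \<Rightarrow> complex) calg" where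
  "tensor_pre K V = magma_alg K (carrier V) (mult V)"

definition tensor_relations :: "complex set \<Rightarrow> 'v calg \<Rightarrow> ('v \<Rightarrow> complex) set" where
  "tensor_relations K V = lspan K (tensor_pre K V)
    ({\<lambda>x. indicator {v \<oplus>\<^bsub>V\<^esub> w} x - indicator {v} x - indicator {w} x | v w.
        v \<in> carrier V \<and> w \<in> carrier V} \<union>
     {\<lambda>x. indicator {q \<odot>\<^bsub>V\<^esub> v} x - q * indicator {v} x | q v. q \<in> \<rat> \<and> v \<in> carrier V})"

definition tensor :: "'v calg \<Rightarrow> complex set \<Rightarrow> ('v \<Rightarrow> complex) set calg" where
  "tensor V K = quot_alg (tensor_pre K V) (tensor_relations K V)"

definition pushforward :: "('v \<Rightarrow> 'w) \<Rightarrow> ('v \<Rightarrow> complex) \<Rightarrow> 'w \<Rightarrow> complex" where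
  "pushforward f F w = (\<Sum>v | F v \<noteq> 0 \<and> f v = w. F v)"

definition tensor_map :: "'v calg \<Rightarrow> 'w calg \<Rightarrow> complex set \<Rightarrow> ('v \<Rightarrow> 'w)
    \<Rightarrow> ('v \<Rightarrow> complex) set \<Rightarrow> ('w \<Rightarrow> complex) set" where
  "tensor_map V W K f = quot_map (tensor_pre K V) (tensor_relations K V)
     (tensor_pre K W) (tensor_relations K W) (pushforward f)"

section \<open>Automorphisms, derivations and the abelianization\<close>

definition lin_end :: "complex set \<Rightarrow> 'a calg \<Rightarrow> ('a \<Rightarrow> 'a) set" where
  "lin_end K V = module_hom (cfield K) V V \<inter> extensional (carrier V)"

definition lie_aut :: "complex set \<Rightarrow> 'a calg \<Rightarrow> ('a \<Rightarrow> 'a) set" where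
  "lie_aut K A = {\<Phi> \<in> lin_end K A. bij_betw \<Phi> (carrier A) (carrier A) \<and>
     (\<forall>x\<in>carrier A. \<forall>y\<in>carrier A. \<Phi> (x \<otimes>\<^bsub>A\<^esub> y) = \<Phi> x \<otimes>\<^bsub>A\<^esub> \<Phi> y)}"

definition lie_der :: "complex set \<Rightarrow> 'a calg \<Rightarrow> ('a \<Rightarrow> 'a) set" where
  "lie_der K A = {D \<in> lin_end K A. \<forall>x\<in>carrier A. \<forall>y\<in>carrier A.
     D (x \<otimes>\<^bsub>A\<^esub> y) = (D x \<otimes>\<^bsub>A\<^esub> y) \<oplus>\<^bsub>A\<^esub> (x \<otimes>\<^bsub>A\<^esub> D y)}"

abbreviation derived :: "complex set \<Rightarrow> 'a calg \<Rightarrow> 'a set" where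
  "derived K A \<equiv> bracket_span K A (carrier A) (carrier A)"

definition abelianization :: "complex set \<Rightarrow> 'a calg \<Rightarrow> 'a set calg" where
  "abelianization K A = quot_alg A (derived K A)"

definition ab_map :: "complex set \<Rightarrow> 'a calg \<Rightarrow> ('a \<Rightarrow> 'a) \<Rightarrow> 'a set \<Rightarrow> 'a set" where
  "ab_map K A f = quot_map A (derived K A) A (derived K A) f"

section \<open>Matrices, eigenvalues and the matrix logarithm\<close>

definition represents :: "complex set \<Rightarrow> 'a calg \<Rightarrow> 'a list \<Rightarrow> ('a \<Rightarrow> 'a) \<Rightarrow> complex mat \<Rightarrow> bool" where
  "represents K V bs f A \<longleftrightarrow> distinct bs \<and> lbasis K V (set bs) \<and>
     A \<in> carrier_mat (length bs) (length bs) \<and> elements_mat A \<subseteq> K \<and>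
     (\<forall>j<length bs. f (bs ! j) = (\<Oplus>\<^bsub>V\<^esub> i\<in>{..<length bs}. (A $$ (i, j)) \<odot>\<^bsub>V\<^esub> (bs ! i)))"

text \<open>Eigenvalues are complex eigenvalues of a representing matrix, also when \<open>K\<close> is a proper subfield.\<close>

definition eigenvalues :: "complex set \<Rightarrow> 'a calg \<Rightarrow> ('a \<Rightarrow> 'a) \<Rightarrow> complex set" where
  "eigenvalues K V f = {z. \<exists>bs A. represents K V bs f A \<and> eigenvalue A z}"

definition exp_solvable :: "complex set \<Rightarrow> bool" where
  "exp_solvable E \<longleftrightarrow>
     generate (mult_of (cfield UNIV)) (E \<union> cnj ` E) \<inter> sphere 0 1 = {1}"

text \<open>\<^term>\<open>ln z\<close> for complex \<open>z\<close> is the principal branch with imaginary part in \<open>(-\<pi>, \<pi>]\<close>.\<close>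

definition ln_jordan_block :: "nat \<Rightarrow> complex \<Rightarrow> complex mat" where
  "ln_jordan_block l z = mat l l (\<lambda>(r, c). (if r = c then ln z else 0) +
     (\<Sum>i\<in>{1..<l}. (-1) ^ (i - 1) / of_nat i *
        ((inverse z \<cdot>\<^sub>m jordan_block l z - 1\<^sub>m l) ^\<^sub>m i) $$ (r, c)))"

text \<open>\<open>is_mat_ln A B\<close> says that \<open>B\<close> is \<open>ln A\<close>, computed from some Jordan form of \<open>A\<close>.\<close>

definition is_mat_ln :: "complex mat \<Rightarrow> complex mat \<Rightarrow> bool" where
  "is_mat_ln A B \<longleftrightarrow> (\<exists>n_as P Q. 0 \<notin> fst ` set n_as \<and> 0 \<notin> snd ` set n_as \<and>
     similar_mat_wit A (jordan_matrix n_as) P Q \<and>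
     B = P * diag_block_mat (map (\<lambda>(l, z). ln_jordan_block l z) n_as) * Q)"

section \<open>Exponentials and logarithms of endomorphisms\<close>

text \<open>
  Convergence in the canonical topology of a finite-dimensional vector space over \<open>K\<close>: every
  linear functional converges, with respect to the Euclidean topology on \<open>K\<close>. Sequences of
  endomorphisms converge pointwise.
\<close>

definition linear_functionals :: "complex set \<Rightarrow> 'a calg \<Rightarrow> ('a \<Rightarrow> complex) set" where
  "linear_functionals K V = {f \<in> carrier V \<rightarrow> K.
     (\<forall>x\<in>carrier V. \<forall>y\<in>carrier V. f (x \<oplus>\<^bsub>V\<^esub> y) = f x + f y) \<and>
     (\<forall>c\<in>K. \<forall>x\<in>carrier V. f (c \<odot>\<^bsub>V\<^esub> x) = c * f x)}"

definition vconverges :: "complex set \<Rightarrow> 'a calg \<Rightarrow> (nat \<Rightarrow> 'a) \<Rightarrow> 'a \<Rightarrow> bool" where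
  "vconverges K V X x \<longleftrightarrow> (\<forall>f\<in>linear_functionals K V. (\<lambda>m. f (X m)) \<longlonglongrightarrow> f x)"

definition exp_sums :: "complex set \<Rightarrow> 'a calg \<Rightarrow> ('a \<Rightarrow> 'a) \<Rightarrow> ('a \<Rightarrow> 'a) \<Rightarrow> bool" where
  "exp_sums K V D \<Phi> \<longleftrightarrow> (\<forall>x\<in>carrier V. vconverges K V
     (\<lambda>N. \<Oplus>\<^bsub>V\<^esub> j\<in>{..<N}. (1 / fact j) \<odot>\<^bsub>V\<^esub> (D ^^ j) x) (\<Phi> x))"

definition log_sums :: "complex set \<Rightarrow> 'a calg \<Rightarrow> ('a \<Rightarrow> 'a) \<Rightarrow> ('a \<Rightarrow> 'a) \<Rightarrow> bool" where
  "log_sums K V \<Phi> D \<longleftrightarrow> (\<forall>x\<in>carrier V. vconverges K V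
     (\<lambda>N. \<ominus>\<^bsub>V\<^esub> (\<Oplus>\<^bsub>V\<^esub> i\<in>{1..N}. (1 / of_nat i) \<odot>\<^bsub>V\<^esub> ((\<lambda>y. y \<ominus>\<^bsub>V\<^esub> \<Phi> y) ^^ i) x)) (D x))"

definition log_domain :: "complex set \<Rightarrow> 'a calg \<Rightarrow> ('a \<Rightarrow> 'a) set" where
  "log_domain K A = {\<Phi> \<in> lie_aut K A. \<exists>D\<in>lie_der K A. log_sums K A \<Phi> D}"

definition lie_Log :: "complex set \<Rightarrow> 'a calg \<Rightarrow> ('a \<Rightarrow> 'a) \<Rightarrow> 'a \<Rightarrow> 'a" where
  "lie_Log K A \<Phi> = (THE D. D \<in> lin_end K A \<and> log_sums K A \<Phi> D)"

definition is_lie_ln :: "'a calg \<Rightarrow> ('a \<Rightarrow> 'a) \<Rightarrow> ('a \<Rightarrow> 'a) \<Rightarrow> bool" where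
  "is_lie_ln A \<Phi> D \<longleftrightarrow>
     exp_solvable (eigenvalues UNIV (abelianization UNIV A) (ab_map UNIV A \<Phi>)) \<and>
     D \<in> lie_der UNIV A \<and> exp_sums UNIV A D \<Phi> \<and>
     (\<exists>bs P Q. represents UNIV (abelianization UNIV A) bs (ab_map UNIV A \<Phi>) P \<and>
               represents UNIV (abelianization UNIV A) bs (ab_map UNIV A D) Q \<and>
               is_mat_ln P Q)"

definition lie_ln :: "'a calg \<Rightarrow> ('a \<Rightarrow> 'a) \<Rightarrow> 'a \<Rightarrow> 'a" where
  "lie_ln A \<Phi> = (THE D. is_lie_ln A \<Phi> D)"

section \<open>The nilpotent quotients and their inverse limit\<close>

type_synonym flie = "(nat free_magma \<Rightarrow> complex) set"
type_synonym flie_quot = "(flie set \<Rightarrow> complex) set"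

abbreviation nil_quot :: "nat \<Rightarrow> nat \<Rightarrow> flie set calg" where
  "nil_quot n k \<equiv> quot_alg (free_lie \<rat> n) (lower_central \<rat> (free_lie \<rat> n) k)"

definition lie_level :: "complex set \<Rightarrow> nat \<Rightarrow> nat \<Rightarrow> flie_quot calg" where
  "lie_level K n k = tensor (nil_quot n k) K"

definition level_proj :: "complex set \<Rightarrow> nat \<Rightarrow> nat \<Rightarrow> flie_quot \<Rightarrow> flie_quot" where
  "level_proj K n k = tensor_map (nil_quot n (Suc k)) (nil_quot n k) K
     (quot_map (free_lie \<rat> n) (lower_central \<rat> (free_lie \<rat> n) (Suc k))
               (free_lie \<rat> n) (lower_central \<rat> (free_lie \<rat> n) k) (\<lambda>x. x))"

definition lie_limit :: "complex set \<Rightarrow> nat \<Rightarrow> (nat \<Rightarrow> flie_quot) calg" where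
  "lie_limit K n =
    \<lparr>carrier = {s \<in> Pi\<^sub>E {1..} (\<lambda>k. carrier (lie_level K n k)).
        \<forall>k\<ge>1. level_proj K n k (s (Suc k)) = s k},
     mult = (\<lambda>s t. \<lambda>k\<in>{1..}. s k \<otimes>\<^bsub>lie_level K n k\<^esub> t k),
     one = (\<lambda>k\<in>{1..}. \<one>\<^bsub>lie_level K n k\<^esub>),
     zero = (\<lambda>k\<in>{1..}. \<zero>\<^bsub>lie_level K n k\<^esub>),
     add = (\<lambda>s t. \<lambda>k\<in>{1..}. s k \<oplus>\<^bsub>lie_level K n k\<^esub> t k),
     smult = (\<lambda>c s. \<lambda>k\<in>{1..}. c \<odot>\<^bsub>lie_level K n k\<^esub> s k)\<rparr>"

definition induces :: "complex set \<Rightarrow> nat \<Rightarrow> nat \<Rightarrow> ((nat \<Rightarrow> flie_quot) \<Rightarrow> (nat \<Rightarrow> flie_quot))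
    \<Rightarrow> (flie_quot \<Rightarrow> flie_quot) \<Rightarrow> bool" where
  "induces K n k \<Phi> \<phi> \<longleftrightarrow> \<phi> \<in> extensional (carrier (lie_level K n k)) \<and>
     (\<forall>s\<in>carrier (lie_limit K n). \<phi> (s k) = \<Phi> s k)"

text \<open>
  The map induced on a quotient is unique because the limit surjects onto every quotient.
\<close>

definition level_map :: "complex set \<Rightarrow> nat \<Rightarrow> nat \<Rightarrow> ((nat \<Rightarrow> flie_quot) \<Rightarrow> (nat \<Rightarrow> flie_quot))
    \<Rightarrow> flie_quot \<Rightarrow> flie_quot" where
  "level_map K n k \<Phi> = (THE \<phi>. induces K n k \<Phi> \<phi>)"

definition limit_map :: "complex set \<Rightarrow> nat \<Rightarrow> (nat \<Rightarrow> flie_quot \<Rightarrow> flie_quot)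
    \<Rightarrow> (nat \<Rightarrow> flie_quot) \<Rightarrow> (nat \<Rightarrow> flie_quot)" where
  "limit_map K n f = (\<lambda>s\<in>carrier (lie_limit K n). \<lambda>k\<in>{1..}. f k (s k))"

definition M_circ :: "complex set \<Rightarrow> nat \<Rightarrow> nat \<Rightarrow> (flie_quot \<Rightarrow> flie_quot) set" where
  "M_circ K n k = log_domain K (lie_level K n k)"

definition M_circ_limit :: "complex set \<Rightarrow> nat \<Rightarrow> ((nat \<Rightarrow> flie_quot) \<Rightarrow> (nat \<Rightarrow> flie_quot)) set" where
  "M_circ_limit K n = {\<Phi> \<in> lie_aut K (lie_limit K n).
     \<forall>k\<ge>1. \<exists>\<phi>\<in>M_circ K n k. induces K n k \<Phi> \<phi>}"

definition limit_Log :: "complex set \<Rightarrow> nat \<Rightarrow> ((nat \<Rightarrow> flie_quot) \<Rightarrow> (nat \<Rightarrow> flie_quot))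
    \<Rightarrow> (nat \<Rightarrow> flie_quot) \<Rightarrow> (nat \<Rightarrow> flie_quot)" where
  "limit_Log K n \<Phi> = limit_map K n (\<lambda>k. lie_Log K (lie_level K n k) (level_map K n k \<Phi>))"

definition limit_ln :: "nat \<Rightarrow> ((nat \<Rightarrow> flie_quot) \<Rightarrow> (nat \<Rightarrow> flie_quot))
    \<Rightarrow> (nat \<Rightarrow> flie_quot) \<Rightarrow> (nat \<Rightarrow> flie_quot)" where
  "limit_ln n \<Phi> = limit_map UNIV n (\<lambda>k. lie_ln (lie_level UNIV n k) (level_map UNIV n k \<Phi>))"

end

(*
  If Phi is a Lie automorphism of a nilpotent Lie algebra g and N = id - Phi is nilpotent on the
  abelianization, then the rule N[x,y] = [Nx,y] + [x,Ny] - [Nx,Ny] makes N nilpotent on g, so Log(Phi)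
  is a finite sum. For a linear functional f, the value f(Phi^m x) is a polynomial in m whose linear
  coefficient is f(Log(Phi) x). Comparing polynomials that agree at all natural numbers shows that
  Log(Phi) is a derivation (from Phi^m [x,y] = [Phi^m x, Phi^m y]), that exp(Log(Phi)) = Phi (from
  Phi^(a+b) = Phi^a Phi^b and Taylor's formula), and that every nilpotent D with exp(D) = Phi equals
  Log(Phi). On the abelianization the matrix logarithm of a unipotent matrix is the same power series,
  hence ln(Phi) is nilpotent there, thus nilpotent, and so equal to Log(Phi).

  In the inverse limit, an abstract automorphism induces maps on all quotients because the kernel of the
  projection to L/L_k (tensored with K) is the k-th term of the algebraic lower central series of the
  limit: finite generation lets one write each of its elements as a finite sum of brackets [x_i, t_i]
  with the t_i built by successive approximation.
*)
theory Submission
  imports Defs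
begin

section \<open>Vector spaces over subfields of the complex numbers\<close>

text \<open>Most of the spaces are quotients of function spaces, often infinite-dimensional and
  without a basis at hand. Identities of vectors are therefore tested by linear functionals: Zorn's
  lemma supplies enough of them in every dimension, the identity becomes one of complex numbers, and
  convergence is defined by functionals anyway. Statements about all vectors are reduced to
  generators by checking that the vectors with the property form a subspace (\<open>linsub\<close>).

  The polynomial in m behind f(\<Phi>^m x) is Newton's expansion of (id - N)^m in the binomials (m
  choose j). The linear coefficient of (m choose j) is (-1)^(j-1)/j, and this is where the series of
  the logarithm comes from.

  The obstacle in the limit is that an automorphism is not assumed to be continuous, so the kernels
  of the projections must be described by algebra alone. The lower central series of the limit
  contains only finite sums of brackets; the fixed number n of generators bounds the number of
  summands on all levels at once, so the corrections made level by level can be collected in n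
  coefficients.\<close>

lemma cfield_simps [simp]:
  "carrier (cfield K) = K" "x \<oplus>\<^bsub>cfield K\<^esub> y = x + y" "x \<otimes>\<^bsub>cfield K\<^esub> y = x * y"
  "\<zero>\<^bsub>cfield K\<^esub> = 0" "\<one>\<^bsub>cfield K\<^esub> = 1"
  by (simp_all add: cfield_def)

text \<open>Four closure conditions determine a subfield of the complex numbers;
  \<open>K_inverse\<close> needs no exception at 0 because \<open>inverse 0 = 0\<close>.\<close>

locale cx_field =
  fixes K :: "complex set"
  assumes K_one [simp]: "1 \<in> K"
    and K_diff [simp]: "\<lbrakk>a \<in> K; b \<in> K\<rbrakk> \<Longrightarrow> a - b \<in> K"
    and K_mult [simp]: "\<lbrakk>a \<in> K; b \<in> K\<rbrakk> \<Longrightarrow> a * b \<in> K"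
    and K_inverse [simp]: "a \<in> K \<Longrightarrow> inverse a \<in> K"
begin

lemma K_zero [simp]: "0 \<in> K"
  using K_diff[OF K_one K_one] by simp

lemma K_uminus [simp]: "a \<in> K \<Longrightarrow> - a \<in> K"
  using K_diff[OF K_zero] by force

lemma K_add [simp]: "\<lbrakk>a \<in> K; b \<in> K\<rbrakk> \<Longrightarrow> a + b \<in> K"
  using K_diff[OF _ K_uminus] by force

lemma K_divide [simp]: "\<lbrakk>a \<in> K; b \<in> K\<rbrakk> \<Longrightarrow> a / b \<in> K"
  by (simp add: divide_inverse)

lemma K_of_nat [simp]: "of_nat m \<in> K"
  by (induction m) simp_all

lemma K_of_int [simp]: "of_int m \<in> K"
  by (cases m) simp_all

lemma K_Rats: "\<rat> \<subseteq> K"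
  by (auto elim!: Rats_cases' )

lemma K_sum: "(\<And>i. i \<in> I \<Longrightarrow> g i \<in> K) \<Longrightarrow> sum g I \<in> K"
  by (induction I rule: infinite_finite_induct) simp_all

lemma field_cfield: "field (cfield K)"
proof -
  have "cring (cfield K)"
    by (intro cringI abelian_groupI comm_monoidI) (auto simp: algebra_simps intro!: bexI[of _ "- x" for x])
  moreover have "Units (cfield K) = carrier (cfield K) - {\<zero>\<^bsub>cfield K\<^esub>}"
    by (auto simp: Units_def) (metis K_inverse left_inverse right_inverse)
  ultimately show ?thesis
    by (rule cring.cring_fieldI)
qed

sublocale Kf: field "cfield K"
  by (rule field_cfield)

lemma cfield_uminus [simp]: "a \<in> K \<Longrightarrow> \<ominus>\<^bsub>cfield K\<^esub> a = - a"
  by (rule Kf.minus_equality) auto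

end

lemma cx_field_subfields:
  assumes "K \<in> {\<rat>, \<real>, UNIV}"
  shows "cx_field K"
  using assms by (auto intro!: cx_field.intro)

locale kspace = cx_field K + module "cfield K" V
  for K and V :: "'a calg" (structure)
begin

lemma vectorspace: "vectorspace (cfield K) V"
  by (intro vectorspace.intro field_cfield module_axioms)

lemma smult_K_closed [simp]: "\<lbrakk>c \<in> K; x \<in> carrier V\<rbrakk> \<Longrightarrow> c \<odot> x \<in> carrier V"
  using smult_closed by simp

lemma smult_K_add_left: "\<lbrakk>a \<in> K; b \<in> K; x \<in> carrier V\<rbrakk> \<Longrightarrow> (a + b) \<odot> x = a \<odot> x \<oplus> b \<odot> x"
  using smult_l_distr by simp

lemma smult_K_add_right: "\<lbrakk>a \<in> K; x \<in> carrier V; y \<in> carrier V\<rbrakk> \<Longrightarrow> a \<odot> (x \<oplus> y) = a \<odot> x \<oplus> a \<odot> y"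
  using smult_r_distr by simp

lemma smult_K_assoc: "\<lbrakk>a \<in> K; b \<in> K; x \<in> carrier V\<rbrakk> \<Longrightarrow> a \<odot> (b \<odot> x) = (a * b) \<odot> x"
  using smult_assoc1 by simp

lemma smult_K_one [simp]: "x \<in> carrier V \<Longrightarrow> 1 \<odot> x = x"
  using smult_one by simp

lemma smult_K_zero [simp]: "x \<in> carrier V \<Longrightarrow> 0 \<odot> x = \<zero>"
  using smult_l_null by simp

lemma smult_K_null [simp]: "c \<in> K \<Longrightarrow> c \<odot> \<zero> = \<zero>"
  using smult_r_null by simp

lemma neg_eq_smult: "x \<in> carrier V \<Longrightarrow> \<ominus> x = (- 1) \<odot> x"
  using smult_l_minus[of 1 x] by simp

lemma minus_self: "x \<in> carrier V \<Longrightarrow> x \<ominus> x = \<zero>"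
  by (simp add: a_minus_def M.r_neg)

lemma minus_zero: "x \<in> carrier V \<Longrightarrow> x \<ominus> \<zero> = x"
  by (simp add: a_minus_def neg_eq_smult)

end

lemma kspaceI:
  fixes V (structure)
  assumes "cx_field K" "abelian_group V"
    and "\<And>c x. \<lbrakk>c \<in> K; x \<in> carrier V\<rbrakk> \<Longrightarrow> c \<odot> x \<in> carrier V"
    and "\<And>a b x. \<lbrakk>a \<in> K; b \<in> K; x \<in> carrier V\<rbrakk> \<Longrightarrow> (a + b) \<odot> x = a \<odot> x \<oplus> b \<odot> x"
    and "\<And>a x y. \<lbrakk>a \<in> K; x \<in> carrier V; y \<in> carrier V\<rbrakk> \<Longrightarrow> a \<odot> (x \<oplus> y) = a \<odot> x \<oplus> a \<odot> y"
    and "\<And>a b x. \<lbrakk>a \<in> K; b \<in> K; x \<in> carrier V\<rbrakk> \<Longrightarrow> (a * b) \<odot> x = a \<odot> (b \<odot> x)"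
    and "\<And>x. x \<in> carrier V \<Longrightarrow> 1 \<odot> x = x"
  shows "kspace K V"
proof -
  interpret cx_field K by fact
  have "cring (cfield K)" by (rule Kf.is_cring)
  then show ?thesis
    using assms by (intro kspace.intro moduleI) simp_all
qed

text \<open>Linear subspaces in elementary form. Nearly every argument of the type "true on
  generators, hence everywhere" proves \<open>linsub\<close> for the set of vectors with the
  property and then applies a spanning lemma.\<close>

definition linsub :: "complex set \<Rightarrow> 'a calg \<Rightarrow> 'a set \<Rightarrow> bool" where
  "linsub K V U \<longleftrightarrow> U \<subseteq> carrier V \<and> \<zero>\<^bsub>V\<^esub> \<in> U \<and> (\<forall>x\<in>U. \<forall>y\<in>U. x \<oplus>\<^bsub>V\<^esub> y \<in> U)
     \<and> (\<forall>c\<in>K. \<forall>x\<in>U. c \<odot>\<^bsub>V\<^esub> x \<in> U)"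

lemma linsubI:
  assumes "U \<subseteq> carrier V" "\<zero>\<^bsub>V\<^esub> \<in> U" "\<And>x y. \<lbrakk>x \<in> U; y \<in> U\<rbrakk> \<Longrightarrow> x \<oplus>\<^bsub>V\<^esub> y \<in> U"
    and "\<And>c x. \<lbrakk>c \<in> K; x \<in> U\<rbrakk> \<Longrightarrow> c \<odot>\<^bsub>V\<^esub> x \<in> U"
  shows "linsub K V U"
  using assms by (auto simp: linsub_def)

lemma linsubD:
  assumes "linsub K V U"
  shows linsub_subset: "U \<subseteq> carrier V" and linsub_zero: "\<zero>\<^bsub>V\<^esub> \<in> U"
    and linsub_add: "\<lbrakk>x \<in> U; y \<in> U\<rbrakk> \<Longrightarrow> x \<oplus>\<^bsub>V\<^esub> y \<in> U"
    and linsub_smult: "\<lbrakk>c \<in> K; x \<in> U\<rbrakk> \<Longrightarrow> c \<odot>\<^bsub>V\<^esub> x \<in> U"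
  using assms by (auto simp: linsub_def)

context kspace
begin

lemma linsub_neg:
  assumes "linsub K V U" "x \<in> U" shows "\<ominus> x \<in> U"
proof -
  have "x \<in> carrier V" using assms linsub_subset by blast
  then show ?thesis using linsub_smult[OF assms(1), of "- 1" x] assms(2) by (simp add: neg_eq_smult)
qed

lemma linsub_diff:
  assumes "linsub K V U" "x \<in> U" "y \<in> U" shows "x \<ominus> y \<in> U"
  using linsub_add[OF assms(1) assms(2) linsub_neg[OF assms(1,3)]] by (simp add: a_minus_def)

lemma linsub_carrier: "linsub K V (carrier V)"
  by (rule linsubI) auto

lemma linsub_zero_set: "linsub K V {\<zero>}"
  by (rule linsubI) auto

lemma linsub_Inter:
  assumes "\<U> \<noteq> {}" "\<And>U. U \<in> \<U> \<Longrightarrow> linsub K V U"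
  shows "linsub K V (\<Inter>\<U>)"
  using assms unfolding linsub_def by blast

lemma linsub_finsum:
  assumes "linsub K V U" "\<And>i. i \<in> I \<Longrightarrow> g i \<in> U"
  shows "(\<Oplus>i\<in>I. g i) \<in> U"
  using assms(2)
proof (induction I rule: infinite_finite_induct)
  case (infinite I)
  then show ?case using linsub_zero[OF assms(1)] by (simp add: finsum_infinite)
next
  case empty
  then show ?case using linsub_zero[OF assms(1)] by simp
next
  case (insert i I)
  have "g \<in> I \<rightarrow> carrier V" "g i \<in> carrier V"
    using insert.prems linsub_subset[OF assms(1)] by auto
  with insert show ?case by (simp add: finsum_insert linsub_add[OF assms(1)])
qed

lemma lspan_linsub:
  assumes "S \<subseteq> carrier V" shows "linsub K V (lspan K V S)"
proof -
  have s: "LinearCombinations.submodule (cfield K) (span S) V"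
    by (rule span_is_submodule[OF assms])
  show ?thesis
    using submodule.subset[OF s] submodule.m_closed[OF s] submodule.zero_closed[OF s] submodule.smult_closed[OF s]
    by (intro linsubI) auto
qed

lemma lspan_superset: "S \<subseteq> carrier V \<Longrightarrow> S \<subseteq> lspan K V S"
  by (rule in_own_span)

lemma lspan_least:
  assumes "linsub K V U" "S \<subseteq> U" shows "lspan K V S \<subseteq> U"
proof
  fix x assume "x \<in> lspan K V S"
  then obtain a T where *: "x = lincomb a T" "T \<subseteq> S" "a \<in> T \<rightarrow> K" by (auto simp: span_def)
  show "x \<in> U"
    unfolding *(1) lincomb_def
    by (rule linsub_finsum[OF assms(1)]) (use * assms linsub_smult[OF assms(1)] in blast)
qed

text \<open>Algebraic Hahn-Banach: among the subspaces that contain \<open>U\<close> and miss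
  \<open>v\<close>, a maximal one \<open>M\<close> is a complement of the line through
  \<open>v\<close>, and the coordinate along \<open>v\<close> is the functional. No bound on the
  dimension enters, so this applies to magma algebras and to the inverse limit as well.\<close>

lemma linear_functional_separates:
  assumes U: "linsub K V U" and v: "v \<in> carrier V" "v \<notin> U"
  shows "\<exists>f\<in>linear_functionals K V. (\<forall>u\<in>U. f u = 0) \<and> f v = 1"
proof -
  let ?\<A> = "{W. linsub K V W \<and> U \<subseteq> W \<and> v \<notin> W}"
  have "\<exists>M\<in>?\<A>. \<forall>X\<in>?\<A>. M \<subseteq> X \<longrightarrow> X = M"
  proof (rule subset_Zorn_nonempty)
    show "?\<A> \<noteq> {}" using U v by auto
    fix \<C> assume C: "\<C> \<noteq> {}" "subset.chain ?\<A> \<C>"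
    then have sub: "\<And>W. W \<in> \<C> \<Longrightarrow> linsub K V W \<and> U \<subseteq> W \<and> v \<notin> W"
      by (auto simp: subset.chain_def)
    have tot: "\<exists>W\<in>\<C>. x \<in> W \<and> y \<in> W" if "x \<in> \<Union>\<C>" "y \<in> \<Union>\<C>" for x y
      using that C(2) unfolding subset_chain_def by blast
    have "linsub K V (\<Union>\<C>)"
    proof (rule linsubI)
      show "\<Union>\<C> \<subseteq> carrier V" using sub linsub_subset by blast
      show "\<zero> \<in> \<Union>\<C>"
      proof -
        obtain W where "W \<in> \<C>" using C(1) by blast
        then show ?thesis using linsub_zero[of K V W] sub[of W] by blast
      qed
      show "x \<oplus> y \<in> \<Union>\<C>" if xy: "x \<in> \<Union>\<C>" "y \<in> \<Union>\<C>" for x y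
      proof -
        obtain W where "W \<in> \<C>" "x \<in> W" "y \<in> W" using tot[OF xy] by blast
        then show ?thesis using linsub_add[of K V W x y] sub[of W] by blast
      qed
      show "c \<odot> x \<in> \<Union>\<C>" if cx: "c \<in> K" "x \<in> \<Union>\<C>" for c x
      proof -
        obtain W where "W \<in> \<C>" "x \<in> W" using cx by blast
        then show ?thesis using linsub_smult[of K V W c x] sub[of W] cx by blast
      qed
    qed
    then show "\<Union>\<C> \<in> ?\<A>" using sub C(1) by blast
  qed
  then obtain M where "M \<in> ?\<A>" and max: "\<forall>X\<in>?\<A>. M \<subseteq> X \<longrightarrow> X = M"
    by (elim bexE)
  then have M: "linsub K V M" "U \<subseteq> M" "v \<notin> M" by simp_all
  have maxM: "X = M" if "linsub K V X" "v \<notin> X" "M \<subseteq> X" for X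
    using bspec[OF max, of X] that M(2) by simp
  have Mc: "x \<in> carrier V" if "x \<in> M" for x using that M(1) linsub_subset by blast
  \<comment> \<open>If \<open>w\<close> is outside \<open>M\<close>, then \<open>M + K w\<close> is
    strictly larger than \<open>M\<close>, so by maximality it contains \<open>v\<close>. The
    coefficient of \<open>w\<close> in that expression is nonzero since \<open>v\<close> is not in
    \<open>M\<close>, and the equation can be solved for \<open>w\<close>.\<close>
  have dec: "\<exists>c\<in>K. \<exists>m\<in>M. w = m \<oplus> c \<odot> v" if w: "w \<in> carrier V" for w
  proof (cases "w \<in> M")
    case True
    then show ?thesis using v Mc by (intro bexI[of _ 0] bexI[of _ w]) auto
  next
    case False
    let ?X = "{m \<oplus> a \<odot> w | m a. m \<in> M \<and> a \<in> K}"
    have X: "linsub K V ?X"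
    proof (rule linsubI)
      show "?X \<subseteq> carrier V" using Mc w by auto
      show "\<zero> \<in> ?X" using linsub_zero[OF M(1)] w by (intro CollectI exI[of _ \<zero>] exI[of _ 0]) auto
      show "x \<oplus> y \<in> ?X" if "x \<in> ?X" "y \<in> ?X" for x y
      proof -
        from that obtain m a m' a' where *: "x = m \<oplus> a \<odot> w" "y = m' \<oplus> a' \<odot> w" "m \<in> M" "m' \<in> M" "a \<in> K" "a' \<in> K" by blast
        have "x \<oplus> y = (m \<oplus> m') \<oplus> (a + a') \<odot> w"
          using * Mc w by (simp add: smult_K_add_left M.a_ac)
        then show ?thesis using * linsub_add[OF M(1) *(3,4)]
          by (intro CollectI exI[of _ "m \<oplus> m'"] exI[of _ "a + a'"]) simp
      qed
      show "c \<odot> x \<in> ?X" if "c \<in> K" "x \<in> ?X" for c x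
      proof -
        from that obtain m a where *: "x = m \<oplus> a \<odot> w" "m \<in> M" "a \<in> K" by blast
        have "c \<odot> x = (c \<odot> m) \<oplus> (c * a) \<odot> w"
          using * Mc w that by (simp add: smult_K_add_right smult_K_assoc)
        then show ?thesis using * linsub_smult[OF M(1) that(1) *(2)] that(1)
          by (intro CollectI exI[of _ "c \<odot> m"] exI[of _ "c * a"]) simp
      qed
    qed
    have MX: "M \<subseteq> ?X"
    proof
      fix m assume "m \<in> M"
      then show "m \<in> ?X" using w Mc by (intro CollectI exI[of _ m] exI[of _ 0]) auto
    qed
    have wX: "w \<in> ?X"
      using linsub_zero[OF M(1)] w by (intro CollectI exI[of _ \<zero>] exI[of _ 1]) auto
    have "v \<in> ?X"
    proof (rule ccontr)
      assume "v \<notin> ?X"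
      from maxM[OF X this MX] wX False show False by simp
    qed
    then obtain m a where *: "v = m \<oplus> a \<odot> w" "m \<in> M" "a \<in> K" by blast
    have a: "a \<noteq> 0" using * M(3) Mc w by auto
    have "\<ominus> m \<oplus> v = a \<odot> w" using * Mc w by (simp add: M.r_neg1)
    then have "inverse a \<odot> (\<ominus> m \<oplus> v) = w" using a * w by (simp add: smult_K_assoc)
    then have "w = inverse a \<odot> (\<ominus> m) \<oplus> inverse a \<odot> v" using * Mc v by (simp add: smult_K_add_right)
    moreover have "inverse a \<odot> (\<ominus> m) \<in> M"
      using * by (intro linsub_smult[OF M(1)] linsub_neg[OF M(1)]) auto
    ultimately show ?thesis using * by (intro bexI[of _ "inverse a"] bexI[of _ "inverse a \<odot> (\<ominus> m)"]) auto
  qed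
  \<comment> \<open>Two different coefficients would put a nonzero multiple of \<open>v\<close>,
    hence \<open>v\<close> itself, into \<open>M\<close>.\<close>
  have uniq: "c = c'" if *: "m \<oplus> c \<odot> v = m' \<oplus> c' \<odot> v" "m \<in> M" "m' \<in> M" "c \<in> K" "c' \<in> K" for m m' c c'
  proof (rule ccontr)
    assume ne: "c \<noteq> c'"
    have "c \<odot> v = \<ominus> m \<oplus> (m' \<oplus> c' \<odot> v)" using * Mc v by (metis M.r_neg1 smult_K_closed)
    then have "c \<odot> v \<oplus> (- c') \<odot> v = (\<ominus> m \<oplus> m') \<oplus> (c' \<odot> v \<oplus> (- c') \<odot> v)"
      using * Mc v by (simp add: M.a_assoc)
    then have "(c - c') \<odot> v = \<ominus> m \<oplus> m'"
      using smult_K_add_left[of c "- c'" v] smult_K_add_left[of c' "- c'" v] * v Mc by simp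
    then have "(c - c') \<odot> v \<in> M" using * linsub_add[OF M(1)] linsub_neg[OF M(1)] by simp
    then have "inverse (c - c') \<odot> ((c - c') \<odot> v) \<in> M" using * linsub_smult[OF M(1)] by simp
    then show False using M(3) ne v * by (simp add: smult_K_assoc)
  qed
  define f where "f w = (THE c. c \<in> K \<and> (\<exists>m\<in>M. w = m \<oplus> c \<odot> v))" for w
  have f_eq: "f (m \<oplus> c \<odot> v) = c" if "m \<in> M" "c \<in> K" for m c
    unfolding f_def
  proof (rule the_equality)
    show "c \<in> K \<and> (\<exists>m'\<in>M. m \<oplus> c \<odot> v = m' \<oplus> c \<odot> v)" using that by blast
    show "c' = c" if "c' \<in> K \<and> (\<exists>m'\<in>M. m \<oplus> c \<odot> v = m' \<oplus> c' \<odot> v)" for c'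
      using that uniq[of m c _ c'] \<open>m \<in> M\<close> \<open>c \<in> K\<close> by metis
  qed
  have "f \<in> linear_functionals K V"
    unfolding linear_functionals_def
  proof (intro CollectI conjI ballI funcsetI)
    show "f x \<in> K" if "x \<in> carrier V" for x using dec[OF that] f_eq by auto
    show "f (x \<oplus> y) = f x + f y" if "x \<in> carrier V" "y \<in> carrier V" for x y
    proof -
      from dec that obtain m c m' c' where *: "x = m \<oplus> c \<odot> v" "m \<in> M" "c \<in> K" "y = m' \<oplus> c' \<odot> v" "m' \<in> M" "c' \<in> K" by meson
      have "x \<oplus> y = (m \<oplus> m') \<oplus> (c + c') \<odot> v"
        using * Mc v by (simp add: smult_K_add_left M.a_ac)
      then show ?thesis using * f_eq linsub_add[OF M(1)] by simp
    qed
    show "f (a \<odot> x) = a * f x" if "a \<in> K" "x \<in> carrier V" for a x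
    proof -
      from dec that obtain m c where *: "x = m \<oplus> c \<odot> v" "m \<in> M" "c \<in> K" by meson
      have "a \<odot> x = (a \<odot> m) \<oplus> (a * c) \<odot> v"
        using * Mc v that by (simp add: smult_K_add_right smult_K_assoc)
      then show ?thesis using * f_eq linsub_smult[OF M(1)] that by simp
    qed
  qed
  moreover have "f u = 0" if "u \<in> U" for u
    using f_eq[of u 0] that M(2) Mc v by auto
  moreover have "f v = 1" using f_eq[OF linsub_zero[OF M(1)], of 1] v by simp
  ultimately show ?thesis by blast
qed

lemma LF_simps:
  assumes "f \<in> linear_functionals K V"
  shows LF_closed: "x \<in> carrier V \<Longrightarrow> f x \<in> K"
    and LF_add: "\<lbrakk>x \<in> carrier V; y \<in> carrier V\<rbrakk> \<Longrightarrow> f (x \<oplus> y) = f x + f y"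
    and LF_smult: "\<lbrakk>c \<in> K; x \<in> carrier V\<rbrakk> \<Longrightarrow> f (c \<odot> x) = c * f x"
    and LF_zero: "f \<zero> = 0"
    and LF_neg: "x \<in> carrier V \<Longrightarrow> f (\<ominus> x) = - f x"
    and LF_diff: "\<lbrakk>x \<in> carrier V; y \<in> carrier V\<rbrakk> \<Longrightarrow> f (x \<ominus> y) = f x - f y"
proof -
  show 1: "x \<in> carrier V \<Longrightarrow> f x \<in> K"
    and 2: "\<And>x y. \<lbrakk>x \<in> carrier V; y \<in> carrier V\<rbrakk> \<Longrightarrow> f (x \<oplus> y) = f x + f y"
    and 3: "\<And>c x. \<lbrakk>c \<in> K; x \<in> carrier V\<rbrakk> \<Longrightarrow> f (c \<odot> x) = c * f x" for x
    using assms by (auto simp: linear_functionals_def)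
  show "f \<zero> = 0" using 3[of 0 \<zero>] by simp
  show 5: "\<And>x. x \<in> carrier V \<Longrightarrow> f (\<ominus> x) = - f x" using 3[of "- 1"] by (simp add: neg_eq_smult)
  show "\<lbrakk>x \<in> carrier V; y \<in> carrier V\<rbrakk> \<Longrightarrow> f (x \<ominus> y) = f x - f y" by (simp add: a_minus_def 2 5)
qed

lemma LF_finsum:
  assumes f: "f \<in> linear_functionals K V" and g: "\<And>i. i \<in> I \<Longrightarrow> g i \<in> carrier V"
  shows "f (\<Oplus>i\<in>I. g i) = (\<Sum>i\<in>I. f (g i))"
  using g
proof (induction I rule: infinite_finite_induct)
  case (insert i I)
  have "g \<in> I \<rightarrow> carrier V" using insert.prems by auto
  with insert show ?case by (simp add: finsum_insert LF_simps[OF f])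
qed (simp_all add: finsum_infinite LF_zero[OF f])

lemma functional_mem_linsub:
  assumes "linsub K V U" "x \<in> carrier V"
    and "\<And>f. \<lbrakk>f \<in> linear_functionals K V; \<forall>u\<in>U. f u = 0\<rbrakk> \<Longrightarrow> f x = 0"
  shows "x \<in> U"
  using linear_functional_separates[OF assms(1,2)] assms(3) by force

text \<open>The main tool for identities of vectors: after applying \<open>f\<close>, the additive
  structure is that of the complex numbers and \<open>algebra_simps\<close> does the rest.\<close>

lemma functional_eqI:
  assumes "x \<in> carrier V" "y \<in> carrier V"
    and "\<And>f. f \<in> linear_functionals K V \<Longrightarrow> f x = f y"
  shows "x = y"
proof -
  have "x \<ominus> y \<in> {\<zero>}"
    using assms by (intro functional_mem_linsub[OF linsub_zero_set]) (auto simp: LF_diff)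
  then show ?thesis using assms by simp
qed

end

declare lower_central.simps(2) [simp del]

section \<open>Algebras, homomorphisms and the lower central series\<close>

locale kalg = kspace K A for K and A :: "'a calg" (structure) +
  assumes br_closed [simp]: "\<lbrakk>x \<in> carrier A; y \<in> carrier A\<rbrakk> \<Longrightarrow> x \<otimes> y \<in> carrier A"
    and br_add_left: "\<lbrakk>x \<in> carrier A; y \<in> carrier A; z \<in> carrier A\<rbrakk> \<Longrightarrow> (x \<oplus> y) \<otimes> z = x \<otimes> z \<oplus> y \<otimes> z"
    and br_add_right: "\<lbrakk>x \<in> carrier A; y \<in> carrier A; z \<in> carrier A\<rbrakk> \<Longrightarrow> x \<otimes> (y \<oplus> z) = x \<otimes> y \<oplus> x \<otimes> z"
    and br_smult_left: "\<lbrakk>c \<in> K; x \<in> carrier A; y \<in> carrier A\<rbrakk> \<Longrightarrow> (c \<odot> x) \<otimes> y = c \<odot> (x \<otimes> y)"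
    and br_smult_right: "\<lbrakk>c \<in> K; x \<in> carrier A; y \<in> carrier A\<rbrakk> \<Longrightarrow> x \<otimes> (c \<odot> y) = c \<odot> (x \<otimes> y)"
begin

lemma br_zero_left [simp]: "x \<in> carrier A \<Longrightarrow> \<zero> \<otimes> x = \<zero>"
  using br_smult_left[of 0 \<zero> x] by simp

lemma br_zero_right [simp]: "x \<in> carrier A \<Longrightarrow> x \<otimes> \<zero> = \<zero>"
  using br_smult_right[of 0 x \<zero>] by simp

lemma br_neg_left: "\<lbrakk>x \<in> carrier A; y \<in> carrier A\<rbrakk> \<Longrightarrow> (\<ominus> x) \<otimes> y = \<ominus> (x \<otimes> y)"
  using br_smult_left[of "- 1" x y] by (simp add: neg_eq_smult)

lemma br_neg_right: "\<lbrakk>x \<in> carrier A; y \<in> carrier A\<rbrakk> \<Longrightarrow> x \<otimes> (\<ominus> y) = \<ominus> (x \<otimes> y)"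
  using br_smult_right[of "- 1" x y] by (simp add: neg_eq_smult)

lemma br_diff_left: "\<lbrakk>x \<in> carrier A; y \<in> carrier A; z \<in> carrier A\<rbrakk> \<Longrightarrow> (x \<ominus> y) \<otimes> z = x \<otimes> z \<ominus> y \<otimes> z"
  by (simp add: a_minus_def br_add_left br_neg_left)

lemma br_diff_right: "\<lbrakk>x \<in> carrier A; y \<in> carrier A; z \<in> carrier A\<rbrakk> \<Longrightarrow> x \<otimes> (y \<ominus> z) = x \<otimes> y \<ominus> x \<otimes> z"
  by (simp add: a_minus_def br_add_right br_neg_right)

lemma linsub_br_left:
  assumes "linsub K A U" "y \<in> carrier A" shows "linsub K A {x \<in> carrier A. x \<otimes> y \<in> U}"
  using assms linsubD[OF assms(1)] by (intro linsubI) (auto simp: br_add_left br_smult_left)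

lemma linsub_br_right:
  assumes "linsub K A U" "y \<in> carrier A" shows "linsub K A {x \<in> carrier A. y \<otimes> x \<in> U}"
  using assms linsubD[OF assms(1)] by (intro linsubI) (auto simp: br_add_right br_smult_right)

lemma bracket_span_linsub:
  assumes "U \<subseteq> carrier A" "W \<subseteq> carrier A" shows "linsub K A (bracket_span K A U W)"
  unfolding bracket_span_def by (rule lspan_linsub) (use assms in \<open>auto simp: subset_iff\<close>)

lemma bracket_span_mem:
  assumes "U \<subseteq> carrier A" "W \<subseteq> carrier A" "x \<in> U" "y \<in> W" shows "x \<otimes> y \<in> bracket_span K A U W"
proof -
  have "{x \<otimes> y | x y. x \<in> U \<and> y \<in> W} \<subseteq> carrier A" using assms by (auto simp: subset_iff)
  moreover have "x \<otimes> y \<in> {x \<otimes> y | x y. x \<in> U \<and> y \<in> W}" using assms(3,4) by auto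
  ultimately show ?thesis unfolding bracket_span_def using lspan_superset by (meson subsetD)
qed

lemma bracket_span_least:
  assumes "linsub K A T" "\<And>x y. \<lbrakk>x \<in> U; y \<in> W\<rbrakk> \<Longrightarrow> x \<otimes> y \<in> T" shows "bracket_span K A U W \<subseteq> T"
  unfolding bracket_span_def by (rule lspan_least) (use assms in auto)

lemma lc_1 [simp]: "lower_central K A (Suc 0) = carrier A"
  by (simp add: lower_central.simps)

lemma lc_Suc: "k \<ge> 1 \<Longrightarrow> lower_central K A (Suc k) = bracket_span K A (carrier A) (lower_central K A k)"
  by (simp add: lower_central.simps)

lemma lc_2: "lower_central K A 2 = derived K A"
  by (simp add: numeral_2_eq_2 lower_central.simps)

lemma lc_linsub: "linsub K A (lower_central K A k)"
proof (induction k)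
  case (Suc k)
  then show ?case using bracket_span_linsub[OF _ linsub_subset[OF Suc]] by (simp add: linsub_carrier lower_central.simps)
qed (simp add: linsub_carrier)

lemma lc_subset: "lower_central K A k \<subseteq> carrier A"
  by (rule linsub_subset[OF lc_linsub])

lemma lc_br: "\<lbrakk>k \<ge> 1; x \<in> carrier A; y \<in> lower_central K A k\<rbrakk> \<Longrightarrow> x \<otimes> y \<in> lower_central K A (Suc k)"
  using bracket_span_mem[OF _ lc_subset] by (simp add: lc_Suc)

lemma lc_Suc_least:
  assumes "linsub K A T" "k \<ge> 1" "\<And>x y. \<lbrakk>x \<in> carrier A; y \<in> lower_central K A k\<rbrakk> \<Longrightarrow> x \<otimes> y \<in> T"
  shows "lower_central K A (Suc k) \<subseteq> T"
  using bracket_span_least[OF assms(1,3)] assms(2) by (simp add: lc_Suc)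

lemma lc_decr: "k \<ge> 1 \<Longrightarrow> lower_central K A (Suc k) \<subseteq> lower_central K A k"
proof (induction k rule: nat_induct_at_least)
  case base
  then show ?case using lc_subset[of "Suc 1"] by simp
next
  case (Suc k)
  then show ?case using lc_br by (intro lc_Suc_least lc_linsub) auto
qed

end

locale lie_alg = kalg +
  assumes br_self [simp]: "x \<in> carrier A \<Longrightarrow> x \<otimes> x = \<zero>"
    and jacobi: "\<lbrakk>x \<in> carrier A; y \<in> carrier A; z \<in> carrier A\<rbrakk> \<Longrightarrow>
      x \<otimes> (y \<otimes> z) \<oplus> y \<otimes> (z \<otimes> x) \<oplus> z \<otimes> (x \<otimes> y) = \<zero>"
begin

lemma br_anti:
  assumes "x \<in> carrier A" "y \<in> carrier A" shows "x \<otimes> y = \<ominus> (y \<otimes> x)"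
proof (rule functional_eqI)
  fix f assume f: "f \<in> linear_functionals K A"
  have "f ((x \<oplus> y) \<otimes> (x \<oplus> y)) = f (x \<otimes> x) + f (x \<otimes> y) + (f (y \<otimes> x) + f (y \<otimes> y))"
    using assms by (simp add: br_add_left br_add_right LF_simps[OF f] del: br_self)
  then show "f (x \<otimes> y) = f (\<ominus> (y \<otimes> x))"
    using assms by (simp add: br_add_left br_add_right LF_simps[OF f] eq_neg_iff_add_eq_0)
qed (use assms in auto)

lemma br_br:
  assumes "x \<in> carrier A" "y \<in> carrier A" "z \<in> carrier A"
  shows "(x \<otimes> y) \<otimes> z = x \<otimes> (y \<otimes> z) \<ominus> y \<otimes> (x \<otimes> z)"
proof (rule functional_eqI)
  fix f assume f: "f \<in> linear_functionals K A"
  have "f (x \<otimes> (y \<otimes> z) \<oplus> y \<otimes> (z \<otimes> x) \<oplus> z \<otimes> (x \<otimes> y)) = f \<zero>" using jacobi assms by simp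
  then have "f (x \<otimes> (y \<otimes> z)) + f (y \<otimes> (z \<otimes> x)) + f (z \<otimes> (x \<otimes> y)) = 0"
    using assms by (simp add: LF_simps[OF f])
  moreover have "z \<otimes> (x \<otimes> y) = \<ominus> ((x \<otimes> y) \<otimes> z)" using assms by (intro br_anti) auto
  moreover have "y \<otimes> (z \<otimes> x) = \<ominus> (y \<otimes> (x \<otimes> z))" using assms br_anti[of z x] by (simp add: br_neg_right)
  ultimately show "f ((x \<otimes> y) \<otimes> z) = f (x \<otimes> (y \<otimes> z) \<ominus> y \<otimes> (x \<otimes> z))"
    using assms by (simp add: LF_simps[OF f] algebra_simps)
qed (use assms in auto)

lemma lc_ideal: "k \<ge> 1 \<Longrightarrow> x \<in> lower_central K A k \<Longrightarrow> a \<in> carrier A \<Longrightarrow>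
   a \<otimes> x \<in> lower_central K A k \<and> x \<otimes> a \<in> lower_central K A k"
proof -
  assume *: "k \<ge> 1" "x \<in> lower_central K A k" "a \<in> carrier A"
  then have "a \<otimes> x \<in> lower_central K A k" using lc_br lc_decr by blast
  moreover have "x \<otimes> a = \<ominus> (a \<otimes> x)" using * lc_subset br_anti by blast
  ultimately show ?thesis using linsub_neg[OF lc_linsub] by simp
qed

text \<open>By the Jacobi identity [[a, b], y] = [a, [b, y]] - [b, [a, y]], where both terms raise
  \<open>y\<close> by two steps. This is the one instance of [L_i, L_j] in L_(i+j) with i > 1 that
  is used below.\<close>

lemma lc_2_br:
  assumes "m \<ge> 1" "x \<in> lower_central K A 2" "y \<in> lower_central K A m"
  shows "x \<otimes> y \<in> lower_central K A (Suc (Suc m))"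
proof -
  have y: "y \<in> carrier A" using assms lc_subset by blast
  have "lower_central K A (Suc 1) \<subseteq> {x \<in> carrier A. x \<otimes> y \<in> lower_central K A (Suc (Suc m))}"
  proof (rule lc_Suc_least[OF linsub_br_left[OF lc_linsub y]])
    fix a b assume ab: "a \<in> carrier A" "b \<in> lower_central K A 1"
    then have "(a \<otimes> b) \<otimes> y = a \<otimes> (b \<otimes> y) \<ominus> b \<otimes> (a \<otimes> y)" using y by (intro br_br) auto
    moreover have "a \<otimes> (b \<otimes> y) \<in> lower_central K A (Suc (Suc m))" "b \<otimes> (a \<otimes> y) \<in> lower_central K A (Suc (Suc m))"
      using ab assms by (intro lc_br; simp)+
    ultimately show "a \<otimes> b \<in> {x \<in> carrier A. x \<otimes> y \<in> lower_central K A (Suc (Suc m))}"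
      using ab linsub_diff[OF lc_linsub] by simp
  qed simp
  then show ?thesis using assms by (auto simp: numeral_2_eq_2)
qed

end

section \<open>Homomorphisms and transport of structure along surjections\<close>

lemma module_homI:
  assumes "\<And>x. x \<in> carrier A \<Longrightarrow> f x \<in> carrier B"
    and "\<And>x y. \<lbrakk>x \<in> carrier A; y \<in> carrier A\<rbrakk> \<Longrightarrow> f (x \<oplus>\<^bsub>A\<^esub> y) = f x \<oplus>\<^bsub>B\<^esub> f y"
    and "\<And>c x. \<lbrakk>c \<in> K; x \<in> carrier A\<rbrakk> \<Longrightarrow> f (c \<odot>\<^bsub>A\<^esub> x) = c \<odot>\<^bsub>B\<^esub> f x"
  shows "f \<in> module_hom (cfield K) A B"
  using assms by (auto simp: module_hom_def)

locale khom = A: kspace K A + B: kspace K B for K and A :: "'a calg" and B :: "'b calg" and f +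
  assumes hom: "f \<in> module_hom (cfield K) A B"
begin

lemma hom_closed [simp]: "x \<in> carrier A \<Longrightarrow> f x \<in> carrier B"
  and hom_add: "\<lbrakk>x \<in> carrier A; y \<in> carrier A\<rbrakk> \<Longrightarrow> f (x \<oplus>\<^bsub>A\<^esub> y) = f x \<oplus>\<^bsub>B\<^esub> f y"
  and hom_smult: "\<lbrakk>c \<in> K; x \<in> carrier A\<rbrakk> \<Longrightarrow> f (c \<odot>\<^bsub>A\<^esub> x) = c \<odot>\<^bsub>B\<^esub> f x"
  using hom by (auto simp: module_hom_def)

lemma hom_zero [simp]: "f \<zero>\<^bsub>A\<^esub> = \<zero>\<^bsub>B\<^esub>"
  using hom_smult[of 0 "\<zero>\<^bsub>A\<^esub>"] by simp

lemma hom_neg: "x \<in> carrier A \<Longrightarrow> f (\<ominus>\<^bsub>A\<^esub> x) = \<ominus>\<^bsub>B\<^esub> f x"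
  using hom_smult[of "- 1" x] by (simp add: A.neg_eq_smult B.neg_eq_smult)

lemma hom_diff: "\<lbrakk>x \<in> carrier A; y \<in> carrier A\<rbrakk> \<Longrightarrow> f (x \<ominus>\<^bsub>A\<^esub> y) = f x \<ominus>\<^bsub>B\<^esub> f y"
  by (simp add: a_minus_def hom_add hom_neg)

lemma hom_finsum:
  assumes "\<And>i. i \<in> I \<Longrightarrow> g i \<in> carrier A"
  shows "f (\<Oplus>\<^bsub>A\<^esub> i\<in>I. g i) = (\<Oplus>\<^bsub>B\<^esub> i\<in>I. f (g i))"
  using assms
proof (induction I rule: infinite_finite_induct)
  case (insert i I)
  have "g \<in> I \<rightarrow> carrier A" "(\<lambda>i. f (g i)) \<in> I \<rightarrow> carrier B" using insert.prems by auto
  with insert show ?case by (simp add: A.finsum_insert B.finsum_insert hom_add)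
qed (simp_all add: A.finsum_infinite B.finsum_infinite)

lemma linsub_vimage: "linsub K B U \<Longrightarrow> linsub K A {x \<in> carrier A. f x \<in> U}"
  using linsubD[of K B U] by (intro linsubI) (auto simp: hom_add hom_smult)

lemma linsub_image:
  assumes "linsub K A U" shows "linsub K B (f ` U)"
proof -
  note U = linsubD[OF assms]
  have c: "x \<in> carrier A" if "x \<in> U" for x using that U(1) by blast
  show ?thesis
  proof (rule linsubI)
    show "f ` U \<subseteq> carrier B" using U(1) by auto
    show "\<zero>\<^bsub>B\<^esub> \<in> f ` U" using U(2) by (metis hom_zero imageI)
    show "x \<oplus>\<^bsub>B\<^esub> y \<in> f ` U" if "x \<in> f ` U" "y \<in> f ` U" for x y
      using that U(3) c by (auto simp flip: hom_add)
    show "a \<odot>\<^bsub>B\<^esub> x \<in> f ` U" if "a \<in> K" "x \<in> f ` U" for a x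
      using that U(4) c by (auto simp flip: hom_smult)
  qed
qed

lemma LF_comp: "\<phi> \<in> linear_functionals K B \<Longrightarrow> (\<lambda>x. \<phi> (f x)) \<in> linear_functionals K A"
  by (auto simp: linear_functionals_def hom_add hom_smult)

end

locale ahom = A: kalg K A + B: kalg K B + khom K A B f
  for K and A :: "'a calg" and B :: "'b calg" and f +
  assumes hom_br: "\<lbrakk>x \<in> carrier A; y \<in> carrier A\<rbrakk> \<Longrightarrow> f (x \<otimes>\<^bsub>A\<^esub> y) = f x \<otimes>\<^bsub>B\<^esub> f y"
begin

lemma image_bracket_span:
  assumes U: "U \<subseteq> carrier A" and W: "W \<subseteq> carrier A"
  shows "f ` bracket_span K A U W = bracket_span K B (f ` U) (f ` W)"
proof
  have fU: "f ` U \<subseteq> carrier B" and fW: "f ` W \<subseteq> carrier B" using U W by auto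
  have "bracket_span K A U W \<subseteq> {x \<in> carrier A. f x \<in> bracket_span K B (f ` U) (f ` W)}"
  proof (rule A.bracket_span_least)
    show "linsub K A {x \<in> carrier A. f x \<in> bracket_span K B (f ` U) (f ` W)}"
      by (rule linsub_vimage[OF B.bracket_span_linsub[OF fU fW]])
    fix x y assume "x \<in> U" "y \<in> W"
    then show "x \<otimes>\<^bsub>A\<^esub> y \<in> {x \<in> carrier A. f x \<in> bracket_span K B (f ` U) (f ` W)}"
      using U W B.bracket_span_mem[OF fU fW] by (auto simp: hom_br subset_iff)
  qed
  then show "f ` bracket_span K A U W \<subseteq> bracket_span K B (f ` U) (f ` W)" by auto
  show "bracket_span K B (f ` U) (f ` W) \<subseteq> f ` bracket_span K A U W"
  proof (rule B.bracket_span_least)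
    show "linsub K B (f ` bracket_span K A U W)"
      by (rule linsub_image[OF A.bracket_span_linsub[OF U W]])
    fix x y assume "x \<in> f ` U" "y \<in> f ` W"
    then obtain u w where "u \<in> U" "w \<in> W" "x = f u" "y = f w" by blast
    then show "x \<otimes>\<^bsub>B\<^esub> y \<in> f ` bracket_span K A U W"
      using U W A.bracket_span_mem[OF U W] by (auto simp: subset_iff simp flip: hom_br)
  qed
qed

lemma image_lc_subset: "f ` lower_central K A k \<subseteq> lower_central K B k"
proof (induction k)
  case (Suc k)
  have "bracket_span K B (f ` carrier A) (f ` lower_central K A k)
      \<subseteq> bracket_span K B (carrier B) (lower_central K B k)"
    using Suc B.bracket_span_mem[OF _ B.lc_subset]
    by (intro B.bracket_span_least B.bracket_span_linsub B.lc_subset) auto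
  then show ?case using image_bracket_span[OF _ A.lc_subset] by (auto simp: lower_central.simps)
qed auto

lemma image_lc:
  assumes "f ` carrier A = carrier B" shows "f ` lower_central K A k = lower_central K B k"
  by (induction k) (simp_all add: assms image_bracket_span A.lc_subset lower_central.simps)

end

text \<open>Only the compatibility of the operations with the surjection \<pi> is assumed of
  \<open>B\<close>. This is how quotient algebras inherit their axioms without any choice of
  representatives.\<close>

lemma kspace_image:
  assumes "kspace K A" and car: "carrier B = \<pi> ` carrier A"
    and add: "\<And>x y. \<lbrakk>x \<in> carrier A; y \<in> carrier A\<rbrakk> \<Longrightarrow> \<pi> (x \<oplus>\<^bsub>A\<^esub> y) = \<pi> x \<oplus>\<^bsub>B\<^esub> \<pi> y"
    and zero: "\<zero>\<^bsub>B\<^esub> = \<pi> \<zero>\<^bsub>A\<^esub>"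
    and smult: "\<And>c x. \<lbrakk>c \<in> K; x \<in> carrier A\<rbrakk> \<Longrightarrow> \<pi> (c \<odot>\<^bsub>A\<^esub> x) = c \<odot>\<^bsub>B\<^esub> \<pi> x"
  shows "kspace K B"
proof -
  interpret A: kspace K A by fact
  show ?thesis
  proof (rule kspaceI)
    show "cx_field K" ..
    show "abelian_group B"
    proof (rule abelian_groupI)
      fix x assume "x \<in> carrier B"
      then obtain a where "a \<in> carrier A" "x = \<pi> a" using car by auto
      then show "\<exists>y\<in>carrier B. y \<oplus>\<^bsub>B\<^esub> x = \<zero>\<^bsub>B\<^esub>"
        by (intro bexI[of _ "\<pi> (\<ominus>\<^bsub>A\<^esub> a)"]) (auto simp: car zero A.M.l_neg simp flip: add)
    qed (auto simp: car zero A.M.a_ac simp flip: add)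
  qed (auto simp: car A.smult_K_add_left A.smult_K_add_right A.smult_K_assoc simp flip: add smult)
qed

lemma kalg_image:
  assumes "kalg K A" and car: "carrier B = \<pi> ` carrier A"
    and add: "\<And>x y. \<lbrakk>x \<in> carrier A; y \<in> carrier A\<rbrakk> \<Longrightarrow> \<pi> (x \<oplus>\<^bsub>A\<^esub> y) = \<pi> x \<oplus>\<^bsub>B\<^esub> \<pi> y"
    and zero: "\<zero>\<^bsub>B\<^esub> = \<pi> \<zero>\<^bsub>A\<^esub>"
    and smult: "\<And>c x. \<lbrakk>c \<in> K; x \<in> carrier A\<rbrakk> \<Longrightarrow> \<pi> (c \<odot>\<^bsub>A\<^esub> x) = c \<odot>\<^bsub>B\<^esub> \<pi> x"
    and br: "\<And>x y. \<lbrakk>x \<in> carrier A; y \<in> carrier A\<rbrakk> \<Longrightarrow> \<pi> (x \<otimes>\<^bsub>A\<^esub> y) = \<pi> x \<otimes>\<^bsub>B\<^esub> \<pi> y"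
  shows "kalg K B" "ahom K A B \<pi>"
proof -
  interpret A: kalg K A by fact
  interpret B: kspace K B by (rule kspace_image[OF A.kspace_axioms assms(2-5)])
  show "kalg K B"
    by unfold_locales
      (auto simp: car A.br_add_left A.br_add_right A.br_smult_left A.br_smult_right simp flip: add smult br)
  then interpret B: kalg K B .
  show "ahom K A B \<pi>"
    by unfold_locales (auto intro!: module_homI simp: add smult br car)
qed

lemma lie_alg_image:
  assumes "lie_alg K A" "ahom K A B \<pi>" and car: "carrier B = \<pi> ` carrier A"
  shows "lie_alg K B"
proof -
  interpret A: lie_alg K A by fact
  interpret ahom K A B \<pi> by fact
  show ?thesis
  proof
    fix x assume "x \<in> carrier B"
    then show "x \<otimes>\<^bsub>B\<^esub> x = \<zero>\<^bsub>B\<^esub>" by (auto simp: car simp flip: hom_br)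
  next
    fix x y z assume "x \<in> carrier B" "y \<in> carrier B" "z \<in> carrier B"
    then obtain a b c where "x = \<pi> a" "y = \<pi> b" "z = \<pi> c" "a \<in> carrier A" "b \<in> carrier A" "c \<in> carrier A"
      using car by auto
    then show "x \<otimes>\<^bsub>B\<^esub> (y \<otimes>\<^bsub>B\<^esub> z) \<oplus>\<^bsub>B\<^esub> y \<otimes>\<^bsub>B\<^esub> (z \<otimes>\<^bsub>B\<^esub> x) \<oplus>\<^bsub>B\<^esub> z \<otimes>\<^bsub>B\<^esub> (x \<otimes>\<^bsub>B\<^esub> y) = \<zero>\<^bsub>B\<^esub>"
      by (simp add: A.jacobi flip: hom_br hom_add)
  qed
qed

section \<open>Quotient algebras\<close>

lemma (in kalg) alg_idealI:
  assumes "linsub K A I" "\<And>a x. \<lbrakk>a \<in> carrier A; x \<in> I\<rbrakk> \<Longrightarrow> a \<otimes> x \<in> I \<and> x \<otimes> a \<in> I"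
  shows "alg_ideal K A I"
proof -
  have "subgroup I (add_monoid A)"
    using assms linsubD[OF assms(1)] linsub_neg[OF assms(1)]
    by (intro subgroup.intro) (auto simp: a_inv_def)
  then show ?thesis
    using assms linsubD[OF assms(1)] by (auto simp: alg_ideal_def intro: additive_subgroupI)
qed

lemma alg_ideal_linsub:
  assumes "alg_ideal K A I" shows "linsub K A I"
proof -
  interpret additive_subgroup I A using assms by (simp add: alg_ideal_def)
  show ?thesis using assms a_subset by (intro linsubI) (auto simp: alg_ideal_def)
qed

lemma (in lie_alg) lc_alg_ideal: "k \<ge> 1 \<Longrightarrow> alg_ideal K A (lower_central K A k)"
  using lc_ideal by (intro alg_idealI lc_linsub) blast

locale kalg_ideal = kalg + fixes I assumes ideal: "alg_ideal K A I"
begin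

lemma I_linsub: "linsub K A I"
  by (rule alg_ideal_linsub[OF ideal])

lemma I_subset: "I \<subseteq> carrier A"
  by (rule linsub_subset[OF I_linsub])

lemma I_br: "\<lbrakk>a \<in> carrier A; x \<in> I\<rbrakk> \<Longrightarrow> a \<otimes> x \<in> I" "\<lbrakk>a \<in> carrier A; x \<in> I\<rbrakk> \<Longrightarrow> x \<otimes> a \<in> I"
  using ideal by (auto simp: alg_ideal_def)

sublocale I: abelian_subgroup I A
  using ideal by (intro abelian_subgroupI3 abelian_group_axioms) (simp add: alg_ideal_def)

lemma mem_rcos:
  assumes "x \<in> carrier A" shows "z \<in> I +> x \<longleftrightarrow> z \<in> carrier A \<and> z \<ominus> x \<in> I"
proof
  assume "z \<in> I +> x"
  then obtain i where "i \<in> I" "z = i \<oplus> x" by (auto simp: a_r_coset_def')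
  moreover from this have "z \<ominus> x = i" using assms I_subset by (auto simp: a_minus_def M.a_assoc M.r_neg)
  ultimately show "z \<in> carrier A \<and> z \<ominus> x \<in> I" using assms I_subset by auto
next
  assume z: "z \<in> carrier A \<and> z \<ominus> x \<in> I"
  then have "z = (z \<ominus> x) \<oplus> x" using assms by (simp add: a_minus_def M.a_assoc M.l_neg)
  then show "z \<in> I +> x" using z by (auto simp: a_r_coset_def')
qed

lemma rcos_self: "x \<in> carrier A \<Longrightarrow> x \<in> I +> x"
  using linsub_zero[OF I_linsub] by (simp add: mem_rcos minus_self)

lemma rcos_eq:
  assumes "x \<in> carrier A" "y \<in> carrier A" shows "I +> x = I +> y \<longleftrightarrow> x \<ominus> y \<in> I"
proof
  assume "I +> x = I +> y"
  then show "x \<ominus> y \<in> I" using rcos_self[OF assms(1)] mem_rcos[OF assms(2)] by simp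
next
  assume "x \<ominus> y \<in> I"
  then have "x \<in> I +> y" using assms(1) mem_rcos[OF assms(2)] by simp
  then show "I +> x = I +> y" using I.a_repr_independence'[OF _ assms(2)] by simp
qed

text \<open>The operations of \<open>quot_alg\<close> and the maps \<open>quot_map\<close> are
  defined as unions over all representatives of a coset. Such a union collapses to a single member
  as soon as the value does not depend on the representative.\<close>

lemma rcos_UN:
  assumes "x \<in> carrier A" "\<And>y. \<lbrakk>y \<in> carrier A; y \<ominus> x \<in> I\<rbrakk> \<Longrightarrow> g y = g x"
  shows "(\<Union>y\<in>I +> x. g y) = g x"
proof -
  have "g y = g x" if "y \<in> I +> x" for y using that assms(2) mem_rcos[OF assms(1)] by blast
  then show ?thesis using rcos_self[OF assms(1)] by blast
qed

lemma carrier_quot: "carrier (quot_alg A I) = (\<lambda>x. I +> x) ` carrier A"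
  by (auto simp: quot_alg_def ring.defs FactRing_def A_RCOSETS_def')

lemma quot_add: "\<lbrakk>x \<in> carrier A; y \<in> carrier A\<rbrakk> \<Longrightarrow> (I +> x) \<oplus>\<^bsub>quot_alg A I\<^esub> (I +> y) = I +> (x \<oplus> y)"
  by (simp add: quot_alg_def ring.defs FactRing_def I.a_rcos_sum)

lemma quot_zero: "\<zero>\<^bsub>quot_alg A I\<^esub> = I +> \<zero>"
  using M.a_coset_add_zero I_subset by (simp add: quot_alg_def ring.defs FactRing_def)

lemma quot_smult:
  assumes "c \<in> K" "x \<in> carrier A" shows "c \<odot>\<^bsub>quot_alg A I\<^esub> (I +> x) = I +> (c \<odot> x)"
proof -
  have "(\<Union>y\<in>I +> x. I +> (c \<odot> y)) = I +> (c \<odot> x)"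
  proof (rule rcos_UN[OF assms(2)])
    fix y assume y: "y \<in> carrier A" "y \<ominus> x \<in> I"
    have "c \<odot> y \<ominus> c \<odot> x = c \<odot> (y \<ominus> x)"
      using assms y by (simp add: a_minus_def smult_K_add_right neg_eq_smult smult_K_assoc mult.commute)
    then show "I +> c \<odot> y = I +> c \<odot> x"
      using assms y linsub_smult[OF I_linsub] by (simp add: rcos_eq)
  qed
  then show ?thesis by (simp add: quot_alg_def ring.defs)
qed

lemma quot_br:
  assumes "x \<in> carrier A" "y \<in> carrier A" shows "(I +> x) \<otimes>\<^bsub>quot_alg A I\<^esub> (I +> y) = I +> (x \<otimes> y)"
proof -
  have eq: "I +> a \<otimes> b = I +> x \<otimes> y" if "a \<in> carrier A" "a \<ominus> x \<in> I" "b \<in> carrier A" "b \<ominus> y \<in> I" for a b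
  proof -
    have "a \<otimes> b \<ominus> x \<otimes> y = (a \<ominus> x) \<otimes> b \<oplus> x \<otimes> (b \<ominus> y)"
    proof (rule functional_eqI)
      fix f assume f: "f \<in> linear_functionals K A"
      show "f (a \<otimes> b \<ominus> x \<otimes> y) = f ((a \<ominus> x) \<otimes> b \<oplus> x \<otimes> (b \<ominus> y))"
        using assms that by (simp add: br_diff_left br_diff_right LF_simps[OF f])
    qed (use assms that in auto)
    then have "a \<otimes> b \<ominus> x \<otimes> y \<in> I"
      using linsub_add[OF I_linsub I_br(2)[OF that(3,2)] I_br(1)[OF assms(1) that(4)]] by simp
    then show ?thesis using assms that by (simp add: rcos_eq)
  qed
  have "(\<Union>a\<in>I +> x. \<Union>b\<in>I +> y. I +> (a \<otimes> b)) = (\<Union>b\<in>I +> y. I +> (x \<otimes> b))"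
  proof (rule rcos_UN[OF assms(1)], rule SUP_cong[OF refl])
    fix a b assume "a \<in> carrier A" "a \<ominus> x \<in> I" "b \<in> I +> y"
    then show "I +> a \<otimes> b = I +> x \<otimes> b"
      using eq[of a b] eq[of x b] assms linsub_zero[OF I_linsub] by (simp add: mem_rcos minus_self)
  qed
  also have "\<dots> = I +> (x \<otimes> y)"
    using assms linsub_zero[OF I_linsub] by (intro rcos_UN eq) (simp_all add: minus_self)
  finally show ?thesis by (simp add: quot_alg_def ring.defs FactRing_def rcoset_mult_def)
qed

lemma kalg_quot: "kalg K (quot_alg A I)" and ahom_quot: "ahom K A (quot_alg A I) (\<lambda>x. I +> x)"
  using kalg_image[OF kalg_axioms carrier_quot] by (auto simp: quot_add quot_zero quot_smult quot_br)

lemma quot_eq_zero: "x \<in> carrier A \<Longrightarrow> I +> x = \<zero>\<^bsub>quot_alg A I\<^esub> \<longleftrightarrow> x \<in> I"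
  by (simp add: quot_zero rcos_eq minus_zero)

end

lemma kalg_idealI: "\<lbrakk>kalg K A; alg_ideal K A I\<rbrakk> \<Longrightarrow> kalg_ideal K A I"
  by (simp add: kalg_ideal.intro kalg_ideal_axioms_def)

lemma lie_alg_quot:
  assumes "lie_alg K A" "alg_ideal K A I" shows "lie_alg K (quot_alg A I)"
proof -
  interpret lie_alg K A by fact
  interpret kalg_ideal K A I by (rule kalg_idealI[OF kalg_axioms assms(2)])
  show ?thesis by (rule lie_alg_image[OF assms(1) ahom_quot carrier_quot])
qed

locale quot_khom = A: kalg_ideal K A I + B: kalg_ideal K B J + khom K A B f
  for K and A :: "'a calg" and I and B :: "'b calg" and J and f +
  assumes ideal_into: "x \<in> I \<Longrightarrow> f x \<in> J"
begin

lemma quot_map_rcos: "x \<in> carrier A \<Longrightarrow> quot_map A I B J f (I +>\<^bsub>A\<^esub> x) = J +>\<^bsub>B\<^esub> f x"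
proof -
  assume x: "x \<in> carrier A"
  have "(\<Union>y\<in>I +>\<^bsub>A\<^esub> x. J +>\<^bsub>B\<^esub> f y) = J +>\<^bsub>B\<^esub> f x"
    using x ideal_into by (intro A.rcos_UN) (auto simp: B.rcos_eq simp flip: hom_diff)
  then show ?thesis using x A.carrier_quot by (auto simp: quot_map_def)
qed

lemma khom_quot_map: "khom K (quot_alg A I) (quot_alg B J) (quot_map A I B J f)"
proof -
  interpret QA: kalg K "quot_alg A I" by (rule A.kalg_quot)
  interpret QB: kalg K "quot_alg B J" by (rule B.kalg_quot)
  show ?thesis
    by unfold_locales
      (auto intro!: module_homI simp: A.carrier_quot B.carrier_quot quot_map_rcos A.quot_add B.quot_add
        A.quot_smult B.quot_smult hom_add hom_smult)
qed

lemma ahom_quot_map: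
  assumes "\<And>x y. \<lbrakk>x \<in> carrier A; y \<in> carrier A\<rbrakk> \<Longrightarrow> f (x \<otimes>\<^bsub>A\<^esub> y) = f x \<otimes>\<^bsub>B\<^esub> f y"
  shows "ahom K (quot_alg A I) (quot_alg B J) (quot_map A I B J f)"
proof -
  interpret QA: kalg K "quot_alg A I" by (rule A.kalg_quot)
  interpret QB: kalg K "quot_alg B J" by (rule B.kalg_quot)
  interpret q: khom K "quot_alg A I" "quot_alg B J" "quot_map A I B J f" by (rule khom_quot_map)
  show ?thesis
    by unfold_locales (auto simp: A.carrier_quot B.carrier_quot quot_map_rcos A.quot_br B.quot_br assms)
qed

end

lemma (in kalg) alg_ideal_Inter:
  assumes "\<U> \<noteq> {}" "\<And>U. U \<in> \<U> \<Longrightarrow> alg_ideal K A U" shows "alg_ideal K A (\<Inter>\<U>)"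
proof (rule alg_idealI)
  show "linsub K A (\<Inter>\<U>)" using assms alg_ideal_linsub by (intro linsub_Inter) blast+
  fix a x assume "a \<in> carrier A" "x \<in> \<Inter>\<U>"
  then show "a \<otimes> x \<in> \<Inter>\<U> \<and> x \<otimes> a \<in> \<Inter>\<U>" using assms(2) unfolding alg_ideal_def by blast
qed

lemma (in kalg) ideal_generated:
  assumes "S \<subseteq> carrier A"
  shows alg_ideal_ideal_generated: "alg_ideal K A (ideal_generated K A S)"
    and ideal_generated_superset: "S \<subseteq> ideal_generated K A S"
proof -
  have "alg_ideal K A (carrier A)" by (intro alg_idealI linsub_carrier) auto
  then show "alg_ideal K A (ideal_generated K A S)"
    unfolding ideal_generated_def using assms by (intro alg_ideal_Inter) auto
  show "S \<subseteq> ideal_generated K A S" by (auto simp: ideal_generated_def)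
qed

section \<open>Magma algebras\<close>

text \<open>The free nonassociative algebra and the space \<open>tensor_pre\<close> are both spaces
  with a multiplicatively closed basis, so they are treated together.\<close>

locale magma = cx_field K for K +
  fixes M :: "'m set" and m :: "'m \<Rightarrow> 'm \<Rightarrow> 'm"
  assumes m_closed: "\<lbrakk>v \<in> M; w \<in> M\<rbrakk> \<Longrightarrow> m v w \<in> M"
begin

abbreviation "MA \<equiv> magma_alg K M m"

abbreviation supp :: "('m \<Rightarrow> complex) \<Rightarrow> 'm set" where "supp F \<equiv> {v. F v \<noteq> 0}"

lemma MA_simps [simp]:
  "\<zero>\<^bsub>MA\<^esub> = (\<lambda>_. 0)" "F \<oplus>\<^bsub>MA\<^esub> G = (\<lambda>x. F x + G x)" "c \<odot>\<^bsub>MA\<^esub> F = (\<lambda>x. c * F x)"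
  by (simp_all add: magma_alg_def)

lemma MA_carrier: "F \<in> carrier MA \<longleftrightarrow> finite (supp F) \<and> supp F \<subseteq> M \<and> (\<forall>v. F v \<in> K)"
  by (auto simp: magma_alg_def)

text \<open>The index set in the definition of the product varies with both factors. Any finite sets
  that contain the supports may be used instead, which gives sums of products a common index
  set.\<close>

lemma MA_mult:
  assumes "finite S" "supp F \<subseteq> S" "finite T" "supp G \<subseteq> T"
  shows "(F \<otimes>\<^bsub>MA\<^esub> G) u = (\<Sum>v\<in>S. \<Sum>w\<in>T. F v * G w * of_bool (m v w = u))"
proof -
  have "(F \<otimes>\<^bsub>MA\<^esub> G) u = (\<Sum>(v, w) | F v \<noteq> 0 \<and> G w \<noteq> 0 \<and> m v w = u. F v * G w)"
    by (simp add: magma_alg_def)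
  also have "\<dots> = (\<Sum>(v, w)\<in>S \<times> T. F v * G w * of_bool (m v w = u))"
    using assms by (intro sum.mono_neutral_cong_left) auto
  finally show ?thesis by (simp add: sum.cartesian_product)
qed

lemma MA_mult_closed:
  assumes F: "F \<in> carrier MA" and G: "G \<in> carrier MA" shows "F \<otimes>\<^bsub>MA\<^esub> G \<in> carrier MA"
proof -
  have eq: "(F \<otimes>\<^bsub>MA\<^esub> G) u = (\<Sum>v\<in>supp F. \<Sum>w\<in>supp G. F v * G w * of_bool (m v w = u))" for u
    using F G by (intro MA_mult) (auto simp: MA_carrier)
  have s: "supp (F \<otimes>\<^bsub>MA\<^esub> G) \<subseteq> (\<lambda>(v, w). m v w) ` (supp F \<times> supp G)"
  proof
    fix u assume "u \<in> supp (F \<otimes>\<^bsub>MA\<^esub> G)"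
    then have "(\<Sum>v\<in>supp F. \<Sum>w\<in>supp G. F v * G w * of_bool (m v w = u)) \<noteq> 0" by (simp add: eq)
    then obtain v where v: "v \<in> supp F" "(\<Sum>w\<in>supp G. F v * G w * of_bool (m v w = u)) \<noteq> 0"
      by (rule sum.not_neutral_contains_not_neutral)
    from v(2) obtain w where "w \<in> supp G" "F v * G w * of_bool (m v w = u) \<noteq> 0"
      by (rule sum.not_neutral_contains_not_neutral)
    then show "u \<in> (\<lambda>(v, w). m v w) ` (supp F \<times> supp G)" using v(1) by force
  qed
  have "finite (supp (F \<otimes>\<^bsub>MA\<^esub> G))"
    by (rule finite_subset[OF s]) (use F G in \<open>auto simp: MA_carrier\<close>)
  moreover have "supp (F \<otimes>\<^bsub>MA\<^esub> G) \<subseteq> M"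
    using F G m_closed by (intro order_trans[OF s]) (auto simp: MA_carrier subset_iff)
  moreover have "(F \<otimes>\<^bsub>MA\<^esub> G) u \<in> K" for u
    unfolding eq using F G by (intro K_sum K_mult) (auto simp: MA_carrier)
  ultimately show ?thesis unfolding MA_carrier by blast
qed

lemma MA_add_closed:
  assumes F: "F \<in> carrier MA" and G: "G \<in> carrier MA" shows "(\<lambda>x. F x + G x) \<in> carrier MA"
proof -
  have s: "supp (\<lambda>x. F x + G x) \<subseteq> supp F \<union> supp G" by auto
  have "finite (supp (\<lambda>x. F x + G x))"
    by (rule finite_subset[OF s]) (use F G in \<open>auto simp: MA_carrier\<close>)
  then show ?thesis using F G s unfolding MA_carrier by auto
qed

lemma MA_smult_closed:
  assumes "c \<in> K" and F: "F \<in> carrier MA" shows "(\<lambda>x. c * F x) \<in> carrier MA"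
proof -
  have s: "supp (\<lambda>x. c * F x) \<subseteq> supp F" by auto
  have "finite (supp (\<lambda>x. c * F x))"
    by (rule finite_subset[OF s]) (use F in \<open>auto simp: MA_carrier\<close>)
  then show ?thesis using assms s unfolding MA_carrier by auto
qed

lemma kspace_MA: "kspace K MA"
proof (rule kspaceI)
  show "cx_field K" ..
  show "abelian_group MA"
  proof (rule abelian_groupI)
    show "\<exists>G\<in>carrier MA. G \<oplus>\<^bsub>MA\<^esub> F = \<zero>\<^bsub>MA\<^esub>" if "F \<in> carrier MA" for F
      using MA_smult_closed[OF _ that, of "- 1"] by (intro bexI[of _ "\<lambda>x. - F x"]) auto
    show "\<zero>\<^bsub>MA\<^esub> \<in> carrier MA" by (simp add: MA_carrier)
  qed (auto simp: algebra_simps MA_add_closed)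
qed (auto simp: algebra_simps MA_smult_closed)

lemma kalg_MA: "kalg K MA"
proof -
  interpret kspace K MA by (rule kspace_MA)
  show ?thesis
  proof
    fix F G H assume FGH: "F \<in> carrier MA" "G \<in> carrier MA" "H \<in> carrier MA"
    then have fin: "finite (supp F \<union> supp G \<union> supp H)" by (auto simp: MA_carrier)
    have s: "supp F \<subseteq> supp F \<union> supp G \<union> supp H" "supp G \<subseteq> supp F \<union> supp G \<union> supp H"
       "supp H \<subseteq> supp F \<union> supp G \<union> supp H" "supp (\<lambda>x. F x + G x) \<subseteq> supp F \<union> supp G \<union> supp H"
       "supp (\<lambda>x. G x + H x) \<subseteq> supp F \<union> supp G \<union> supp H" by auto
    note e = MA_mult[OF fin _ fin]
    show "(F \<oplus>\<^bsub>MA\<^esub> G) \<otimes>\<^bsub>MA\<^esub> H = F \<otimes>\<^bsub>MA\<^esub> H \<oplus>\<^bsub>MA\<^esub> G \<otimes>\<^bsub>MA\<^esub> H"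
      by (rule ext) (simp add: e[OF s(4,3)] e[OF s(1,3)] e[OF s(2,3)] distrib_left distrib_right sum.distrib)
    show "F \<otimes>\<^bsub>MA\<^esub> (G \<oplus>\<^bsub>MA\<^esub> H) = F \<otimes>\<^bsub>MA\<^esub> G \<oplus>\<^bsub>MA\<^esub> F \<otimes>\<^bsub>MA\<^esub> H"
      by (rule ext) (simp add: e[OF s(1,5)] e[OF s(1,2)] e[OF s(1,3)] distrib_left distrib_right sum.distrib)
  next
    fix c F G assume FG: "c \<in> K" "F \<in> carrier MA" "G \<in> carrier MA"
    then have fin: "finite (supp F \<union> supp G)" by (auto simp: MA_carrier)
    have s: "supp F \<subseteq> supp F \<union> supp G" "supp G \<subseteq> supp F \<union> supp G"
       "supp (\<lambda>x. c * F x) \<subseteq> supp F \<union> supp G" "supp (\<lambda>x. c * G x) \<subseteq> supp F \<union> supp G" by auto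
    note e = MA_mult[OF fin _ fin]
    show "c \<odot>\<^bsub>MA\<^esub> F \<otimes>\<^bsub>MA\<^esub> G = c \<odot>\<^bsub>MA\<^esub> (F \<otimes>\<^bsub>MA\<^esub> G)"
      by (rule ext) (simp add: e[OF s(3,2)] e[OF s(1,2)] sum_distrib_left mult.assoc)
    show "F \<otimes>\<^bsub>MA\<^esub> (c \<odot>\<^bsub>MA\<^esub> G) = c \<odot>\<^bsub>MA\<^esub> (F \<otimes>\<^bsub>MA\<^esub> G)"
      by (rule ext) (simp add: e[OF s(1,4)] e[OF s(1,2)] sum_distrib_left mult_ac)
  qed (rule MA_mult_closed)
qed

sublocale MA: kalg K MA
  by (rule kalg_MA)

lemma MA_uminus: "F \<in> carrier MA \<Longrightarrow> \<ominus>\<^bsub>MA\<^esub> F = (\<lambda>x. - F x)"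
  by (simp add: MA.neg_eq_smult)

lemma MA_minus: "\<lbrakk>F \<in> carrier MA; G \<in> carrier MA\<rbrakk> \<Longrightarrow> F \<ominus>\<^bsub>MA\<^esub> G = (\<lambda>x. F x - G x)"
  by (simp add: a_minus_def MA_uminus)

lemma supp_indicator: "supp (indicator {v}) = {v}"
  by (auto simp: indicator_def)

lemma indicator_MA [simp]: "v \<in> M \<Longrightarrow> indicator {v} \<in> carrier MA"
  by (auto simp: MA_carrier supp_indicator indicator_def split: if_splits)

lemma indicator_br: "indicator {v} \<otimes>\<^bsub>MA\<^esub> indicator {w} = indicator {m v w}"
  by (rule ext, subst MA_mult[of "{v}" _ "{w}"]) (auto simp: supp_indicator indicator_def)

text \<open>Induction over a finite set containing the support, removing one basis vector at a time.
  It serves as the induction principle for magma algebras.\<close>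

lemma MA_span:
  assumes "linsub K MA U" "\<And>v. v \<in> M \<Longrightarrow> indicator {v} \<in> U" "F \<in> carrier MA" shows "F \<in> U"
proof -
  have "F \<in> U" if "finite S" "F \<in> carrier MA" "supp F \<subseteq> S" for S F
    using that
  proof (induction S arbitrary: F)
    case empty
    then have "F = \<zero>\<^bsub>MA\<^esub>" by (auto simp: fun_eq_iff)
    then show ?case using linsub_zero[OF assms(1)] by simp
  next
    case (insert v S)
    show ?case
    proof (cases "F v = 0")
      case True
      with insert have "supp F \<subseteq> S" by auto
      then show ?thesis using insert.IH insert.prems by blast
    next
      case False
      then have v: "v \<in> M" and Fv: "F v \<in> K" using insert.prems by (auto simp: MA_carrier)
      define G where "G = (\<lambda>x. F x - F v * indicator {v} x)"
      have "G \<in> carrier MA"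
        using MA_add_closed[OF insert.prems(1) MA_smult_closed[OF K_uminus[OF Fv] indicator_MA[OF v]]]
        by (simp add: G_def)
      moreover have "supp G \<subseteq> S" using insert.prems(2) by (auto simp: G_def indicator_def)
      ultimately have "G \<in> U" by (rule insert.IH)
      moreover have "F v \<odot>\<^bsub>MA\<^esub> indicator {v} \<in> U" by (rule linsub_smult[OF assms(1) Fv assms(2)[OF v]])
      ultimately have "G \<oplus>\<^bsub>MA\<^esub> F v \<odot>\<^bsub>MA\<^esub> indicator {v} \<in> U" by (rule linsub_add[OF assms(1)])
      then show ?thesis by (simp add: G_def)
    qed
  qed
  then show ?thesis using assms(3) by (auto simp: MA_carrier)
qed

end

lemma (in kspace) LF_equalizer:
  assumes "f \<in> linear_functionals K V" "g \<in> linear_functionals K V"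
  shows "linsub K V {x \<in> carrier V. f x = g x}"
  using LF_simps[OF assms(1)] LF_simps[OF assms(2)] by (intro linsubI) auto

lemma (in kspace) LF_null: "(\<lambda>x. 0) \<in> linear_functionals K V"
  by (auto simp: linear_functionals_def)

context magma
begin

text \<open>The linear functional with prescribed values on the basis \<open>M\<close>; it is needed
  to build functionals on the source of a tensor product.\<close>

definition lin_ext :: "('m \<Rightarrow> complex) \<Rightarrow> ('m \<Rightarrow> complex) \<Rightarrow> complex" where
  "lin_ext \<psi> F = (\<Sum>v\<in>supp F. F v * \<psi> v)"

lemma lin_ext_eq: "\<lbrakk>finite S; supp F \<subseteq> S\<rbrakk> \<Longrightarrow> lin_ext \<psi> F = (\<Sum>v\<in>S. F v * \<psi> v)"
  unfolding lin_ext_def by (rule sum.mono_neutral_left) auto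

lemma lin_ext_indicator: "lin_ext \<psi> (indicator {v}) = \<psi> v"
  by (subst lin_ext_eq[of "{v}"]) (auto simp: supp_indicator)

lemma lin_ext_LF:
  assumes "\<And>v. v \<in> M \<Longrightarrow> \<psi> v \<in> K" shows "lin_ext \<psi> \<in> linear_functionals K MA"
  unfolding linear_functionals_def
proof (intro CollectI conjI ballI funcsetI)
  show "lin_ext \<psi> F \<in> K" if "F \<in> carrier MA" for F
    unfolding lin_ext_def using that assms by (intro K_sum) (auto simp: MA_carrier subset_iff)
  show "lin_ext \<psi> (F \<oplus>\<^bsub>MA\<^esub> G) = lin_ext \<psi> F + lin_ext \<psi> G" if "F \<in> carrier MA" "G \<in> carrier MA" for F G
  proof -
    have fin: "finite (supp F \<union> supp G)" using that by (auto simp: MA_carrier)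
    have s: "supp F \<subseteq> supp F \<union> supp G" "supp G \<subseteq> supp F \<union> supp G" "supp (\<lambda>x. F x + G x) \<subseteq> supp F \<union> supp G" by auto
    show ?thesis
      by (simp add: lin_ext_eq[OF fin s(1)] lin_ext_eq[OF fin s(2)] lin_ext_eq[OF fin s(3)] distrib_right sum.distrib)
  qed
  show "lin_ext \<psi> (c \<odot>\<^bsub>MA\<^esub> F) = c * lin_ext \<psi> F" if "c \<in> K" "F \<in> carrier MA" for c F
  proof -
    have fin: "finite (supp F)" using that by (auto simp: MA_carrier)
    have s: "supp F \<subseteq> supp F" "supp (\<lambda>x. c * F x) \<subseteq> supp F" by auto
    show ?thesis
      by (simp add: lin_ext_eq[OF fin s(1)] lin_ext_eq[OF fin s(2)] sum_distrib_left mult.assoc)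
  qed
qed

lemma pushforward_eq:
  assumes "finite S" "supp F \<subseteq> S"
  shows "pushforward f F w = (\<Sum>v\<in>S. F v * of_bool (f v = w))"
  unfolding pushforward_def using assms by (intro sum.mono_neutral_cong_left) auto

end

lemma pushforward_khom:
  assumes "magma K M m" "magma K N m'" "\<And>v. v \<in> M \<Longrightarrow> f v \<in> N"
  shows "khom K (magma_alg K M m) (magma_alg K N m') (pushforward f)"
    and "v \<in> M \<Longrightarrow> pushforward f (indicator {v}) = indicator {f v}"
proof -
  interpret M: magma K M m by fact
  interpret N: magma K N m' by fact
  have "pushforward f \<in> module_hom (cfield K) M.MA N.MA"
  proof (rule module_homI)
    fix F assume F: "F \<in> carrier M.MA"
    then have fin: "finite (M.supp F)" by (simp add: M.MA_carrier)
    note eq = M.pushforward_eq[OF fin subset_refl]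
    have s: "N.supp (pushforward f F) \<subseteq> f ` M.supp F"
    proof
      fix w assume "w \<in> N.supp (pushforward f F)"
      then have "(\<Sum>v\<in>M.supp F. F v * of_bool (f v = w)) \<noteq> 0" by (simp add: eq)
      then obtain v where "v \<in> M.supp F" "F v * of_bool (f v = w) \<noteq> 0"
        by (rule sum.not_neutral_contains_not_neutral)
      then show "w \<in> f ` M.supp F" by auto
    qed
    have "finite (N.supp (pushforward f F))" by (rule finite_subset[OF s]) (use fin in simp)
    moreover have "N.supp (pushforward f F) \<subseteq> N"
      using s assms(3) F by (force simp: M.MA_carrier subset_iff)
    moreover have "pushforward f F w \<in> K" for w
      unfolding eq using F by (intro M.K_sum) (auto simp: M.MA_carrier)
    ultimately show "pushforward f F \<in> carrier N.MA" unfolding N.MA_carrier by blast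
  next
    fix F G assume FG: "F \<in> carrier M.MA" "G \<in> carrier M.MA"
    have fin: "finite (M.supp F \<union> M.supp G)" using FG by (auto simp: M.MA_carrier)
    have s: "M.supp F \<subseteq> M.supp F \<union> M.supp G" "M.supp G \<subseteq> M.supp F \<union> M.supp G"
      "M.supp (\<lambda>x. F x + G x) \<subseteq> M.supp F \<union> M.supp G" by auto
    show "pushforward f (F \<oplus>\<^bsub>M.MA\<^esub> G) = pushforward f F \<oplus>\<^bsub>N.MA\<^esub> pushforward f G"
      by (rule ext) (simp add: M.pushforward_eq[OF fin s(1)] M.pushforward_eq[OF fin s(2)] M.pushforward_eq[OF fin s(3)]
          distrib_right sum.distrib)
  next
    fix c F assume cF: "c \<in> K" "F \<in> carrier M.MA"
    have fin: "finite (M.supp F)" using cF by (auto simp: M.MA_carrier)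
    have s: "M.supp F \<subseteq> M.supp F" "M.supp (\<lambda>x. c * F x) \<subseteq> M.supp F" by auto
    show "pushforward f (c \<odot>\<^bsub>M.MA\<^esub> F) = c \<odot>\<^bsub>N.MA\<^esub> pushforward f F"
      by (rule ext) (simp add: M.pushforward_eq[OF fin s(1)] M.pushforward_eq[OF fin s(2)] sum_distrib_left mult.assoc)
  qed
  then show "khom K M.MA N.MA (pushforward f)" by unfold_locales
  show "pushforward f (indicator {v}) = indicator {f v}"
    by (rule ext, subst M.pushforward_eq[of "{v}"]) (auto simp: M.supp_indicator indicator_def)
qed

section \<open>Extension of scalars\<close>

global_interpretation Q: cx_field "\<rat>"
  by (rule cx_field_subfields) simp

locale ext_scalars = cx_field K + V: kalg "\<rat>" V for K and V :: "'v calg"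
begin

abbreviation R :: "('v \<Rightarrow> complex) set" where "R \<equiv> tensor_relations K V"

abbreviation T :: "('v \<Rightarrow> complex) set calg" where "T \<equiv> tensor V K"

sublocale P: magma K "carrier V" "mult V"
  by unfold_locales simp

lemma tensor_pre_eq: "tensor_pre K V = P.MA"
  by (simp add: tensor_pre_def)

text \<open>The generators of \<open>tensor_relations\<close>, rewritten with the operations of the
  algebra so that bilinearity and the laws of homomorphisms apply to them; \<open>R_eq\<close>
  identifies the two forms.\<close>

definition add_rel :: "'v \<Rightarrow> 'v \<Rightarrow> 'v \<Rightarrow> complex" where
  "add_rel v w = (indicator {v \<oplus>\<^bsub>V\<^esub> w} \<ominus>\<^bsub>P.MA\<^esub> indicator {v}) \<ominus>\<^bsub>P.MA\<^esub> indicator {w}"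

definition smult_rel :: "complex \<Rightarrow> 'v \<Rightarrow> 'v \<Rightarrow> complex" where
  "smult_rel q v = indicator {q \<odot>\<^bsub>V\<^esub> v} \<ominus>\<^bsub>P.MA\<^esub> q \<odot>\<^bsub>P.MA\<^esub> indicator {v}"

definition rels :: "('v \<Rightarrow> complex) set" where
  "rels = {add_rel v w | v w. v \<in> carrier V \<and> w \<in> carrier V} \<union> {smult_rel q v | q v. q \<in> \<rat> \<and> v \<in> carrier V}"

lemma Q_K: "q \<in> \<rat> \<Longrightarrow> q \<in> K"
  using K_Rats by blast

lemma add_rel_closed: "\<lbrakk>v \<in> carrier V; w \<in> carrier V\<rbrakk> \<Longrightarrow> add_rel v w \<in> carrier P.MA"
  unfolding add_rel_def by (intro P.MA.minus_closed P.indicator_MA) simp_all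

lemma smult_rel_closed: "\<lbrakk>q \<in> \<rat>; v \<in> carrier V\<rbrakk> \<Longrightarrow> smult_rel q v \<in> carrier P.MA"
  unfolding smult_rel_def by (intro P.MA.minus_closed P.MA.smult_K_closed P.indicator_MA Q_K) simp_all

lemma rels_closed: "rels \<subseteq> carrier P.MA"
  using add_rel_closed smult_rel_closed by (auto simp: rels_def)

lemma R_eq: "R = lspan K P.MA rels"
proof -
  have 1: "add_rel v w = (\<lambda>x. indicator {v \<oplus>\<^bsub>V\<^esub> w} x - indicator {v} x - indicator {w} x)"
    if "v \<in> carrier V" "w \<in> carrier V" for v w
  proof -
    have "indicator {v \<oplus>\<^bsub>V\<^esub> w} \<ominus>\<^bsub>P.MA\<^esub> indicator {v} \<in> carrier P.MA"
      using that by (intro P.MA.minus_closed P.indicator_MA) simp_all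
    moreover have eq: "indicator {v \<oplus>\<^bsub>V\<^esub> w} \<ominus>\<^bsub>P.MA\<^esub> indicator {v}
        = (\<lambda>x. indicator {v \<oplus>\<^bsub>V\<^esub> w} x - indicator {v} x)"
      using that by (intro P.MA_minus) simp_all
    ultimately show ?thesis using that by (simp add: add_rel_def P.MA_minus)
  qed
  have 2: "smult_rel q v = (\<lambda>x. indicator {q \<odot>\<^bsub>V\<^esub> v} x - q * indicator {v} x)"
    if "v \<in> carrier V" "q \<in> \<rat>" for q v
    using that P.MA.smult_K_closed[of q "indicator {v}"] Q_K by (simp add: smult_rel_def P.MA_minus)
  have "rels = {\<lambda>x. indicator {v \<oplus>\<^bsub>V\<^esub> w} x - indicator {v} x - indicator {w} x | v w.
        v \<in> carrier V \<and> w \<in> carrier V} \<union>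
     {\<lambda>x. indicator {q \<odot>\<^bsub>V\<^esub> v} x - q * indicator {v} x | q v. q \<in> \<rat> \<and> v \<in> carrier V}"
    unfolding rels_def
    by (intro arg_cong2[where f = "(\<union>)"] Collect_cong iff_exI rev_conj_cong refl) (simp_all add: 1 2)
  then show ?thesis by (simp add: tensor_relations_def tensor_pre_eq)
qed

lemma R_linsub: "linsub K P.MA R"
  unfolding R_eq by (rule P.MA.lspan_linsub[OF rels_closed])

lemma R_least: "linsub K P.MA U \<Longrightarrow> rels \<subseteq> U \<Longrightarrow> R \<subseteq> U"
  unfolding R_eq by (rule P.MA.lspan_least)

lemma rels_R: "rels \<subseteq> R"
  unfolding R_eq by (rule P.MA.lspan_superset[OF rels_closed])

lemma add_rel_R: "\<lbrakk>v \<in> carrier V; w \<in> carrier V\<rbrakk> \<Longrightarrow> add_rel v w \<in> R"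
  using rels_R by (auto simp: rels_def)

lemma smult_rel_R: "\<lbrakk>q \<in> \<rat>; v \<in> carrier V\<rbrakk> \<Longrightarrow> smult_rel q v \<in> R"
  using rels_R by (auto simp: rels_def)

text \<open>The bracket of a basis vector with a relation is again a relation of the same kind,
  because the bracket of \<open>V\<close> is bilinear over the rationals.\<close>

lemma indicator_br_rels:
  assumes u: "u \<in> carrier V" and r: "r \<in> rels"
  shows "indicator {u} \<otimes>\<^bsub>P.MA\<^esub> r \<in> R" "r \<otimes>\<^bsub>P.MA\<^esub> indicator {u} \<in> R"
proof -
  note [simp del] = P.MA_simps
  have add: "indicator {u} \<otimes>\<^bsub>P.MA\<^esub> add_rel v w = add_rel (u \<otimes>\<^bsub>V\<^esub> v) (u \<otimes>\<^bsub>V\<^esub> w)"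
    "add_rel v w \<otimes>\<^bsub>P.MA\<^esub> indicator {u} = add_rel (v \<otimes>\<^bsub>V\<^esub> u) (w \<otimes>\<^bsub>V\<^esub> u)"
    if "v \<in> carrier V" "w \<in> carrier V" for v w
    using u that by (simp_all add: add_rel_def P.MA.br_diff_right P.MA.br_diff_left P.indicator_br
        V.br_add_left V.br_add_right P.MA.minus_closed)
  have smult: "indicator {u} \<otimes>\<^bsub>P.MA\<^esub> smult_rel q v = smult_rel q (u \<otimes>\<^bsub>V\<^esub> v)"
    "smult_rel q v \<otimes>\<^bsub>P.MA\<^esub> indicator {u} = smult_rel q (v \<otimes>\<^bsub>V\<^esub> u)"
    if "v \<in> carrier V" "q \<in> \<rat>" for v q
    using u that Q_K by (simp_all add: smult_rel_def P.MA.br_diff_right P.MA.br_diff_left P.indicator_br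
        V.br_smult_left V.br_smult_right P.MA.br_smult_left P.MA.br_smult_right)
  from r consider v w where "r = add_rel v w" "v \<in> carrier V" "w \<in> carrier V"
    | q v where "r = smult_rel q v" "q \<in> \<rat>" "v \<in> carrier V"
    by (auto simp: rels_def)
  then show "indicator {u} \<otimes>\<^bsub>P.MA\<^esub> r \<in> R" "r \<otimes>\<^bsub>P.MA\<^esub> indicator {u} \<in> R"
    by (cases; simp add: add smult add_rel_R smult_rel_R u)+
qed

text \<open>Linearity is exploited in one argument at a time: for a fixed generator of
  \<open>R\<close> the factor \<open>a\<close> is reduced to basis vectors, then for fixed
  \<open>a\<close> the element of \<open>R\<close> is reduced to generators.\<close>

lemma R_ideal: "alg_ideal K P.MA R"
proof (rule P.MA.alg_idealI[OF R_linsub])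
  fix a x assume a: "a \<in> carrier P.MA" and x: "x \<in> R"
  have "a \<otimes>\<^bsub>P.MA\<^esub> r \<in> R" "r \<otimes>\<^bsub>P.MA\<^esub> a \<in> R" if r: "r \<in> rels" for r
  proof -
    have rc: "r \<in> carrier P.MA" using r rels_closed by blast
    show "a \<otimes>\<^bsub>P.MA\<^esub> r \<in> R"
      using P.MA_span[OF P.MA.linsub_br_left[OF R_linsub rc] _ a] indicator_br_rels(1)[OF _ r] by simp
    show "r \<otimes>\<^bsub>P.MA\<^esub> a \<in> R"
      using P.MA_span[OF P.MA.linsub_br_right[OF R_linsub rc] _ a] indicator_br_rels(2)[OF _ r] by simp
  qed
  then have "R \<subseteq> {x \<in> carrier P.MA. a \<otimes>\<^bsub>P.MA\<^esub> x \<in> R}" "R \<subseteq> {x \<in> carrier P.MA. x \<otimes>\<^bsub>P.MA\<^esub> a \<in> R}"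
    using rels_closed by (intro R_least P.MA.linsub_br_right[OF R_linsub a] P.MA.linsub_br_left[OF R_linsub a]; blast)+
  then show "a \<otimes>\<^bsub>P.MA\<^esub> x \<in> R \<and> x \<otimes>\<^bsub>P.MA\<^esub> a \<in> R" using x by blast
qed

sublocale I: kalg_ideal K P.MA R
  by (rule kalg_idealI[OF P.kalg_MA R_ideal])

lemma T_eq: "T = quot_alg P.MA R"
  by (simp add: tensor_def tensor_pre_eq)

lemma kalg_T: "kalg K T"
  unfolding T_eq by (rule I.kalg_quot)

sublocale T: kalg K T
  by (rule kalg_T)

text \<open>The canonical map from \<open>V\<close> to its extension of scalars, v to v \<otimes>
  1.\<close>

definition iota :: "'v \<Rightarrow> ('v \<Rightarrow> complex) set" where
  "iota v = R +>\<^bsub>P.MA\<^esub> indicator {v}"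

lemma iota_closed [simp]: "v \<in> carrier V \<Longrightarrow> iota v \<in> carrier T"
  by (simp add: T_eq iota_def I.carrier_quot)

lemma iota_add:
  assumes "v \<in> carrier V" "w \<in> carrier V" shows "iota (v \<oplus>\<^bsub>V\<^esub> w) = iota v \<oplus>\<^bsub>T\<^esub> iota w"
proof -
  note [simp del] = P.MA_simps
  have "indicator {v \<oplus>\<^bsub>V\<^esub> w} \<ominus>\<^bsub>P.MA\<^esub> (indicator {v} \<oplus>\<^bsub>P.MA\<^esub> indicator {w}) = add_rel v w"
    using assms by (simp add: add_rel_def a_minus_def P.MA.M.minus_add P.MA.M.a_assoc)
  then show ?thesis
    using assms add_rel_R by (simp add: iota_def T_eq I.quot_add I.rcos_eq)
qed

lemma iota_smult:
  assumes "q \<in> \<rat>" "v \<in> carrier V" shows "iota (q \<odot>\<^bsub>V\<^esub> v) = q \<odot>\<^bsub>T\<^esub> iota v"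
proof -
  note [simp del] = P.MA_simps
  show ?thesis
    using assms smult_rel_R Q_K by (simp add: iota_def T_eq I.quot_smult I.rcos_eq smult_rel_def)
qed

lemma iota_br:
  assumes "v \<in> carrier V" "w \<in> carrier V" shows "iota (v \<otimes>\<^bsub>V\<^esub> w) = iota v \<otimes>\<^bsub>T\<^esub> iota w"
  using assms by (simp add: iota_def T_eq I.quot_br P.indicator_br)

lemma iota_zero: "iota \<zero>\<^bsub>V\<^esub> = \<zero>\<^bsub>T\<^esub>"
  using iota_smult[of 0 "\<zero>\<^bsub>V\<^esub>"] by simp

lemma T_span:
  assumes "linsub K T U" "\<And>v. v \<in> carrier V \<Longrightarrow> iota v \<in> U" "x \<in> carrier T" shows "x \<in> U"
proof -
  interpret ahom K P.MA T "\<lambda>F. R +>\<^bsub>P.MA\<^esub> F" unfolding T_eq by (rule I.ahom_quot)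
  have "x \<in> (\<lambda>F. R +>\<^bsub>P.MA\<^esub> F) ` carrier P.MA" using assms(3) unfolding T_eq I.carrier_quot .
  then obtain F where F: "x = R +>\<^bsub>P.MA\<^esub> F" "F \<in> carrier P.MA" by (rule imageE)
  have "F \<in> {F \<in> carrier P.MA. R +>\<^bsub>P.MA\<^esub> F \<in> U}"
  proof (rule P.MA_span[OF linsub_vimage[OF assms(1)] _ F(2)])
    fix v assume "v \<in> carrier V"
    then show "indicator {v} \<in> {F \<in> carrier P.MA. R +>\<^bsub>P.MA\<^esub> F \<in> U}"
      using assms(2)[of v] by (simp add: iota_def)
  qed
  then show ?thesis unfolding F(1) by blast
qed

lemma iota_vimage: "linsub K T U \<Longrightarrow> linsub \<rat> V {v \<in> carrier V. iota v \<in> U}"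
  using linsubD[of K T U] Q_K by (intro linsubI) (auto simp: iota_zero iota_add iota_smult)

lemma lc_iota: "v \<in> lower_central \<rat> V k \<Longrightarrow> iota v \<in> lower_central K T k"
proof (induction k arbitrary: v)
  case (Suc k)
  show ?case
  proof (cases "k = 0")
    case False
    have "lower_central \<rat> V (Suc k) \<subseteq> {v \<in> carrier V. iota v \<in> lower_central K T (Suc k)}"
    proof (rule V.lc_Suc_least[OF iota_vimage[OF T.lc_linsub]])
      fix x y assume "x \<in> carrier V" "y \<in> lower_central \<rat> V k"
      then show "x \<otimes>\<^bsub>V\<^esub> y \<in> {v \<in> carrier V. iota v \<in> lower_central K T (Suc k)}"
        using False Suc.IH V.lc_subset T.lc_br[of k] by (auto simp: iota_br subset_iff)
    qed (use False in simp)
    then show ?thesis using Suc.prems by blast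
  qed (use Suc in simp)
qed simp

text \<open>Together with \<open>lc_iota\<close> this says that extension of scalars commutes with
  the lower central series. The induction must allow every \<open>U\<close>, since fixing one factor
  of a bracket replaces \<open>U\<close> by its preimage under that bracket.\<close>

lemma lc_T_least:
  assumes "linsub K T U" "\<And>v. v \<in> lower_central \<rat> V k \<Longrightarrow> iota v \<in> U"
  shows "lower_central K T k \<subseteq> U"
  using assms
proof (induction k arbitrary: U)
  case 0
  then show ?case using T_span by auto
next
  case (Suc k)
  show ?case
  proof (cases "k = 0")
    case True
    then show ?thesis using Suc.prems T_span by auto
  next
    case False
    show ?thesis
    proof (rule T.lc_Suc_least[OF Suc.prems(1)])
      fix x y assume x: "x \<in> carrier T" and y: "y \<in> lower_central K T k"
      have yc: "y \<in> carrier T" using y T.lc_subset by blast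
      have "x \<in> {x \<in> carrier T. x \<otimes>\<^bsub>T\<^esub> y \<in> U}"
      proof (rule T_span[OF T.linsub_br_left[OF Suc.prems(1) yc] _ x])
        fix v assume v: "v \<in> carrier V"
        have "lower_central K T k \<subseteq> {y \<in> carrier T. iota v \<otimes>\<^bsub>T\<^esub> y \<in> U}"
        proof (rule Suc.IH[OF T.linsub_br_right[OF Suc.prems(1) iota_closed[OF v]]])
          fix w assume w: "w \<in> lower_central \<rat> V k"
          then have "iota (v \<otimes>\<^bsub>V\<^esub> w) \<in> U" using V.lc_br[OF _ v w] False Suc.prems(2) by simp
          moreover have "w \<in> carrier V" using w V.lc_subset by blast
          ultimately show "iota w \<in> {y \<in> carrier T. iota v \<otimes>\<^bsub>T\<^esub> y \<in> U}" using v by (simp add: iota_br)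
        qed
        then show "iota v \<in> {x \<in> carrier T. x \<otimes>\<^bsub>T\<^esub> y \<in> U}" using y v by auto
      qed
      then show "x \<otimes>\<^bsub>T\<^esub> y \<in> U" by simp
    qed (use False in simp)
  qed
qed

end

lemma ext_scalarsI: "\<lbrakk>cx_field K; kalg \<rat> V\<rbrakk> \<Longrightarrow> ext_scalars K V"
  by (rule ext_scalars.intro)

lemma lie_alg_tensor:
  assumes "cx_field K" "lie_alg \<rat> V" shows "lie_alg K (tensor V K)"
proof -
  interpret V: lie_alg \<rat> V by fact
  interpret ext_scalars K V by (intro ext_scalarsI assms(1) V.kalg_axioms)
  \<comment> \<open>The law [x, x] = 0 is not linear in x and cannot be checked on pure tensors. Its
    polarization is linear in each argument, and division by 2 recovers the law.\<close>
  have anti: "x \<otimes>\<^bsub>T\<^esub> y \<oplus>\<^bsub>T\<^esub> y \<otimes>\<^bsub>T\<^esub> x = \<zero>\<^bsub>T\<^esub>" if x: "x \<in> carrier T" and y: "y \<in> carrier T" for x y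
  proof -
    have lin: "linsub K T {x \<in> carrier T. x \<otimes>\<^bsub>T\<^esub> y \<oplus>\<^bsub>T\<^esub> y \<otimes>\<^bsub>T\<^esub> x = \<zero>\<^bsub>T\<^esub>}" if y: "y \<in> carrier T" for y
    proof -
      have "khom K T T (\<lambda>x. x \<otimes>\<^bsub>T\<^esub> y \<oplus>\<^bsub>T\<^esub> y \<otimes>\<^bsub>T\<^esub> x)"
        using y by unfold_locales
          (auto intro!: module_homI simp: T.br_add_left T.br_add_right T.br_smult_left T.br_smult_right
             T.M.a_ac T.smult_K_add_right)
      from khom.linsub_vimage[OF this T.linsub_zero_set] show ?thesis by simp
    qed
    have "x \<in> {x \<in> carrier T. x \<otimes>\<^bsub>T\<^esub> y \<oplus>\<^bsub>T\<^esub> y \<otimes>\<^bsub>T\<^esub> x = \<zero>\<^bsub>T\<^esub>}"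
    proof (rule T_span[OF lin[OF y] _ x])
      fix v assume v: "v \<in> carrier V"
      have "y \<in> {y \<in> carrier T. y \<otimes>\<^bsub>T\<^esub> iota v \<oplus>\<^bsub>T\<^esub> iota v \<otimes>\<^bsub>T\<^esub> y = \<zero>\<^bsub>T\<^esub>}"
      proof (rule T_span[OF lin[OF iota_closed[OF v]] _ y])
        fix w assume w: "w \<in> carrier V"
        have "iota w \<otimes>\<^bsub>T\<^esub> iota v \<oplus>\<^bsub>T\<^esub> iota v \<otimes>\<^bsub>T\<^esub> iota w = iota (w \<otimes>\<^bsub>V\<^esub> v \<oplus>\<^bsub>V\<^esub> v \<otimes>\<^bsub>V\<^esub> w)"
          using v w by (simp add: iota_add iota_br)
        also have "w \<otimes>\<^bsub>V\<^esub> v \<oplus>\<^bsub>V\<^esub> v \<otimes>\<^bsub>V\<^esub> w = \<zero>\<^bsub>V\<^esub>"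
          using V.br_anti[OF w v] v w by (simp add: V.M.l_neg)
        finally show "iota w \<in> {y \<in> carrier T. y \<otimes>\<^bsub>T\<^esub> iota v \<oplus>\<^bsub>T\<^esub> iota v \<otimes>\<^bsub>T\<^esub> y = \<zero>\<^bsub>T\<^esub>}"
          using w by (simp add: iota_zero)
      qed
      then show "iota v \<in> {x \<in> carrier T. x \<otimes>\<^bsub>T\<^esub> y \<oplus>\<^bsub>T\<^esub> y \<otimes>\<^bsub>T\<^esub> x = \<zero>\<^bsub>T\<^esub>}" using v y by (simp add: T.M.a_comm)
    qed
    then show ?thesis by simp
  qed
  let ?J = "\<lambda>x y z. x \<otimes>\<^bsub>T\<^esub> (y \<otimes>\<^bsub>T\<^esub> z) \<oplus>\<^bsub>T\<^esub> y \<otimes>\<^bsub>T\<^esub> (z \<otimes>\<^bsub>T\<^esub> x) \<oplus>\<^bsub>T\<^esub> z \<otimes>\<^bsub>T\<^esub> (x \<otimes>\<^bsub>T\<^esub> y)"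
  \<comment> \<open>The Jacobi sum is invariant under cyclic rotation. Hence linearity is needed in
    the first slot only, and each argument is rotated there in turn.\<close>
  have cyc: "?J x y z = ?J y z x" if "x \<in> carrier T" "y \<in> carrier T" "z \<in> carrier T" for x y z
    using that by (simp add: T.M.a_ac)
  have step: "?J x y z = \<zero>\<^bsub>T\<^esub>"
    if *: "y \<in> carrier T" "z \<in> carrier T" "x \<in> carrier T" "\<And>v. v \<in> carrier V \<Longrightarrow> ?J (iota v) y z = \<zero>\<^bsub>T\<^esub>" for x y z
  proof -
    have "khom K T T (\<lambda>x. ?J x y z)"
      using * by unfold_locales
        (auto intro!: module_homI simp: T.br_add_left T.br_add_right T.br_smult_left T.br_smult_right
           T.M.a_ac T.smult_K_add_right)
    from khom.linsub_vimage[OF this T.linsub_zero_set]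
    have "linsub K T {x \<in> carrier T. ?J x y z = \<zero>\<^bsub>T\<^esub>}" by simp
    from T_span[OF this _ *(3)] *(4) show ?thesis by simp
  qed
  show ?thesis
  proof
    fix x assume x: "x \<in> carrier T"
    show "x \<otimes>\<^bsub>T\<^esub> x = \<zero>\<^bsub>T\<^esub>"
    proof (rule T.functional_eqI)
      fix f assume f: "f \<in> linear_functionals K T"
      have "f (x \<otimes>\<^bsub>T\<^esub> x \<oplus>\<^bsub>T\<^esub> x \<otimes>\<^bsub>T\<^esub> x) = f \<zero>\<^bsub>T\<^esub>" using anti[OF x x] by simp
      then show "f (x \<otimes>\<^bsub>T\<^esub> x) = f \<zero>\<^bsub>T\<^esub>" using x by (simp add: T.LF_simps[OF f])
    qed (use x in auto)
  next
    fix x y z assume xyz: "x \<in> carrier T" "y \<in> carrier T" "z \<in> carrier T"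
    have 0: "?J (iota u) (iota v) (iota w) = \<zero>\<^bsub>T\<^esub>" if "u \<in> carrier V" "v \<in> carrier V" "w \<in> carrier V" for u v w
    proof -
      have "?J (iota u) (iota v) (iota w) = iota (u \<otimes>\<^bsub>V\<^esub> (v \<otimes>\<^bsub>V\<^esub> w) \<oplus>\<^bsub>V\<^esub> v \<otimes>\<^bsub>V\<^esub> (w \<otimes>\<^bsub>V\<^esub> u) \<oplus>\<^bsub>V\<^esub> w \<otimes>\<^bsub>V\<^esub> (u \<otimes>\<^bsub>V\<^esub> v))"
        using that by (simp add: iota_add iota_br)
      then show ?thesis using that by (simp add: V.jacobi iota_zero)
    qed
    have 1: "?J x (iota v) (iota w) = \<zero>\<^bsub>T\<^esub>" if "v \<in> carrier V" "w \<in> carrier V" for v w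
      using step[OF iota_closed[OF that(1)] iota_closed[OF that(2)] xyz(1) 0[OF _ that]] .
    have 2: "?J y (iota w) x = \<zero>\<^bsub>T\<^esub>" if w: "w \<in> carrier V" for w
    proof (rule step[OF iota_closed[OF w] xyz(1,2)])
      fix v assume v: "v \<in> carrier V"
      show "?J (iota v) (iota w) x = \<zero>\<^bsub>T\<^esub>"
        using 1[OF v w] cyc[OF xyz(1) iota_closed[OF v] iota_closed[OF w]] by argo
    qed
    have "?J z x y = \<zero>\<^bsub>T\<^esub>"
    proof (rule step[OF xyz])
      fix v assume v: "v \<in> carrier V"
      show "?J (iota v) x y = \<zero>\<^bsub>T\<^esub>"
        using 2[OF v] cyc[OF xyz(2) iota_closed[OF v] xyz(1)] by argo
    qed
    then show "?J x y z = \<zero>\<^bsub>T\<^esub>" using cyc[OF xyz(3,1,2)] by argo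
  qed
qed

locale tensor_hom = V: ext_scalars K V + W: ext_scalars K W + khom "\<rat>" V W f
  for K and V :: "'v calg" and W :: "'w calg" and f
begin

lemma pf_khom: "khom K V.P.MA W.P.MA (pushforward f)"
  and pf_indicator: "v \<in> carrier V \<Longrightarrow> pushforward f (indicator {v}) = indicator {f v}"
  using pushforward_khom[OF V.P.magma_axioms W.P.magma_axioms hom_closed] by auto

sublocale pf: khom K V.P.MA W.P.MA "pushforward f"
  by (rule pf_khom)

lemma pf_rels: "r \<in> V.rels \<Longrightarrow> pushforward f r \<in> W.R"
proof -
  note [simp del] = V.P.MA_simps W.P.MA_simps
  have add: "pushforward f (V.add_rel v w) = W.add_rel (f v) (f w)" if "v \<in> carrier V" "w \<in> carrier V" for v w
    using that by (simp add: V.add_rel_def W.add_rel_def pf.hom_diff pf_indicator V.P.MA.minus_closed hom_add)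
  have smult: "pushforward f (V.smult_rel q v) = W.smult_rel q (f v)" if "v \<in> carrier V" "q \<in> \<rat>" for v q
    using that V.Q_K
    by (simp add: V.smult_rel_def W.smult_rel_def pf.hom_diff pf.hom_smult pf_indicator hom_smult)
  assume "r \<in> V.rels"
  then consider v w where "r = V.add_rel v w" "v \<in> carrier V" "w \<in> carrier V"
    | q v where "r = V.smult_rel q v" "q \<in> \<rat>" "v \<in> carrier V"
    by (auto simp: V.rels_def)
  then show ?thesis by (cases; simp add: add smult W.add_rel_R W.smult_rel_R)
qed

lemma pf_R: "r \<in> V.R \<Longrightarrow> pushforward f r \<in> W.R"
proof -
  have "V.R \<subseteq> {r \<in> carrier V.P.MA. pushforward f r \<in> W.R}"
    using V.rels_closed pf_rels by (intro V.R_least pf.linsub_vimage W.R_linsub) blast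
  then show "r \<in> V.R \<Longrightarrow> pushforward f r \<in> W.R" by blast
qed

sublocale q: quot_khom K V.P.MA V.R W.P.MA W.R "pushforward f"
  by unfold_locales (rule pf_R)

lemma tensor_map_eq: "tensor_map V W K f = quot_map V.P.MA V.R W.P.MA W.R (pushforward f)"
  by (simp add: tensor_map_def V.tensor_pre_eq W.tensor_pre_eq)

lemma khom_tensor_map: "khom K V.T W.T (tensor_map V W K f)"
  using q.khom_quot_map by (simp add: tensor_map_eq V.T_eq W.T_eq)

lemma tensor_map_iota: "v \<in> carrier V \<Longrightarrow> tensor_map V W K f (V.iota v) = W.iota (f v)"
  by (simp add: tensor_map_eq V.iota_def W.iota_def q.quot_map_rcos pf_indicator)

lemma tensor_map_surj:
  assumes "f ` carrier V = carrier W" shows "tensor_map V W K f ` carrier V.T = carrier W.T"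
proof -
  interpret t: khom K V.T W.T "tensor_map V W K f" by (rule khom_tensor_map)
  have "y \<in> tensor_map V W K f ` carrier V.T" if "y \<in> carrier W.T" for y
  proof (rule W.T_span[OF t.linsub_image[OF V.T.linsub_carrier] _ that])
    fix w assume "w \<in> carrier W"
    then obtain v where "v \<in> carrier V" "w = f v" using assms by auto
    then show "W.iota w \<in> tensor_map V W K f ` carrier V.T"
      by (intro image_eqI[of _ _ "V.iota v"]) (simp_all add: tensor_map_iota)
  qed
  then show ?thesis by auto
qed

lemma ahom_tensor_map:
  assumes "\<And>v w. \<lbrakk>v \<in> carrier V; w \<in> carrier V\<rbrakk> \<Longrightarrow> f (v \<otimes>\<^bsub>V\<^esub> w) = f v \<otimes>\<^bsub>W\<^esub> f w"
  shows "ahom K V.T W.T (tensor_map V W K f)"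
proof -
  let ?t = "tensor_map V W K f"
  interpret t: khom K V.T W.T ?t by (rule khom_tensor_map)
  have "?t (x \<otimes>\<^bsub>V.T\<^esub> y) = ?t x \<otimes>\<^bsub>W.T\<^esub> ?t y" if x: "x \<in> carrier V.T" and y: "y \<in> carrier V.T" for x y
  proof (rule W.T.functional_eqI)
    fix \<phi> assume "\<phi> \<in> linear_functionals K W.T"
    note \<phi> = t.LF_comp[OF this] W.T.LF_simps[OF this]
    have right: "linsub K V.T {y \<in> carrier V.T. \<phi> (?t (x \<otimes>\<^bsub>V.T\<^esub> y)) = \<phi> (?t x \<otimes>\<^bsub>W.T\<^esub> ?t y)}"
      if "x \<in> carrier V.T" for x
      using that by (intro linsubI) (auto simp: V.T.br_add_right V.T.br_smult_right W.T.br_add_right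
        W.T.br_smult_right t.hom_add t.hom_smult \<phi>)
    have left: "linsub K V.T {x \<in> carrier V.T. \<phi> (?t (x \<otimes>\<^bsub>V.T\<^esub> y)) = \<phi> (?t x \<otimes>\<^bsub>W.T\<^esub> ?t y)}"
      using y by (intro linsubI) (auto simp: V.T.br_add_left V.T.br_smult_left W.T.br_add_left
        W.T.br_smult_left t.hom_add t.hom_smult \<phi>)
    have "x \<in> {x \<in> carrier V.T. \<phi> (?t (x \<otimes>\<^bsub>V.T\<^esub> y)) = \<phi> (?t x \<otimes>\<^bsub>W.T\<^esub> ?t y)}"
    proof (rule V.T_span[OF left _ x])
      fix v assume v: "v \<in> carrier V"
      have "y \<in> {y \<in> carrier V.T. \<phi> (?t (V.iota v \<otimes>\<^bsub>V.T\<^esub> y)) = \<phi> (?t (V.iota v) \<otimes>\<^bsub>W.T\<^esub> ?t y)}"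
        using v by (intro V.T_span[OF right _ y])
          (simp_all add: tensor_map_iota assms flip: V.iota_br W.iota_br)
      then show "V.iota v \<in> {x \<in> carrier V.T. \<phi> (?t (x \<otimes>\<^bsub>V.T\<^esub> y)) = \<phi> (?t x \<otimes>\<^bsub>W.T\<^esub> ?t y)}"
        using v by simp
    qed
    then show "\<phi> (?t (x \<otimes>\<^bsub>V.T\<^esub> y)) = \<phi> (?t x \<otimes>\<^bsub>W.T\<^esub> ?t y)" by simp
  qed (use x y in auto)
  then show ?thesis by unfold_locales
qed

text \<open>Right exactness of extension of scalars: a functional that vanishes on the image of
  \<open>ker f\<close> factors through \<open>W\<close>.\<close>

lemma tensor_map_kernel:
  assumes surj: "f ` carrier V = carrier W" and U: "linsub K V.T U"
    and ker: "\<And>v. \<lbrakk>v \<in> carrier V; f v = \<zero>\<^bsub>W\<^esub>\<rbrakk> \<Longrightarrow> V.iota v \<in> U"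
    and x: "x \<in> carrier V.T" "tensor_map V W K f x = \<zero>\<^bsub>W.T\<^esub>"
  shows "x \<in> U"
proof (rule V.T.functional_mem_linsub[OF U x(1)])
  fix \<phi> assume "\<phi> \<in> linear_functionals K V.T" and \<phi>0: "\<forall>u\<in>U. \<phi> u = 0"
  note \<phi> = this(1)
  define \<sigma> where "\<sigma> w = (SOME v. v \<in> carrier V \<and> f v = w)" for w
  have \<sigma>: "\<sigma> w \<in> carrier V" "f (\<sigma> w) = w" if "w \<in> carrier W" for w
  proof -
    have "w \<in> f ` carrier V" using that surj by simp
    then have "\<exists>v. v \<in> carrier V \<and> f v = w" by (metis imageE)
    from someI_ex[OF this] show "\<sigma> w \<in> carrier V" "f (\<sigma> w) = w" by (auto simp: \<sigma>_def)
  qed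
  \<comment> \<open>The section \<sigma> is a mere choice of preimages. Two preimages differ by an
    element of the kernel of \<open>f\<close>, whose image under \<open>V.iota\<close> lies in
    \<open>U\<close>, where \<phi> vanishes; so \<psi> does not depend on \<sigma> and inherits
    additivity and rational homogeneity from \<phi>.\<close>
  define \<psi> where "\<psi> w = \<phi> (V.iota (\<sigma> w))" for w
  have \<psi>_f: "\<psi> (f v) = \<phi> (V.iota v)" if v: "v \<in> carrier V" for v
  proof -
    have s: "\<sigma> (f v) \<in> carrier V" "f (\<sigma> (f v)) = f v" using v \<sigma>[of "f v"] by auto
    have "f (v \<ominus>\<^bsub>V\<^esub> \<sigma> (f v)) = \<zero>\<^bsub>W\<^esub>" using v s by (simp add: hom_diff W.V.minus_self)
    then have "V.iota (v \<ominus>\<^bsub>V\<^esub> \<sigma> (f v)) \<in> U" using v s by (intro ker) auto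
    moreover have "V.iota (v \<ominus>\<^bsub>V\<^esub> \<sigma> (f v)) = V.iota v \<oplus>\<^bsub>V.T\<^esub> (- 1) \<odot>\<^bsub>V.T\<^esub> V.iota (\<sigma> (f v))"
      using v s by (simp add: a_minus_def V.V.neg_eq_smult V.iota_add V.iota_smult)
    ultimately have "\<phi> (V.iota v \<oplus>\<^bsub>V.T\<^esub> (- 1) \<odot>\<^bsub>V.T\<^esub> V.iota (\<sigma> (f v))) = 0" using \<phi>0 by simp
    then show ?thesis using v s by (simp add: V.T.LF_simps[OF \<phi>] \<psi>_def)
  qed
  have \<psi>_K: "\<psi> w \<in> K" if "w \<in> carrier W" for w
    using \<sigma>[OF that] V.T.LF_closed[OF \<phi>] by (simp add: \<psi>_def)
  define \<Psi> where "\<Psi> = W.P.lin_ext \<psi>"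
  have \<Psi>: "\<Psi> \<in> linear_functionals K W.P.MA" unfolding \<Psi>_def by (rule W.P.lin_ext_LF[OF \<psi>_K])
  have \<Psi>_ind: "\<Psi> (indicator {w}) = \<psi> w" for w unfolding \<Psi>_def by (rule W.P.lin_ext_indicator)
  have \<psi>_add: "\<psi> (w \<oplus>\<^bsub>W\<^esub> w') = \<psi> w + \<psi> w'" if "w \<in> carrier W" "w' \<in> carrier W" for w w'
  proof -
    have "\<psi> (w \<oplus>\<^bsub>W\<^esub> w') = \<psi> (f (\<sigma> w \<oplus>\<^bsub>V\<^esub> \<sigma> w'))" using \<sigma> that by (simp add: hom_add)
    also have "\<dots> = \<psi> w + \<psi> w'" using \<sigma> that by (simp add: \<psi>_f V.iota_add V.T.LF_simps[OF \<phi>]) (simp add: \<psi>_def)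
    finally show ?thesis .
  qed
  have \<psi>_smult: "\<psi> (q \<odot>\<^bsub>W\<^esub> w) = q * \<psi> w" if "w \<in> carrier W" "q \<in> \<rat>" for q w
  proof -
    have "\<psi> (q \<odot>\<^bsub>W\<^esub> w) = \<psi> (f (q \<odot>\<^bsub>V\<^esub> \<sigma> w))" using \<sigma> that by (simp add: hom_smult)
    also have "\<dots> = q * \<psi> w" using \<sigma> that V.Q_K by (simp add: \<psi>_f V.iota_smult V.T.LF_simps[OF \<phi>]) (simp add: \<psi>_def)
    finally show ?thesis .
  qed
  \<comment> \<open>Additivity and homogeneity of \<psi> say exactly that its linear extension
    \<Psi> kills both kinds of relations.\<close>
  have "W.rels \<subseteq> {F \<in> carrier W.P.MA. \<Psi> F = 0}"
  proof
    note [simp del] = W.P.MA_simps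
    fix r assume r: "r \<in> W.rels"
    then consider v w where "r = W.add_rel v w" "v \<in> carrier W" "w \<in> carrier W"
      | q v where "r = W.smult_rel q v" "q \<in> \<rat>" "v \<in> carrier W"
      by (auto simp: W.rels_def)
    then have "\<Psi> r = 0"
      by cases (simp_all add: W.add_rel_def W.smult_rel_def W.P.MA.LF_simps[OF \<Psi>] \<Psi>_ind \<psi>_add \<psi>_smult
          W.P.MA.minus_closed W.Q_K)
    then show "r \<in> {F \<in> carrier W.P.MA. \<Psi> F = 0}" using r W.rels_closed by auto
  qed
  then have \<Psi>_R: "\<Psi> r = 0" if "r \<in> W.R" for r
    using W.R_least[OF W.P.MA.LF_equalizer[OF \<Psi> W.P.MA.LF_null]] that by blast
  interpret pr: ahom K V.P.MA V.T "\<lambda>F. V.R +>\<^bsub>V.P.MA\<^esub> F" unfolding V.T_eq by (rule V.I.ahom_quot)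
  \<comment> \<open>Two functionals on the presentation of \<open>V.T\<close> are compared on basis
    vectors. Hence \<phi> depends only on the image under \<open>pushforward f\<close>, and it
    vanishes where that image is a relation.\<close>
  have eq: "\<Psi> (pushforward f F) = \<phi> (V.R +>\<^bsub>V.P.MA\<^esub> F)" if F: "F \<in> carrier V.P.MA" for F
  proof -
    have "F \<in> {F \<in> carrier V.P.MA. \<Psi> (pushforward f F) = \<phi> (V.R +>\<^bsub>V.P.MA\<^esub> F)}"
    proof (rule V.P.MA_span[OF V.P.MA.LF_equalizer[OF pf.LF_comp[OF \<Psi>] pr.LF_comp[OF \<phi>]] _ F])
      fix v assume "v \<in> carrier V"
      then show "indicator {v} \<in> {F \<in> carrier V.P.MA. \<Psi> (pushforward f F) = \<phi> (V.R +>\<^bsub>V.P.MA\<^esub> F)}"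
        using \<psi>_f[of v] by (simp add: pf_indicator \<Psi>_ind V.iota_def)
    qed
    then show ?thesis by simp
  qed
  have "x \<in> (\<lambda>F. V.R +>\<^bsub>V.P.MA\<^esub> F) ` carrier V.P.MA" using x(1) unfolding V.T_eq V.I.carrier_quot .
  then obtain F where F: "x = V.R +>\<^bsub>V.P.MA\<^esub> F" "F \<in> carrier V.P.MA" by (rule imageE)
  have "W.R +>\<^bsub>W.P.MA\<^esub> pushforward f F = \<zero>\<^bsub>W.T\<^esub>"
    using x(2) F by (simp add: tensor_map_eq q.quot_map_rcos)
  then have "pushforward f F \<in> W.R" using F by (simp add: W.T_eq W.I.quot_eq_zero)
  then show "\<phi> x = 0" using \<Psi>_R eq[OF F(2)] F(1) by simp
qed

end

section \<open>Generators modulo the derived algebra\<close>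

text \<open>\<open>S\<close> spans \<open>A\<close> together with [A, A]; for a nilpotent Lie
  algebra this is equivalent to generating it. The formulation by subspaces can be used directly as
  an induction principle and passes easily to images and to extensions of scalars.\<close>

definition lie_generators :: "complex set \<Rightarrow> 'a calg \<Rightarrow> 'a set \<Rightarrow> bool" where
  "lie_generators K A S \<longleftrightarrow> S \<subseteq> carrier A \<and>
     (\<forall>U. linsub K A U \<and> S \<subseteq> U \<and> lower_central K A 2 \<subseteq> U \<longrightarrow> carrier A \<subseteq> U)"

lemma lie_generatorsI:
  assumes "S \<subseteq> carrier A"
    and "\<And>U x. \<lbrakk>linsub K A U; S \<subseteq> U; lower_central K A 2 \<subseteq> U; x \<in> carrier A\<rbrakk> \<Longrightarrow> x \<in> U"
  shows "lie_generators K A S"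
  using assms by (auto simp: lie_generators_def)

lemma lie_generatorsD:
  assumes "lie_generators K A S"
  shows lie_generators_subset: "S \<subseteq> carrier A"
    and lie_generators_span: "\<lbrakk>linsub K A U; S \<subseteq> U; lower_central K A 2 \<subseteq> U; x \<in> carrier A\<rbrakk> \<Longrightarrow> x \<in> U"
  using assms by (auto simp: lie_generators_def)

lemma (in ahom) lie_generators_image:
  assumes gen: "lie_generators K A S" and surj: "f ` carrier A = carrier B"
  shows "lie_generators K B (f ` S)"
proof (rule lie_generatorsI)
  show "f ` S \<subseteq> carrier B" using lie_generators_subset[OF gen] by auto
  fix U y assume U: "linsub K B U" "f ` S \<subseteq> U" "lower_central K B 2 \<subseteq> U" and "y \<in> carrier B"
  then have "y \<in> f ` carrier A" using surj by simp
  then obtain x where x: "y = f x" "x \<in> carrier A" by (rule imageE)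
  have "x \<in> {x \<in> carrier A. f x \<in> U}"
  proof (rule lie_generators_span[OF gen linsub_vimage[OF U(1)] _ _ x(2)])
    show "S \<subseteq> {x \<in> carrier A. f x \<in> U}" using U(2) lie_generators_subset[OF gen] by auto
    show "lower_central K A 2 \<subseteq> {x \<in> carrier A. f x \<in> U}"
      using subsetD[OF U(3)] subsetD[OF image_lc_subset, OF imageI] subsetD[OF A.lc_subset] by blast
  qed
  then show "y \<in> U" using x by simp
qed

lemma (in ext_scalars) lie_generators_tensor:
  assumes gen: "lie_generators \<rat> V S" shows "lie_generators K T (iota ` S)"
proof (rule lie_generatorsI)
  show "iota ` S \<subseteq> carrier T" using lie_generators_subset[OF gen] by auto
  fix U y assume U: "linsub K T U" "iota ` S \<subseteq> U" "lower_central K T 2 \<subseteq> U" and y: "y \<in> carrier T"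
  show "y \<in> U"
  proof (rule T_span[OF U(1) _ y])
    fix v assume v: "v \<in> carrier V"
    have "v \<in> {v \<in> carrier V. iota v \<in> U}"
    proof (rule lie_generators_span[OF gen iota_vimage[OF U(1)] _ _ v])
      show "S \<subseteq> {v \<in> carrier V. iota v \<in> U}" using U(2) lie_generators_subset[OF gen] by auto
      show "lower_central \<rat> V 2 \<subseteq> {v \<in> carrier V. iota v \<in> U}"
        using subsetD[OF U(3)] lc_iota subsetD[OF V.lc_subset] by blast
    qed
    then show "iota v \<in> U" by simp
  qed
qed

section \<open>The free Lie algebra and its nilpotent quotients\<close>

global_interpretation FM: magma "\<rat>" "{t. set_free_magma t \<subseteq> {..<n}}" Br for n :: nat
  by unfold_locales simp

lemma free_nonassoc_eq: "free_nonassoc \<rat> n = FM.MA n"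
  by (simp add: free_nonassoc_def)

abbreviation free_gen :: "nat \<Rightarrow> nat free_magma \<Rightarrow> complex" where
  "free_gen i \<equiv> indicator {Gen i}"

text \<open>A tree is either a leaf, hence a generator, or a product of two trees, hence in the
  second term of the lower central series.\<close>

lemma lie_generators_free_nonassoc: "lie_generators \<rat> (FM.MA n) (free_gen ` {..<n})"
proof (rule lie_generatorsI)
  show "free_gen ` {..<n} \<subseteq> carrier (FM.MA n)" by (auto intro!: FM.indicator_MA)
  fix U F assume U: "linsub \<rat> (FM.MA n) U" "free_gen ` {..<n} \<subseteq> U" "lower_central \<rat> (FM.MA n) 2 \<subseteq> U"
    and F: "F \<in> carrier (FM.MA n)"
  show "F \<in> U"
  proof (rule FM.MA_span[OF U(1) _ F])
    fix t :: "nat free_magma" assume t: "t \<in> {t. set_free_magma t \<subseteq> {..<n}}"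
    show "indicator {t} \<in> U"
    proof (cases t)
      case (Gen i)
      then show ?thesis using t U(2) by auto
    next
      case (Br s s')
      then have "indicator {s} \<in> carrier (FM.MA n)" "indicator {s'} \<in> carrier (FM.MA n)"
        using t by (auto intro!: FM.indicator_MA)
      then have "indicator {s} \<otimes>\<^bsub>FM.MA n\<^esub> indicator {s'} \<in> lower_central \<rat> (FM.MA n) 2"
        using FM.MA.lc_br[of 1] by (simp add: numeral_2_eq_2)
      then show ?thesis using U(3) Br by (auto simp: FM.indicator_br)
    qed
  qed
qed

definition lie_rel_ideal :: "nat \<Rightarrow> (nat free_magma \<Rightarrow> complex) set" where
  "lie_rel_ideal n = ideal_generated \<rat> (FM.MA n) (lie_relators (FM.MA n))"

lemma lie_relators_closed: "lie_relators (FM.MA n) \<subseteq> carrier (FM.MA n)"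
  unfolding lie_relators_def by (auto simp del: FM.MA_simps)

global_interpretation FI: kalg_ideal "\<rat>" "FM.MA n" "lie_rel_ideal n" for n
  unfolding lie_rel_ideal_def
  by (rule kalg_idealI[OF FM.kalg_MA FM.MA.alg_ideal_ideal_generated[OF lie_relators_closed]])

lemma free_lie_eq: "free_lie \<rat> n = quot_alg (FM.MA n) (lie_rel_ideal n)"
  by (simp add: free_lie_def free_nonassoc_eq lie_rel_ideal_def)

global_interpretation FP: ahom "\<rat>" "FM.MA n" "free_lie \<rat> n" "\<lambda>F. lie_rel_ideal n +>\<^bsub>FM.MA n\<^esub> F" for n
  unfolding free_lie_eq by (rule FI.ahom_quot)

lemma carrier_free_lie: "carrier (free_lie \<rat> n) = (\<lambda>F. lie_rel_ideal n +>\<^bsub>FM.MA n\<^esub> F) ` carrier (FM.MA n)"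
  unfolding free_lie_eq by (rule FI.carrier_quot)

lemma relator_zero:
  assumes "r \<in> lie_relators (FM.MA n)" shows "lie_rel_ideal n +>\<^bsub>FM.MA n\<^esub> r = \<zero>\<^bsub>free_lie \<rat> n\<^esub>"
  using assms lie_relators_closed FM.MA.ideal_generated_superset[OF lie_relators_closed, of n]
  unfolding free_lie_eq by (subst FI.quot_eq_zero) (auto simp: lie_rel_ideal_def)

global_interpretation FL: lie_alg "\<rat>" "free_lie \<rat> n" for n
proof
  note [simp del] = FM.MA_simps
  let ?p = "\<lambda>F. lie_rel_ideal n +>\<^bsub>FM.MA n\<^esub> F"
  {
    fix x assume "x \<in> carrier (free_lie \<rat> n)"
    then obtain F where F: "x = ?p F" "F \<in> carrier (FM.MA n)" unfolding carrier_free_lie by (rule imageE)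
    have "F \<otimes>\<^bsub>FM.MA n\<^esub> F \<in> lie_relators (FM.MA n)" unfolding lie_relators_def using F(2) by blast
    from relator_zero[OF this] show "x \<otimes>\<^bsub>free_lie \<rat> n\<^esub> x = \<zero>\<^bsub>free_lie \<rat> n\<^esub>"
      using F by (simp add: FP.hom_br)
  next
    fix x y z assume xyz: "x \<in> carrier (free_lie \<rat> n)" "y \<in> carrier (free_lie \<rat> n)" "z \<in> carrier (free_lie \<rat> n)"
    obtain F where F: "x = ?p F" "F \<in> carrier (FM.MA n)" using xyz(1) unfolding carrier_free_lie by (rule imageE)
    obtain G where G: "y = ?p G" "G \<in> carrier (FM.MA n)" using xyz(2) unfolding carrier_free_lie by (rule imageE)
    obtain H where H: "z = ?p H" "H \<in> carrier (FM.MA n)" using xyz(3) unfolding carrier_free_lie by (rule imageE)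
    let ?r = "F \<otimes>\<^bsub>FM.MA n\<^esub> (G \<otimes>\<^bsub>FM.MA n\<^esub> H) \<oplus>\<^bsub>FM.MA n\<^esub> G \<otimes>\<^bsub>FM.MA n\<^esub> (H \<otimes>\<^bsub>FM.MA n\<^esub> F) \<oplus>\<^bsub>FM.MA n\<^esub> H \<otimes>\<^bsub>FM.MA n\<^esub> (F \<otimes>\<^bsub>FM.MA n\<^esub> G)"
    have "?r \<in> lie_relators (FM.MA n)" unfolding lie_relators_def using F(2) G(2) H(2) by blast
    from relator_zero[OF this] show "x \<otimes>\<^bsub>free_lie \<rat> n\<^esub> (y \<otimes>\<^bsub>free_lie \<rat> n\<^esub> z) \<oplus>\<^bsub>free_lie \<rat> n\<^esub>
      y \<otimes>\<^bsub>free_lie \<rat> n\<^esub> (z \<otimes>\<^bsub>free_lie \<rat> n\<^esub> x) \<oplus>\<^bsub>free_lie \<rat> n\<^esub> z \<otimes>\<^bsub>free_lie \<rat> n\<^esub> (x \<otimes>\<^bsub>free_lie \<rat> n\<^esub> y) = \<zero>\<^bsub>free_lie \<rat> n\<^esub>"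
      using F G H by (simp add: FP.hom_br FP.hom_add)
  }
qed

text \<open>What the limit argument uses of the algebras L/L_k \<otimes> K. The index is shifted as
  in L/L_k: \<open>G k\<close> has nilpotency class below \<open>k\<close>, so \<open>G 1\<close> is
  zero and \<open>G 2\<close> is abelian. The number \<open>n\<close> of generators is the same on
  every level, and the generators are compatible with the projections.\<close>

locale lie_tower = cx_field K for K +
  fixes G :: "nat \<Rightarrow> 'a calg" and p :: "nat \<Rightarrow> 'a \<Rightarrow> 'a" and n :: nat and g :: "nat \<Rightarrow> nat \<Rightarrow> 'a"
  assumes tower_lie: "k \<ge> 1 \<Longrightarrow> lie_alg K (G k)"
    and tower_nil: "k \<ge> 1 \<Longrightarrow> lower_central K (G k) k = {\<zero>\<^bsub>G k\<^esub>}"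
    and tower_proj: "k \<ge> 1 \<Longrightarrow> ahom K (G (Suc k)) (G k) (p k)"
    and tower_surj: "k \<ge> 1 \<Longrightarrow> p k ` carrier (G (Suc k)) = carrier (G k)"
    and tower_ker: "\<lbrakk>k \<ge> 1; x \<in> carrier (G (Suc k)); p k x = \<zero>\<^bsub>G k\<^esub>\<rbrakk> \<Longrightarrow> x \<in> lower_central K (G (Suc k)) k"
    and tower_gen: "k \<ge> 1 \<Longrightarrow> lie_generators K (G k) (g k ` {..<n})"
    and tower_gen_proj: "\<lbrakk>k \<ge> 1; i < n\<rbrakk> \<Longrightarrow> p k (g (Suc k) i) = g k i"

section \<open>The quotients by the lower central series, with scalars extended, form a
  tower\<close>

context
  fixes n :: nat
begin

abbreviation free_L :: "flie calg" where "free_L \<equiv> free_lie \<rat> n"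

abbreviation free_lc :: "nat \<Rightarrow> flie set" where "free_lc k \<equiv> lower_central \<rat> free_L k"

lemma lc_kalg_ideal: "k \<ge> 1 \<Longrightarrow> kalg_ideal \<rat> free_L (free_lc k)"
  by (intro kalg_idealI FP.B.kalg_axioms FL.lc_alg_ideal)

lemma lie_nil_quot: "k \<ge> 1 \<Longrightarrow> lie_alg \<rat> (nil_quot n k)"
  by (intro lie_alg_quot FL.lie_alg_axioms FL.lc_alg_ideal)

definition nil_proj :: "nat \<Rightarrow> flie set \<Rightarrow> flie set" where
  "nil_proj k = quot_map free_L (free_lc (Suc k)) free_L (free_lc k) (\<lambda>x. x)"

definition nil_class :: "nat \<Rightarrow> flie \<Rightarrow> flie set" where
  "nil_class k x = free_lc k +>\<^bsub>free_L\<^esub> x"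

lemma nil_quot_khom: "k \<ge> 1 \<Longrightarrow> quot_khom \<rat> free_L (free_lc (Suc k)) free_L (free_lc k) (\<lambda>x. x)"
proof -
  assume k: "k \<ge> 1"
  interpret A: kalg_ideal "\<rat>" free_L "free_lc (Suc k)" by (rule lc_kalg_ideal) simp
  interpret B: kalg_ideal "\<rat>" free_L "free_lc k" by (rule lc_kalg_ideal[OF k])
  show ?thesis
    using FP.B.lc_decr[OF k] by unfold_locales (auto intro!: module_homI)
qed

lemma nil_class_ahom: "k \<ge> 1 \<Longrightarrow> ahom \<rat> free_L (nil_quot n k) (nil_class k)"
  unfolding nil_class_def by (rule kalg_ideal.ahom_quot[OF lc_kalg_ideal])

lemma nil_class_carrier: "k \<ge> 1 \<Longrightarrow> carrier (nil_quot n k) = nil_class k ` carrier free_L"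
  unfolding nil_class_def by (rule kalg_ideal.carrier_quot[OF lc_kalg_ideal])

lemma nil_class_zero: "\<lbrakk>k \<ge> 1; x \<in> carrier free_L\<rbrakk> \<Longrightarrow> nil_class k x = \<zero>\<^bsub>nil_quot n k\<^esub> \<longleftrightarrow> x \<in> free_lc k"
  unfolding nil_class_def by (rule kalg_ideal.quot_eq_zero[OF lc_kalg_ideal])

lemma nil_proj_class: "\<lbrakk>k \<ge> 1; x \<in> carrier free_L\<rbrakk> \<Longrightarrow> nil_proj k (nil_class (Suc k) x) = nil_class k x"
  unfolding nil_proj_def nil_class_def by (rule quot_khom.quot_map_rcos[OF nil_quot_khom])

lemma nil_proj_ahom: "k \<ge> 1 \<Longrightarrow> ahom \<rat> (nil_quot n (Suc k)) (nil_quot n k) (nil_proj k)"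
  unfolding nil_proj_def by (rule quot_khom.ahom_quot_map[OF nil_quot_khom]) auto

lemma nil_proj_surj: "k \<ge> 1 \<Longrightarrow> nil_proj k ` carrier (nil_quot n (Suc k)) = carrier (nil_quot n k)"
  by (simp add: nil_class_carrier image_image nil_proj_class)

lemma nil_quot_lc: "k \<ge> 1 \<Longrightarrow> lower_central \<rat> (nil_quot n k) j = nil_class k ` free_lc j"
  using ahom.image_lc[OF nil_class_ahom, of k j] by (simp add: nil_class_carrier)

lemma ext_scalars_nil: "\<lbrakk>cx_field K; k \<ge> 1\<rbrakk> \<Longrightarrow> ext_scalars K (nil_quot n k)"
  using lie_alg.axioms(1)[OF lie_nil_quot] by (intro ext_scalarsI)

lemma tensor_hom_nil: "\<lbrakk>cx_field K; k \<ge> 1\<rbrakk> \<Longrightarrow> tensor_hom K (nil_quot n (Suc k)) (nil_quot n k) (nil_proj k)"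
proof -
  assume K: "cx_field K" and k: "k \<ge> 1"
  interpret A: ext_scalars K "nil_quot n (Suc k)" by (rule ext_scalars_nil[OF K]) simp
  interpret B: ext_scalars K "nil_quot n k" by (rule ext_scalars_nil[OF K k])
  interpret ahom "\<rat>" "nil_quot n (Suc k)" "nil_quot n k" "nil_proj k" by (rule nil_proj_ahom[OF k])
  show ?thesis by unfold_locales
qed

definition level_gen :: "complex set \<Rightarrow> nat \<Rightarrow> nat \<Rightarrow> flie_quot" where
  "level_gen K k i = ext_scalars.iota K (nil_quot n k) (nil_class k (lie_rel_ideal n +>\<^bsub>FM.MA n\<^esub> free_gen i))"

theorem lie_tower_level:
  assumes K: "cx_field K"
  shows "lie_tower K (lie_level K n) (level_proj K n) n (level_gen K)"
proof (intro lie_tower.intro K lie_tower_axioms.intro)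
  fix k :: nat assume k: "k \<ge> 1"
  interpret A: ext_scalars K "nil_quot n (Suc k)" by (rule ext_scalars_nil[OF K]) simp
  interpret B: ext_scalars K "nil_quot n k" by (rule ext_scalars_nil[OF K k])
  interpret pr: ahom "\<rat>" "nil_quot n (Suc k)" "nil_quot n k" "nil_proj k" by (rule nil_proj_ahom[OF k])
  interpret t: tensor_hom K "nil_quot n (Suc k)" "nil_quot n k" "nil_proj k" by (rule tensor_hom_nil[OF K k])
  have lp: "level_proj K n k = tensor_map (nil_quot n (Suc k)) (nil_quot n k) K (nil_proj k)"
    by (simp add: level_proj_def nil_proj_def)
  show "lie_alg K (lie_level K n k)"
    unfolding lie_level_def by (rule lie_alg_tensor[OF K lie_nil_quot[OF k]])
  show "lower_central K (lie_level K n k) k = {\<zero>\<^bsub>lie_level K n k\<^esub>}"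
  proof -
    have "lower_central K B.T k \<subseteq> {\<zero>\<^bsub>B.T\<^esub>}"
    proof (rule B.lc_T_least[OF B.T.linsub_zero_set])
      fix v assume "v \<in> lower_central \<rat> (nil_quot n k) k"
      then obtain x where "v = nil_class k x" "x \<in> free_lc k" unfolding nil_quot_lc[OF k] by (rule imageE)
      then have "v = \<zero>\<^bsub>nil_quot n k\<^esub>" using nil_class_zero[OF k, of x] subsetD[OF FP.B.lc_subset] by simp
      then show "B.iota v \<in> {\<zero>\<^bsub>B.T\<^esub>}" by (simp add: B.iota_zero)
    qed
    then show ?thesis unfolding lie_level_def using linsub_zero[OF B.T.lc_linsub] by blast
  qed
  show "ahom K (lie_level K n (Suc k)) (lie_level K n k) (level_proj K n k)"
    unfolding lie_level_def lp by (rule t.ahom_tensor_map[OF pr.hom_br])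
  show "level_proj K n k ` carrier (lie_level K n (Suc k)) = carrier (lie_level K n k)"
    unfolding lie_level_def lp by (rule t.tensor_map_surj[OF nil_proj_surj[OF k]])
  \<comment> \<open>By right exactness it suffices to treat the images of rational elements of the
    kernel. These are classes of elements of the k-th term of the free Lie algebra.\<close>
  show "x \<in> lower_central K (lie_level K n (Suc k)) k"
    if "x \<in> carrier (lie_level K n (Suc k))" "level_proj K n k x = \<zero>\<^bsub>lie_level K n k\<^esub>" for x
    using that unfolding lie_level_def lp
  proof (rule t.tensor_map_kernel[OF nil_proj_surj[OF k] A.T.lc_linsub, rotated])
    fix v assume v: "v \<in> carrier (nil_quot n (Suc k))" "nil_proj k v = \<zero>\<^bsub>nil_quot n k\<^esub>"
    from v(1) obtain x where x: "v = nil_class (Suc k) x" "x \<in> carrier free_L"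
      unfolding nil_class_carrier[OF le_SucI[OF k]] by (rule imageE)
    with v(2) k have "x \<in> free_lc k" using nil_class_zero[OF k x(2)] nil_proj_class[OF k x(2)] by simp
    then have "v \<in> lower_central \<rat> (nil_quot n (Suc k)) k"
      using x(1) by (simp add: nil_quot_lc)
    then show "A.iota v \<in> lower_central K A.T k" by (rule A.lc_iota)
  qed
  have sub: "lie_rel_ideal n +>\<^bsub>FM.MA n\<^esub> free_gen i \<in> carrier free_L" if "i < n" for i
    using that by (intro FP.hom_closed FM.indicator_MA) simp
  interpret nc: ahom "\<rat>" free_L "nil_quot n k" "nil_class k" by (rule nil_class_ahom[OF k])
  have "lie_generators \<rat> free_L ((\<lambda>F. lie_rel_ideal n +>\<^bsub>FM.MA n\<^esub> F) ` free_gen ` {..<n})"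
    by (rule FP.lie_generators_image[OF lie_generators_free_nonassoc carrier_free_lie[symmetric]])
  from nc.lie_generators_image[OF this nil_class_carrier[OF k, symmetric]]
  have "lie_generators \<rat> (nil_quot n k) (nil_class k ` (\<lambda>F. lie_rel_ideal n +>\<^bsub>FM.MA n\<^esub> F) ` free_gen ` {..<n})" .
  from B.lie_generators_tensor[OF this]
  show "lie_generators K (lie_level K n k) (level_gen K k ` {..<n})"
    by (simp add: image_image level_gen_def lie_level_def)
  show "level_proj K n k (level_gen K (Suc k) i) = level_gen K k i" if "i < n" for i
  proof -
    have "nil_class (Suc k) (lie_rel_ideal n +>\<^bsub>FM.MA n\<^esub> free_gen i) \<in> carrier (nil_quot n (Suc k))"
      using sub[OF that] by (simp add: nil_class_carrier)
    then show ?thesis unfolding lp level_gen_def by (simp add: t.tensor_map_iota nil_proj_class[OF k sub[OF that]])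
  qed
qed

end

text \<open>In the last nonzero layer a bracket [x, z] with z in L_m depends on x only modulo
  [A, A], so x can be replaced by a combination of generators. Collecting the terms by generator
  leaves exactly \<open>n\<close> summands, a number that does not depend on \<open>y\<close> or
  \<open>m\<close>.\<close>

lemma (in lie_alg) lc_generators_sum:
  fixes n :: nat
  assumes gen: "lie_generators K A (g ` {..<n})" and m: "m \<ge> 1"
    and nil: "lower_central K A (Suc (Suc m)) = {\<zero>}" and y: "y \<in> lower_central K A (Suc m)"
  shows "\<exists>w. (\<forall>i<n. w i \<in> lower_central K A m) \<and> y = (\<Oplus>i\<in>{..<n}. g i \<otimes> w i)"
proof -
  have gc: "g i \<in> carrier A" if "i < n" for i using lie_generators_subset[OF gen] that by auto
  note lcc = subsetD[OF lc_subset]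
  define U where "U = {y \<in> carrier A. \<exists>w. (\<forall>i<n. w i \<in> lower_central K A m) \<and> y = (\<Oplus>i\<in>{..<n}. g i \<otimes> w i)}"
  have sc: "(\<Oplus>i\<in>{..<n}. g i \<otimes> w i) \<in> carrier A" if "\<forall>i<n. w i \<in> carrier A" for w
    using that gc by (intro finsum_closed) auto
  have U_I: "(\<Oplus>i\<in>{..<n}. g i \<otimes> w i) \<in> U" if "\<forall>i<n. w i \<in> lower_central K A m" for w
    using that sc[of w] lcc unfolding U_def by blast
  have z: "\<zero> \<in> U"
  proof -
    have "(\<Oplus>i\<in>{..<n}. g i \<otimes> \<zero>) = \<zero>" using gc by (intro add.finprod_one_eqI) simp
    then show ?thesis using U_I[of "\<lambda>_. \<zero>"] linsub_zero[OF lc_linsub] by simp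
  qed
  have U: "linsub K A U"
  proof (rule linsubI)
    show "U \<subseteq> carrier A" by (auto simp: U_def)
    show "\<zero> \<in> U" by (rule z)
    fix a b assume "a \<in> U" "b \<in> U"
    then obtain v w where v: "\<forall>i<n. v i \<in> lower_central K A m" "a = (\<Oplus>i\<in>{..<n}. g i \<otimes> v i)"
      and w: "\<forall>i<n. w i \<in> lower_central K A m" "b = (\<Oplus>i\<in>{..<n}. g i \<otimes> w i)" unfolding U_def by blast
    have vwc: "v i \<in> carrier A" "w i \<in> carrier A" if "i < n" for i using v w lcc that by blast+
    have "a \<oplus> b = (\<Oplus>i\<in>{..<n}. g i \<otimes> v i \<oplus> g i \<otimes> w i)"
      unfolding v(2) w(2) using gc vwc by (intro finsum_addf[symmetric]) auto
    also have "\<dots> = (\<Oplus>i\<in>{..<n}. g i \<otimes> (v i \<oplus> w i))"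
      using gc vwc by (intro finsum_cong') (auto simp: br_add_right)
    also have "\<dots> \<in> U" using v w linsub_add[OF lc_linsub] by (intro U_I) auto
    finally show "a \<oplus> b \<in> U" .
  next
    fix c a assume c: "c \<in> K" and "a \<in> U"
    then obtain v where v: "\<forall>i<n. v i \<in> lower_central K A m" "a = (\<Oplus>i\<in>{..<n}. g i \<otimes> v i)" unfolding U_def by blast
    have vc: "v i \<in> carrier A" if "i < n" for i using v lcc that by blast
    have "c \<odot> a = (\<Oplus>i\<in>{..<n}. c \<odot> (g i \<otimes> v i))"
      unfolding v(2) using gc vc c by (intro finsum_smult_ldistr) auto
    also have "\<dots> = (\<Oplus>i\<in>{..<n}. g i \<otimes> (c \<odot> v i))"
      using gc vc c by (intro finsum_cong') (auto simp: br_smult_right)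
    also have "\<dots> \<in> U" using v c linsub_smult[OF lc_linsub] by (intro U_I) auto
    finally show "c \<odot> a \<in> U" .
  qed
  have "lower_central K A (Suc m) \<subseteq> U"
  proof (rule lc_Suc_least[OF U m])
    fix x z assume x: "x \<in> carrier A" and z': "z \<in> lower_central K A m"
    have zc: "z \<in> carrier A" using lcc[OF z'] .
    have "x \<in> {x \<in> carrier A. x \<otimes> z \<in> U}"
    proof (rule lie_generators_span[OF gen linsub_br_left[OF U zc] _ _ x])
      show "g ` {..<n} \<subseteq> {x \<in> carrier A. x \<otimes> z \<in> U}"
      proof clarify
        fix i assume i: "i < n"
        have "(\<Oplus>j\<in>{..<n}. g j \<otimes> (if j = i then z else \<zero>)) \<in> U"
          using z' linsub_zero[OF lc_linsub] by (intro U_I) auto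
        also have "(\<Oplus>j\<in>{..<n}. g j \<otimes> (if j = i then z else \<zero>)) = g i \<otimes> z"
        proof (rule functional_eqI)
          fix f assume f: "f \<in> linear_functionals K A"
          have "f (\<Oplus>j\<in>{..<n}. g j \<otimes> (if j = i then z else \<zero>)) = (\<Sum>j<n. f (g j \<otimes> (if j = i then z else \<zero>)))"
            using gc zc by (intro LF_finsum[OF f]) auto
          also have "\<dots> = (\<Sum>j<n. if j = i then f (g i \<otimes> z) else 0)"
            using gc by (intro sum.cong) (auto simp: LF_zero[OF f])
          finally show "f (\<Oplus>j\<in>{..<n}. g j \<otimes> (if j = i then z else \<zero>)) = f (g i \<otimes> z)" using i by simp
        qed (use gc zc i in \<open>auto intro!: sc\<close>)
        finally show "g i \<in> carrier A \<and> g i \<otimes> z \<in> U" using gc[OF i] by simp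
      qed
      \<comment> \<open>These brackets lie in L_(m+2), which is zero.\<close>
      show "lower_central K A 2 \<subseteq> {x \<in> carrier A. x \<otimes> z \<in> U}"
        using lc_2_br[OF m _ z'] nil z lcc[of _ 2] by auto
    qed
    then show "x \<otimes> z \<in> U" by simp
  qed
  then show ?thesis using y unfolding U_def by blast
qed

lemma lie_aut_ahom:
  assumes "kalg K A" "\<Phi> \<in> lie_aut K A"
  shows "ahom K A A \<Phi>" "bij_betw \<Phi> (carrier A) (carrier A)" "\<Phi> ` carrier A = carrier A"
    "\<Phi> \<in> extensional (carrier A)"
proof -
  interpret kalg K A by fact
  show "ahom K A A \<Phi>"
    using assms(2) by unfold_locales (auto simp: lie_aut_def lin_end_def)
  show "bij_betw \<Phi> (carrier A) (carrier A)" "\<Phi> \<in> extensional (carrier A)" using assms(2) by (auto simp: lie_aut_def lin_end_def)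
  then show "\<Phi> ` carrier A = carrier A" by (simp add: bij_betw_def)
qed

section \<open>The inverse limit of a tower\<close>

context lie_tower
begin

text \<open>The record has the same shape as \<open>lie_limit\<close>, so for the tower of the
  \<open>lie_level\<close> algebras the two agree by unfolding.\<close>

definition lim :: "(nat \<Rightarrow> 'a) calg" where
  "lim = \<lparr>carrier = {s \<in> Pi\<^sub>E {1..} (\<lambda>k. carrier (G k)). \<forall>k\<ge>1. p k (s (Suc k)) = s k},
     mult = (\<lambda>s t. \<lambda>k\<in>{1..}. s k \<otimes>\<^bsub>G k\<^esub> t k),
     one = (\<lambda>k\<in>{1..}. \<one>\<^bsub>G k\<^esub>),
     zero = (\<lambda>k\<in>{1..}. \<zero>\<^bsub>G k\<^esub>),
     add = (\<lambda>s t. \<lambda>k\<in>{1..}. s k \<oplus>\<^bsub>G k\<^esub> t k),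
     smult = (\<lambda>c s. \<lambda>k\<in>{1..}. c \<odot>\<^bsub>G k\<^esub> s k)\<rparr>"

lemma lim_ops:
  "k \<ge> 1 \<Longrightarrow> (s \<otimes>\<^bsub>lim\<^esub> t) k = s k \<otimes>\<^bsub>G k\<^esub> t k"
  "k \<ge> 1 \<Longrightarrow> \<zero>\<^bsub>lim\<^esub> k = \<zero>\<^bsub>G k\<^esub>"
  "k \<ge> 1 \<Longrightarrow> (s \<oplus>\<^bsub>lim\<^esub> t) k = s k \<oplus>\<^bsub>G k\<^esub> t k"
  "k \<ge> 1 \<Longrightarrow> (c \<odot>\<^bsub>lim\<^esub> s) k = c \<odot>\<^bsub>G k\<^esub> s k"
  by (simp_all add: lim_def)

lemma lim_ext:
  "s \<otimes>\<^bsub>lim\<^esub> t \<in> extensional {1..}" "\<zero>\<^bsub>lim\<^esub> \<in> extensional {1..}"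
  "s \<oplus>\<^bsub>lim\<^esub> t \<in> extensional {1..}" "c \<odot>\<^bsub>lim\<^esub> s \<in> extensional {1..}"
  "s \<in> carrier lim \<Longrightarrow> s \<in> extensional {1..}"
  by (auto simp: lim_def PiE_def)

lemma limI:
  assumes "s \<in> extensional {1..}" "\<And>k. k \<ge> 1 \<Longrightarrow> s k \<in> carrier (G k)" "\<And>k. k \<ge> 1 \<Longrightarrow> p k (s (Suc k)) = s k"
  shows "s \<in> carrier lim"
  using assms by (auto simp: lim_def PiE_def)

lemma lim_comp: "\<lbrakk>s \<in> carrier lim; k \<ge> 1\<rbrakk> \<Longrightarrow> s k \<in> carrier (G k)"
  by (auto simp: lim_def PiE_def)

lemma lim_proj: "\<lbrakk>s \<in> carrier lim; k \<ge> 1\<rbrakk> \<Longrightarrow> p k (s (Suc k)) = s k"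
  by (auto simp: lim_def)

lemma lim_eqI:
  assumes "s \<in> extensional {1..}" "t \<in> extensional {1..}" "\<And>k. k \<ge> 1 \<Longrightarrow> s k = t k" shows "s = t"
  using extensionalityI[OF assms(1,2)] assms(3) by simp

lemma tower_kalg: "k \<ge> 1 \<Longrightarrow> kalg K (G k)"
  using lie_alg.axioms(1)[OF tower_lie] .

lemma tower_kspace: "k \<ge> 1 \<Longrightarrow> kspace K (G k)"
  using kalg.axioms(1)[OF tower_kalg] .

lemma tower_khom: "k \<ge> 1 \<Longrightarrow> khom K (G (Suc k)) (G k) (p k)"
  using tower_proj[of k] by (auto simp: ahom_def)

lemma lim_closed:
  shows "\<lbrakk>s \<in> carrier lim; t \<in> carrier lim\<rbrakk> \<Longrightarrow> s \<otimes>\<^bsub>lim\<^esub> t \<in> carrier lim"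
    and "\<zero>\<^bsub>lim\<^esub> \<in> carrier lim"
    and "\<lbrakk>s \<in> carrier lim; t \<in> carrier lim\<rbrakk> \<Longrightarrow> s \<oplus>\<^bsub>lim\<^esub> t \<in> carrier lim"
    and "\<lbrakk>c \<in> K; s \<in> carrier lim\<rbrakk> \<Longrightarrow> c \<odot>\<^bsub>lim\<^esub> s \<in> carrier lim"
proof -
  have mult: "p k (x \<otimes>\<^bsub>G (Suc k)\<^esub> y) = p k x \<otimes>\<^bsub>G k\<^esub> p k y"
    if "k \<ge> 1" "x \<in> carrier (G (Suc k))" "y \<in> carrier (G (Suc k))" for k x y
    using ahom.hom_br[OF tower_proj] that by blast
  have br: "x \<otimes>\<^bsub>G k\<^esub> y \<in> carrier (G k)" if "k \<ge> 1" "x \<in> carrier (G k)" "y \<in> carrier (G k)" for k x y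
    using kalg.br_closed[OF tower_kalg] that by blast
  have add: "x \<oplus>\<^bsub>G k\<^esub> y \<in> carrier (G k)" if "k \<ge> 1" "x \<in> carrier (G k)" "y \<in> carrier (G k)" for k x y
  proof -
    interpret kspace K "G k" by (rule tower_kspace[OF that(1)])
    show ?thesis using that by simp
  qed
  have zero: "\<zero>\<^bsub>G k\<^esub> \<in> carrier (G k)" if "k \<ge> 1" for k
  proof -
    interpret kspace K "G k" by (rule tower_kspace[OF that(1)])
    show ?thesis by simp
  qed
  show "\<lbrakk>s \<in> carrier lim; t \<in> carrier lim\<rbrakk> \<Longrightarrow> s \<otimes>\<^bsub>lim\<^esub> t \<in> carrier lim"
    by (intro limI lim_ext) (simp_all add: lim_ops lim_comp br mult lim_proj)
  show "\<zero>\<^bsub>lim\<^esub> \<in> carrier lim"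
    by (intro limI lim_ext) (simp_all add: lim_ops zero khom.hom_zero[OF tower_khom])
  show "\<lbrakk>s \<in> carrier lim; t \<in> carrier lim\<rbrakk> \<Longrightarrow> s \<oplus>\<^bsub>lim\<^esub> t \<in> carrier lim"
    by (intro limI lim_ext) (simp_all add: lim_ops lim_comp add lim_proj khom.hom_add[OF tower_khom])
  show "\<lbrakk>c \<in> K; s \<in> carrier lim\<rbrakk> \<Longrightarrow> c \<odot>\<^bsub>lim\<^esub> s \<in> carrier lim"
    by (intro limI lim_ext) (simp_all add: lim_ops lim_comp lim_proj khom.hom_smult[OF tower_khom]
       kspace.smult_K_closed[OF tower_kspace])
qed

lemma kspace_lim: "kspace K lim"
proof (rule kspaceI)
  show "cx_field K" ..
  show "abelian_group lim"
  proof (rule abelian_groupI)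
    fix s t u assume *: "s \<in> carrier lim" "t \<in> carrier lim" "u \<in> carrier lim"
    show "s \<oplus>\<^bsub>lim\<^esub> t \<oplus>\<^bsub>lim\<^esub> u = s \<oplus>\<^bsub>lim\<^esub> (t \<oplus>\<^bsub>lim\<^esub> u)"
    proof (rule lim_eqI[OF lim_ext(3,3)])
      fix k :: nat assume k: "k \<ge> 1"
      interpret kspace K "G k" by (rule tower_kspace[OF k])
      show "(s \<oplus>\<^bsub>lim\<^esub> t \<oplus>\<^bsub>lim\<^esub> u) k = (s \<oplus>\<^bsub>lim\<^esub> (t \<oplus>\<^bsub>lim\<^esub> u)) k"
        using k * by (simp add: lim_ops lim_comp M.a_assoc)
    qed
  next
    fix s t assume *: "s \<in> carrier lim" "t \<in> carrier lim"
    show "s \<oplus>\<^bsub>lim\<^esub> t = t \<oplus>\<^bsub>lim\<^esub> s"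
    proof (rule lim_eqI[OF lim_ext(3,3)])
      fix k :: nat assume k: "k \<ge> 1"
      interpret kspace K "G k" by (rule tower_kspace[OF k])
      show "(s \<oplus>\<^bsub>lim\<^esub> t) k = (t \<oplus>\<^bsub>lim\<^esub> s) k"
        using k * by (simp add: lim_ops lim_comp M.a_comm)
    qed
  next
    fix s assume *: "s \<in> carrier lim"
    show "\<zero>\<^bsub>lim\<^esub> \<oplus>\<^bsub>lim\<^esub> s = s"
    proof (rule lim_eqI[OF lim_ext(3) lim_ext(5)[OF *]])
      fix k :: nat assume k: "k \<ge> 1"
      interpret kspace K "G k" by (rule tower_kspace[OF k])
      show "(\<zero>\<^bsub>lim\<^esub> \<oplus>\<^bsub>lim\<^esub> s) k = s k"
        using k * by (simp add: lim_ops lim_comp)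
    qed
    have "(- 1) \<odot>\<^bsub>lim\<^esub> s \<oplus>\<^bsub>lim\<^esub> s = \<zero>\<^bsub>lim\<^esub>"
    proof (rule lim_eqI[OF lim_ext(3,2)])
      fix k :: nat assume k: "k \<ge> 1"
      interpret kspace K "G k" by (rule tower_kspace[OF k])
      show "((- 1) \<odot>\<^bsub>lim\<^esub> s \<oplus>\<^bsub>lim\<^esub> s) k = \<zero>\<^bsub>lim\<^esub> k"
        using k * by (simp add: lim_ops lim_comp M.l_neg flip: neg_eq_smult)
    qed
    then show "\<exists>t\<in>carrier lim. t \<oplus>\<^bsub>lim\<^esub> s = \<zero>\<^bsub>lim\<^esub>" using * lim_closed(4)[of "- 1" s] by auto
  qed (auto intro: lim_closed)
next
  fix a b s assume *: "a \<in> K" "b \<in> K" "s \<in> carrier lim"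
  show "(a + b) \<odot>\<^bsub>lim\<^esub> s = a \<odot>\<^bsub>lim\<^esub> s \<oplus>\<^bsub>lim\<^esub> b \<odot>\<^bsub>lim\<^esub> s"
    by (rule lim_eqI[OF lim_ext(4,3)])
      (use * in \<open>simp add: lim_ops lim_comp kspace.smult_K_add_left[OF tower_kspace]\<close>)
  show "(a * b) \<odot>\<^bsub>lim\<^esub> s = a \<odot>\<^bsub>lim\<^esub> (b \<odot>\<^bsub>lim\<^esub> s)"
    by (rule lim_eqI[OF lim_ext(4,4)])
      (use * in \<open>simp add: lim_ops lim_comp kspace.smult_K_assoc[OF tower_kspace]\<close>)
next
  fix a s t assume *: "a \<in> K" "s \<in> carrier lim" "t \<in> carrier lim"
  show "a \<odot>\<^bsub>lim\<^esub> (s \<oplus>\<^bsub>lim\<^esub> t) = a \<odot>\<^bsub>lim\<^esub> s \<oplus>\<^bsub>lim\<^esub> a \<odot>\<^bsub>lim\<^esub> t"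
    by (rule lim_eqI[OF lim_ext(4,3)])
      (use * in \<open>simp add: lim_ops lim_comp kspace.smult_K_add_right[OF tower_kspace]\<close>)
next
  fix s assume *: "s \<in> carrier lim"
  show "1 \<odot>\<^bsub>lim\<^esub> s = s"
    by (rule lim_eqI[OF lim_ext(4) lim_ext(5)[OF *]])
      (use * in \<open>simp add: lim_ops lim_comp kspace.smult_K_one[OF tower_kspace]\<close>)
qed (rule lim_closed)

lemma lie_alg_lim: "lie_alg K lim"
proof -
  interpret kspace K lim by (rule kspace_lim)
  show ?thesis
  proof
    fix s t u assume *: "s \<in> carrier lim" "t \<in> carrier lim" "u \<in> carrier lim"
    show "(s \<oplus>\<^bsub>lim\<^esub> t) \<otimes>\<^bsub>lim\<^esub> u = s \<otimes>\<^bsub>lim\<^esub> u \<oplus>\<^bsub>lim\<^esub> t \<otimes>\<^bsub>lim\<^esub> u"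
      by (rule lim_eqI[OF lim_ext(1,3)])
        (use * in \<open>simp add: lim_ops lim_comp kalg.br_add_left[OF tower_kalg]\<close>)
    show "u \<otimes>\<^bsub>lim\<^esub> (s \<oplus>\<^bsub>lim\<^esub> t) = u \<otimes>\<^bsub>lim\<^esub> s \<oplus>\<^bsub>lim\<^esub> u \<otimes>\<^bsub>lim\<^esub> t" if "u \<in> carrier lim" "s \<in> carrier lim" "t \<in> carrier lim" for u s t
      by (rule lim_eqI[OF lim_ext(1,3)])
        (use that in \<open>simp add: lim_ops lim_comp kalg.br_add_right[OF tower_kalg]\<close>)
    show "s \<otimes>\<^bsub>lim\<^esub> (t \<otimes>\<^bsub>lim\<^esub> u) \<oplus>\<^bsub>lim\<^esub> t \<otimes>\<^bsub>lim\<^esub> (u \<otimes>\<^bsub>lim\<^esub> s) \<oplus>\<^bsub>lim\<^esub> u \<otimes>\<^bsub>lim\<^esub> (s \<otimes>\<^bsub>lim\<^esub> t) = \<zero>\<^bsub>lim\<^esub>"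
      by (rule lim_eqI[OF lim_ext(3,2)])
        (use * in \<open>simp add: lim_ops lim_comp lie_alg.jacobi[OF tower_lie]\<close>)
  next
    fix c s t assume *: "c \<in> K" "s \<in> carrier lim" "t \<in> carrier lim"
    show "(c \<odot>\<^bsub>lim\<^esub> s) \<otimes>\<^bsub>lim\<^esub> t = c \<odot>\<^bsub>lim\<^esub> (s \<otimes>\<^bsub>lim\<^esub> t)"
      by (rule lim_eqI[OF lim_ext(1,4)])
        (use * in \<open>simp add: lim_ops lim_comp kalg.br_smult_left[OF tower_kalg]\<close>)
    show "s \<otimes>\<^bsub>lim\<^esub> (c \<odot>\<^bsub>lim\<^esub> t) = c \<odot>\<^bsub>lim\<^esub> (s \<otimes>\<^bsub>lim\<^esub> t)"
      by (rule lim_eqI[OF lim_ext(1,4)])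
        (use * in \<open>simp add: lim_ops lim_comp kalg.br_smult_right[OF tower_kalg]\<close>)
  next
    fix s assume *: "s \<in> carrier lim"
    show "s \<otimes>\<^bsub>lim\<^esub> s = \<zero>\<^bsub>lim\<^esub>"
      by (rule lim_eqI[OF lim_ext(1,2)])
        (use * in \<open>simp add: lim_ops lim_comp lie_alg.br_self[OF tower_lie]\<close>)
  qed (rule lim_closed)
qed

sublocale lim: lie_alg K lim
  by (rule lie_alg_lim)

lemma lim_ahom: "k \<ge> 1 \<Longrightarrow> ahom K lim (G k) (\<lambda>s. s k)"
proof -
  assume k: "k \<ge> 1"
  interpret Gk: kalg K "G k" by (rule tower_kalg[OF k])
  show ?thesis
    using k by unfold_locales (auto intro!: module_homI simp: lim_ops lim_comp)
qed

text \<open>The composite projection from level \<open>j + m\<close> to level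
  \<open>j\<close>.\<close>

primrec down :: "nat \<Rightarrow> nat \<Rightarrow> 'a \<Rightarrow> 'a" where
  "down 0 j x = x"
| "down (Suc m) j x = p j (down m (Suc j) x)"

lemma down_closed: "\<lbrakk>j \<ge> 1; x \<in> carrier (G (j + m))\<rbrakk> \<Longrightarrow> down m j x \<in> carrier (G j)"
proof (induction m arbitrary: j)
  case (Suc m)
  then have "down m (Suc j) x \<in> carrier (G (Suc j))" by simp
  then show ?case using khom.hom_closed[OF tower_khom[OF Suc.prems(1)]] by simp
qed simp

text \<open>A thread through \<open>x\<close> is obtained by choosing preimages upwards, one level
  after the other, and by projecting \<open>x\<close> downwards.\<close>

lemma lim_surj:
  assumes k: "k \<ge> 1" shows "(\<lambda>s. s k) ` carrier lim = carrier (G k)"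
proof -
  have "x \<in> (\<lambda>s. s k) ` carrier lim" if x: "x \<in> carrier (G k)" for x
  proof -
    have "\<exists>u. \<forall>m. (u m \<in> carrier (G (k + m)) \<and> (m = 0 \<longrightarrow> u m = x)) \<and> p (k + m) (u (Suc m)) = u m"
    proof (rule dependent_nat_choice)
      show "\<exists>y. y \<in> carrier (G (k + 0)) \<and> (0 = (0::nat) \<longrightarrow> y = x)" using x by auto
      fix y m assume y: "y \<in> carrier (G (k + m)) \<and> (m = 0 \<longrightarrow> y = x)"
      then have "y \<in> p (k + m) ` carrier (G (Suc (k + m)))" using tower_surj[of "k + m"] k by simp
      then show "\<exists>z. (z \<in> carrier (G (k + Suc m)) \<and> (Suc m = 0 \<longrightarrow> z = x)) \<and> p (k + m) z = y" by auto
    qed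
    then obtain u where u: "\<And>m. u m \<in> carrier (G (k + m))" "u 0 = x" "\<And>m. p (k + m) (u (Suc m)) = u m" by blast
    define s where "s = (\<lambda>j\<in>{1..}. if k \<le> j then u (j - k) else down (k - j) j x)"
    have "s \<in> carrier lim"
    proof (rule limI)
      show "s \<in> extensional {1..}" by (simp add: s_def)
      fix j :: nat assume j: "j \<ge> 1"
      show "s j \<in> carrier (G j)"
        using u(1)[of "j - k"] down_closed[OF j, of x "k - j"] x j by (cases "k \<le> j") (simp_all add: s_def)
      show "p j (s (Suc j)) = s j"
      proof (cases "k \<le> j")
        case True
        then show ?thesis using u(3)[of "j - k"] j by (simp add: s_def Suc_diff_le)
      next
        case False
        \<comment> \<open>For \<open>Suc j = k\<close> the value comes from the upper branch, and
          \<open>u 0 = x\<close> makes it agree with \<open>down 0 k x\<close>.\<close>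
        then have "s (Suc j) = down (k - Suc j) (Suc j) x" using u(2) by (auto simp: s_def)
        moreover have "k - j = Suc (k - Suc j)" using False by simp
        ultimately show ?thesis using False j by (simp add: s_def)
      qed
    qed
    moreover have "s k = x" using u(2) k by (simp add: s_def)
    ultimately show ?thesis by blast
  qed
  then show ?thesis using lim_comp[OF _ k] by auto
qed

lemma lim_zero_below:
  assumes s: "s \<in> carrier lim" and j: "1 \<le> j" "j \<le> k" and "s k = \<zero>\<^bsub>G k\<^esub>" shows "s j = \<zero>\<^bsub>G j\<^esub>"
  using j(2,1) assms(4)
proof (induction j rule: inc_induct)
  case (step m)
  then have "s (Suc m) = \<zero>\<^bsub>G (Suc m)\<^esub>" by simp
  then show ?case using lim_proj[OF s, of m] khom.hom_zero[OF tower_khom[of m]] step by simp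
qed simp

definition lim_gen :: "nat \<Rightarrow> nat \<Rightarrow> 'a" where
  "lim_gen i = (\<lambda>k\<in>{1..}. g k i)"

lemma lim_gen_closed: "i < n \<Longrightarrow> lim_gen i \<in> carrier lim"
  using lie_generators_subset[OF tower_gen]
  by (intro limI) (auto simp: lim_gen_def tower_gen_proj)

lemma image_lc_lim: "k \<ge> 1 \<Longrightarrow> (\<lambda>s. s k) ` lower_central K lim j = lower_central K (G k) j"
  by (rule ahom.image_lc[OF lim_ahom lim_surj])

abbreviation gen_sum :: "(nat \<Rightarrow> nat \<Rightarrow> 'a) \<Rightarrow> nat \<Rightarrow> 'a" where
  "gen_sum t \<equiv> (\<Oplus>\<^bsub>lim\<^esub> i\<in>{..<n}. lim_gen i \<otimes>\<^bsub>lim\<^esub> t i)"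

lemma gen_sum_closed: "(\<And>i. i < n \<Longrightarrow> t i \<in> carrier lim) \<Longrightarrow> gen_sum t \<in> carrier lim"
  using lim_gen_closed by (intro lim.finsum_closed) (auto intro: lim_closed)

lemma gen_sum_comp:
  assumes "k \<ge> 1" "\<And>i. i < n \<Longrightarrow> t i \<in> carrier lim"
  shows "gen_sum t k = (\<Oplus>\<^bsub>G k\<^esub> i\<in>{..<n}. g k i \<otimes>\<^bsub>G k\<^esub> t i k)"
proof -
  interpret ahom K lim "G k" "\<lambda>s. s k" by (rule lim_ahom[OF assms(1)])
  have "gen_sum t k = (\<Oplus>\<^bsub>G k\<^esub> i\<in>{..<n}. (lim_gen i \<otimes>\<^bsub>lim\<^esub> t i) k)"
    using assms lim_gen_closed by (intro hom_finsum) (auto intro: lim_closed)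
  also have "\<dots> = (\<Oplus>\<^bsub>G k\<^esub> i\<in>{..<n}. g k i \<otimes>\<^bsub>G k\<^esub> t i k)"
    using assms lim_comp lie_generators_subset[OF tower_gen[OF assms(1)]] by (intro B.M.finsum_cong') (auto simp: lim_ops lim_gen_def image_subset_iff)
  finally show ?thesis .
qed

text \<open>One correction step. A remainder that vanishes on level \<open>Suc m\<close> lies in the
  last nonzero layer of the next level, where it is a sum of brackets with generators; subtracting a
  lift of this sum makes it vanish one level further.\<close>

lemma approx_step:
  assumes m: "m \<ge> 1" and r: "r \<in> carrier lim" "r (Suc m) = \<zero>\<^bsub>G (Suc m)\<^esub>"
  shows "\<exists>u. (\<forall>i<n. u i \<in> carrier lim \<and> u i m = \<zero>\<^bsub>G m\<^esub>) \<and>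
    (r \<ominus>\<^bsub>lim\<^esub> gen_sum u) (Suc (Suc m)) = \<zero>\<^bsub>G (Suc (Suc m))\<^esub>"
proof -
  let ?H = "G (Suc (Suc m))"
  interpret H: lie_alg K ?H by (rule tower_lie) simp
  interpret c: ahom K lim ?H "\<lambda>s. s (Suc (Suc m))" by (rule lim_ahom) simp
  have "r (Suc (Suc m)) \<in> lower_central K ?H (Suc m)"
    using r lim_proj[OF r(1), of "Suc m"] lim_comp[OF r(1)] by (intro tower_ker) auto
  from H.lc_generators_sum[OF tower_gen m tower_nil this] obtain w where
    w: "\<And>i. i < n \<Longrightarrow> w i \<in> lower_central K ?H m"
       "r (Suc (Suc m)) = (\<Oplus>\<^bsub>?H\<^esub> i\<in>{..<n}. g (Suc (Suc m)) i \<otimes>\<^bsub>?H\<^esub> w i)" by auto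
  \<comment> \<open>The lifts are chosen in the m-th term of the lower central series of the limit,
    not just in the limit. This makes them vanish on level \<open>m\<close>, which is what lets the
    corrections converge.\<close>
  have "\<forall>i. \<exists>u. i < n \<longrightarrow> u \<in> lower_central K lim m \<and> u (Suc (Suc m)) = w i"
  proof
    fix i
    show "\<exists>u. i < n \<longrightarrow> u \<in> lower_central K lim m \<and> u (Suc (Suc m)) = w i"
    proof (cases "i < n")
      case True
      then have "w i \<in> (\<lambda>s. s (Suc (Suc m))) ` lower_central K lim m"
        using w(1) by (simp add: image_lc_lim)
      then show ?thesis by (auto elim!: imageE)
    qed auto
  qed
  from choice[OF this] obtain u where u: "\<And>i. i < n \<Longrightarrow> u i \<in> lower_central K lim m"
    "\<And>i. i < n \<Longrightarrow> u i (Suc (Suc m)) = w i" by blast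
  have uc: "u i \<in> carrier lim" if "i < n" for i using subsetD[OF lim.lc_subset u(1)[OF that]] .
  have "u i m = \<zero>\<^bsub>G m\<^esub>" if "i < n" for i
  proof -
    have "u i m \<in> (\<lambda>s. s m) ` lower_central K lim m" using u(1)[OF that] by (rule imageI)
    then show ?thesis unfolding image_lc_lim[OF m] tower_nil[OF m] by simp
  qed
  moreover have "(r \<ominus>\<^bsub>lim\<^esub> gen_sum u) (Suc (Suc m)) = \<zero>\<^bsub>?H\<^esub>"
  proof -
    have gH: "g (Suc (Suc m)) i \<in> carrier ?H" if "i < n" for i
      using lie_generators_subset[OF tower_gen[of "Suc (Suc m)"]] that by auto
    have wH: "w i \<in> carrier ?H" if "i < n" for i using subsetD[OF H.lc_subset w(1)[OF that]] .
    have "gen_sum u (Suc (Suc m)) = (\<Oplus>\<^bsub>?H\<^esub> i\<in>{..<n}. g (Suc (Suc m)) i \<otimes>\<^bsub>?H\<^esub> u i (Suc (Suc m)))"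
      using uc by (intro gen_sum_comp) auto
    also have "\<dots> = r (Suc (Suc m))"
      unfolding w(2) using u(2) gH wH by (intro H.M.finsum_cong') auto
    finally show ?thesis
      using r gen_sum_closed[OF uc] lim_comp[OF r(1), of "Suc (Suc m)"] by (simp add: c.hom_diff H.minus_self)
  qed
  ultimately show ?thesis using uc by (intro exI[of _ u]) simp
qed

text \<open>Successive approximation: the correction of step m vanishes on all levels up to
  \<open>k + m\<close>, so on each level the coefficients become stationary.\<close>

lemma lim_generators_sum:
  assumes k: "k \<ge> 1" and s: "s \<in> carrier lim" "s (Suc k) = \<zero>\<^bsub>G (Suc k)\<^esub>"
  shows "\<exists>T. (\<forall>i<n. T i \<in> carrier lim \<and> T i k = \<zero>\<^bsub>G k\<^esub>) \<and> s = gen_sum T"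
proof -
  \<comment> \<open>\<open>?P\<close> says that the coefficients vanish on level \<open>k\<close>
    and that the error is zero up to level \<open>k + m + 1\<close>; \<open>?Q\<close> says that
    step m changes nothing up to level \<open>k + m\<close>. The start is t = 0, because
    \<open>s\<close> vanishes on level \<open>Suc k\<close>.\<close>
  let ?P = "\<lambda>m t. (\<forall>i<n. t i \<in> carrier lim \<and> t i k = \<zero>\<^bsub>G k\<^esub>) \<and>
     (s \<ominus>\<^bsub>lim\<^esub> gen_sum t) (Suc (k + m)) = \<zero>\<^bsub>G (Suc (k + m))\<^esub>"
  let ?Q = "\<lambda>m t t'. \<forall>i<n. \<forall>j. 1 \<le> j \<and> j \<le> k + m \<longrightarrow> t' i j = t i j"
  have "\<exists>t. \<forall>m. ?P m (t m) \<and> ?Q m (t m) (t (Suc m))"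
  proof (rule dependent_nat_choice)
    have "gen_sum (\<lambda>_. \<zero>\<^bsub>lim\<^esub>) = \<zero>\<^bsub>lim\<^esub>" using lim_gen_closed by (intro lim.add.finprod_one_eqI) simp
    then show "\<exists>t. ?P 0 t" using k s by (intro exI[of _ "\<lambda>_. \<zero>\<^bsub>lim\<^esub>"]) (simp add: lim_ops lim.minus_zero)
    fix t m assume P: "?P m t"
    then have tc: "t i \<in> carrier lim" if "i < n" for i using that by blast
    let ?r = "s \<ominus>\<^bsub>lim\<^esub> gen_sum t"
    have rc: "?r \<in> carrier lim" using s gen_sum_closed[OF tc] by simp
    obtain u where u: "\<And>i. i < n \<Longrightarrow> u i \<in> carrier lim" "\<And>i. i < n \<Longrightarrow> u i (k + m) = \<zero>\<^bsub>G (k + m)\<^esub>"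
      "(?r \<ominus>\<^bsub>lim\<^esub> gen_sum u) (Suc (Suc (k + m))) = \<zero>\<^bsub>G (Suc (Suc (k + m)))\<^esub>"
      using approx_step[of "k + m" ?r] k rc P by auto
    have u0: "u i j = \<zero>\<^bsub>G j\<^esub>" if "i < n" "1 \<le> j" "j \<le> k + m" for i j
      using lim_zero_below[OF u(1)[OF that(1)] that(2,3) u(2)[OF that(1)]] .
    let ?t = "\<lambda>i. t i \<oplus>\<^bsub>lim\<^esub> u i"
    have comp: "?t i j = t i j" if "i < n" "1 \<le> j" "j \<le> k + m" for i j
    proof -
      interpret kspace K "G j" by (rule tower_kspace[OF that(2)])
      show ?thesis using u0[OF that] that lim_comp[OF tc] by (simp add: lim_ops)
    qed
    have "gen_sum ?t = gen_sum t \<oplus>\<^bsub>lim\<^esub> gen_sum u"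
    proof -
      have "gen_sum ?t = (\<Oplus>\<^bsub>lim\<^esub> i\<in>{..<n}. lim_gen i \<otimes>\<^bsub>lim\<^esub> t i \<oplus>\<^bsub>lim\<^esub> lim_gen i \<otimes>\<^bsub>lim\<^esub> u i)"
        using tc u(1) lim_gen_closed by (intro lim.M.finsum_cong') (auto simp: lim.br_add_right)
      also have "\<dots> = gen_sum t \<oplus>\<^bsub>lim\<^esub> gen_sum u"
        using tc u(1) lim_gen_closed by (intro lim.M.finsum_addf) auto
      finally show ?thesis .
    qed
    then have "s \<ominus>\<^bsub>lim\<^esub> gen_sum ?t = ?r \<ominus>\<^bsub>lim\<^esub> gen_sum u"
      using s gen_sum_closed[OF tc] gen_sum_closed[OF u(1)]
      by (simp add: a_minus_def lim.M.minus_add lim.M.a_assoc)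
    then have "?P (Suc m) ?t"
      using u(3) comp[of _ k] k P tc u(1) by (auto intro: lim_closed)
    moreover have "?Q m t ?t" using comp by blast
    ultimately have "?P (Suc m) ?t \<and> ?Q m t ?t" by (rule conjI)
    then show "\<exists>t'. ?P (Suc m) t' \<and> ?Q m t t'" by (rule exI[of _ ?t])
  qed
  then obtain t where t: "\<forall>m. ?P m (t m) \<and> ?Q m (t m) (t (Suc m))" by (rule exE)
  have P: "?P m (t m)" and Q: "?Q m (t m) (t (Suc m))" for m
    by (rule conjunct1[OF spec[OF t]], rule conjunct2[OF spec[OF t]])
  have tc: "t m i \<in> carrier lim" if "i < n" for m i using P that by blast
  \<comment> \<open>The diagonal is the limit of the coefficients: by \<open>?Q\<close> the
    component on level \<open>j\<close> no longer changes from stage \<open>j\<close> on.\<close>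
  define T where "T i = (\<lambda>j\<in>{1..}. t j i j)" for i
  have Tc: "T i \<in> carrier lim" if i: "i < n" for i
  proof (rule limI)
    show "T i \<in> extensional {1..}" by (simp add: T_def)
    fix j :: nat assume j: "j \<ge> 1"
    show "T i j \<in> carrier (G j)" using lim_comp[OF tc[OF i]] j by (simp add: T_def)
    have "p j (t (Suc j) i (Suc j)) = t (Suc j) i j" by (rule lim_proj[OF tc[OF i] j])
    also have "\<dots> = t j i j" using Q[of j] i j by simp
    finally show "p j (T i (Suc j)) = T i j" using j by (simp add: T_def)
  qed
  have "T i k = \<zero>\<^bsub>G k\<^esub>" if "i < n" for i using P[of k] that k by (simp add: T_def)
  moreover have "s = gen_sum T"
  proof (rule lim_eqI[OF lim_ext(5)[OF s(1)] lim_ext(5)[OF gen_sum_closed[OF Tc]]])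
    fix j :: nat assume j: "j \<ge> 1"
    interpret c: ahom K lim "G j" "\<lambda>s. s j" by (rule lim_ahom[OF j])
    have sc: "gen_sum (t j) \<in> carrier lim" by (rule gen_sum_closed[OF tc])
    \<comment> \<open>At stage \<open>j\<close> the error is zero on level \<open>k + j + 1\<close>,
      hence on the lower level \<open>j\<close>.\<close>
    have "(s \<ominus>\<^bsub>lim\<^esub> gen_sum (t j)) j = \<zero>\<^bsub>G j\<^esub>"
      by (rule lim_zero_below[of _ _ "Suc (k + j)"]) (use P[of j] s(1) sc j in auto)
    then have "s j = gen_sum (t j) j"
      using s(1) sc lim_comp[OF s(1) j] lim_comp[OF sc j] by (simp add: c.hom_diff)
    also have "\<dots> = gen_sum T j" using tc Tc j by (simp add: gen_sum_comp T_def)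
    finally show "s j = gen_sum T j" .
  qed
  ultimately show ?thesis using Tc by blast
qed

text \<open>In the induction the coefficients vanish on level \<open>k\<close>, hence lie in the
  k-th term by hypothesis, and the bracket with a generator raises this by one. The kernel of the
  projection is thereby seen to be stable under all automorphisms of the abstract Lie
  algebra.\<close>

theorem lim_kernel:
  assumes "k \<ge> 1" shows "{s \<in> carrier lim. s k = \<zero>\<^bsub>G k\<^esub>} = lower_central K lim k"
proof
  show "lower_central K lim k \<subseteq> {s \<in> carrier lim. s k = \<zero>\<^bsub>G k\<^esub>}"
  proof
    fix s assume s: "s \<in> lower_central K lim k"
    then have "s k \<in> (\<lambda>s. s k) ` lower_central K lim k" by (rule imageI)
    then have "s k = \<zero>\<^bsub>G k\<^esub>" unfolding image_lc_lim[OF assms] tower_nil[OF assms] by simp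
    then show "s \<in> {s \<in> carrier lim. s k = \<zero>\<^bsub>G k\<^esub>}" using subsetD[OF lim.lc_subset s] by simp
  qed
  show "{s \<in> carrier lim. s k = \<zero>\<^bsub>G k\<^esub>} \<subseteq> lower_central K lim k"
    using assms
  proof (induction k rule: nat_induct_at_least)
    case (Suc k)
    show ?case
    proof clarify
      fix s assume s: "s \<in> carrier lim" "s (Suc k) = \<zero>\<^bsub>G (Suc k)\<^esub>"
      obtain T where T: "\<And>i. i < n \<Longrightarrow> T i \<in> carrier lim" "\<And>i. i < n \<Longrightarrow> T i k = \<zero>\<^bsub>G k\<^esub>" "s = gen_sum T"
        using lim_generators_sum[OF Suc.hyps s] by blast
      have "gen_sum T \<in> lower_central K lim (Suc k)"
      proof (rule lim.linsub_finsum[OF lim.lc_linsub])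
        fix i assume "i \<in> {..<n}"
        then show "lim_gen i \<otimes>\<^bsub>lim\<^esub> T i \<in> lower_central K lim (Suc k)"
          using T Suc.IH Suc.hyps by (intro lim.lc_br lim_gen_closed) auto
      qed
      then show "s \<in> lower_central K lim (Suc k)" using T(3) by simp
    qed
  qed auto
qed

text \<open>The induced map applies \<Phi> to an arbitrary lift. Two lifts differ by an element of a
  term of the lower central series, which \<Phi> preserves.\<close>

lemma lim_induced:
  assumes \<Phi>: "\<Phi> \<in> lie_aut K lim" and k: "k \<ge> 1"
  shows "\<exists>\<phi>\<in>lie_aut K (G k). \<forall>s\<in>carrier lim. \<phi> (s k) = \<Phi> s k"
proof -
  interpret P: ahom K lim lim \<Phi> by (rule lie_aut_ahom(1)[OF lim.kalg_axioms \<Phi>])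
  interpret c: ahom K lim "G k" "\<lambda>s. s k" by (rule lim_ahom[OF k])
  note bij = lie_aut_ahom(2,3)[OF lim.kalg_axioms \<Phi>]
  have lc_im: "\<Phi> ` lower_central K lim k = lower_central K lim k" by (rule P.image_lc[OF bij(2)])
  define \<sigma> where "\<sigma> x = (SOME s. s \<in> carrier lim \<and> s k = x)" for x
  have \<sigma>: "\<sigma> x \<in> carrier lim" "\<sigma> x k = x" if "x \<in> carrier (G k)" for x
  proof -
    have "x \<in> (\<lambda>s. s k) ` carrier lim" using that lim_surj[OF k] by simp
    then have "\<exists>s. s \<in> carrier lim \<and> s k = x" by (metis imageE)
    from someI_ex[OF this] show "\<sigma> x \<in> carrier lim" "\<sigma> x k = x" by (auto simp: \<sigma>_def)
  qed
  define \<phi> where "\<phi> = (\<lambda>x\<in>carrier (G k). \<Phi> (\<sigma> x) k)"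
  have \<phi>: "\<phi> (s k) = \<Phi> s k" if s: "s \<in> carrier lim" for s
  proof -
    have sk: "s k \<in> carrier (G k)" by (rule lim_comp[OF s k])
    have "\<sigma> (s k) \<ominus>\<^bsub>lim\<^esub> s \<in> lower_central K lim k"
      using \<sigma>[OF sk] s sk by (simp add: c.hom_diff c.B.minus_self flip: lim_kernel[OF k])
    then have "\<Phi> (\<sigma> (s k) \<ominus>\<^bsub>lim\<^esub> s) \<in> lower_central K lim k" using lc_im by blast
    then have "(\<Phi> (\<sigma> (s k)) \<ominus>\<^bsub>lim\<^esub> \<Phi> s) k = \<zero>\<^bsub>G k\<^esub>"
      using \<sigma>[OF sk] s by (simp add: P.hom_diff flip: lim_kernel[OF k])
    then show ?thesis
      using \<sigma>[OF sk] s sk by (simp add: c.hom_diff \<phi>_def)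
  qed
  have "\<phi> \<in> lie_aut K (G k)"
    unfolding lie_aut_def lin_end_def
  proof (intro CollectI conjI IntI ballI)
    have ex: "\<exists>s\<in>carrier lim. x = s k" if "x \<in> carrier (G k)" for x using \<sigma>[OF that] by metis
    show "\<phi> \<in> extensional (carrier (G k))" by (simp add: \<phi>_def)
    show "\<phi> \<in> module_hom (cfield K) (G k) (G k)"
    proof (rule module_homI)
      fix x assume "x \<in> carrier (G k)"
      with ex obtain s where s: "s \<in> carrier lim" "x = s k" by blast
      then show "\<phi> x \<in> carrier (G k)" by (simp add: \<phi>)
    next
      fix x y assume "x \<in> carrier (G k)" "y \<in> carrier (G k)"
      with ex obtain s t where s: "s \<in> carrier lim" "x = s k" "t \<in> carrier lim" "y = t k" by meson
      then show "\<phi> (x \<oplus>\<^bsub>G k\<^esub> y) = \<phi> x \<oplus>\<^bsub>G k\<^esub> \<phi> y"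
        using \<phi>[of "s \<oplus>\<^bsub>lim\<^esub> t"] by (simp add: \<phi> c.hom_add P.hom_add)
    next
      fix a x assume a: "a \<in> K" and "x \<in> carrier (G k)"
      with ex obtain s where s: "s \<in> carrier lim" "x = s k" by blast
      then show "\<phi> (a \<odot>\<^bsub>G k\<^esub> x) = a \<odot>\<^bsub>G k\<^esub> \<phi> x"
        using \<phi>[of "a \<odot>\<^bsub>lim\<^esub> s"] a by (simp add: \<phi> c.hom_smult P.hom_smult)
    qed
    show "\<phi> (x \<otimes>\<^bsub>G k\<^esub> y) = \<phi> x \<otimes>\<^bsub>G k\<^esub> \<phi> y" if xy: "x \<in> carrier (G k)" "y \<in> carrier (G k)" for x y
    proof -
      from xy ex obtain s t where s: "s \<in> carrier lim" "x = s k" "t \<in> carrier lim" "y = t k" by meson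
      then show ?thesis using \<phi>[of "s \<otimes>\<^bsub>lim\<^esub> t"] by (simp add: \<phi> c.hom_br P.hom_br)
    qed
    have "inj_on \<phi> (carrier (G k))"
    proof (rule inj_onI)
      fix x y assume xy: "x \<in> carrier (G k)" "y \<in> carrier (G k)" and eq: "\<phi> x = \<phi> y"
      from xy ex obtain s t where s: "s \<in> carrier lim" "x = s k" "t \<in> carrier lim" "y = t k" by meson
      have "\<Phi> (s \<ominus>\<^bsub>lim\<^esub> t) k = \<zero>\<^bsub>G k\<^esub>"
        using eq s by (simp add: \<phi> P.hom_diff c.hom_diff c.B.minus_self)
      then have "\<Phi> (s \<ominus>\<^bsub>lim\<^esub> t) \<in> lower_central K lim k"
        using s by (simp flip: lim_kernel[OF k])
      \<comment> \<open>Injectivity needs more than stability: \<Phi> maps the term of the lower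
        central series onto itself, so a difference that lands there already came from
        there.\<close>
      then have "\<Phi> (s \<ominus>\<^bsub>lim\<^esub> t) \<in> \<Phi> ` lower_central K lim k" unfolding lc_im .
      then obtain v where v: "\<Phi> (s \<ominus>\<^bsub>lim\<^esub> t) = \<Phi> v" "v \<in> lower_central K lim k" by (rule imageE)
      have vc: "v \<in> carrier lim" using subsetD[OF lim.lc_subset v(2)] .
      have "s \<ominus>\<^bsub>lim\<^esub> t = v"
        using bij(1) v(1) vc s(1,3) by (auto simp: bij_betw_def dest: inj_onD)
      then have "(s \<ominus>\<^bsub>lim\<^esub> t) k = \<zero>\<^bsub>G k\<^esub>" using v(2) by (simp flip: lim_kernel[OF k])
      then show "x = y" using s by (simp add: c.hom_diff)
    qed
    moreover have "\<phi> ` carrier (G k) = carrier (G k)"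
    proof -
      have "\<phi> ` (\<lambda>s. s k) ` carrier lim = (\<lambda>s. s k) ` \<Phi> ` carrier lim"
        by (auto simp: image_image \<phi> intro!: image_cong)
      then show ?thesis unfolding bij(2) lim_surj[OF k] .
    qed
    ultimately show "bij_betw \<phi> (carrier (G k)) (carrier (G k))" by (simp add: bij_betw_def)
  qed
  then show ?thesis using \<phi> by blast
qed

end

section \<open>Binomial and exponential polynomials\<close>

lemma poly_eq_on_nats:
  fixes q r :: "complex poly"
  assumes "\<And>m. poly q (of_nat m) = poly r (of_nat m)" shows "q = r"
proof (rule poly_eqI_degree[of "of_nat ` {..max (degree q) (degree r)}"])
  show "poly q x = poly r x" if "x \<in> of_nat ` {..max (degree q) (degree r)}" for x using that assms by auto
  have "card (of_nat ` {..max (degree q) (degree r)} :: complex set) = Suc (max (degree q) (degree r))"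
    by (subst card_image) (auto simp: inj_on_def)
  then show "degree q < card (of_nat ` {..max (degree q) (degree r)} :: complex set)"
    "degree r < card (of_nat ` {..max (degree q) (degree r)} :: complex set)" by linarith+
qed

definition lin_coeff :: "complex poly \<Rightarrow> complex" where
  "lin_coeff q = coeff q 1"

lemma lin_coeff_simps:
  "lin_coeff (\<Sum>i\<in>I. Q i) = (\<Sum>i\<in>I. lin_coeff (Q i))"
  "lin_coeff (Polynomial.smult c q) = c * lin_coeff q"
  "lin_coeff (q * r) = poly q 0 * lin_coeff r + lin_coeff q * poly r 0"
  by (simp_all add: lin_coeff_def coeff_sum coeff_mult poly_0_coeff_0)

lemma higher_pderiv_shift: "(pderiv ^^ i) (q \<circ>\<^sub>p [:a, 1:]) = ((pderiv ^^ i) q) \<circ>\<^sub>p [:a, 1:]"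
  by (induction i) (simp_all add: pderiv_pcompose pderiv_pCons)

lemma lin_coeff_shift: "lin_coeff (q \<circ>\<^sub>p [:a, 1:]) = poly (pderiv q) a"
proof -
  have "lin_coeff (q \<circ>\<^sub>p [:a, 1:]) = poly (pderiv (q \<circ>\<^sub>p [:a, 1:])) 0"
    by (simp add: lin_coeff_def poly_0_coeff_0 coeff_pderiv)
  then show ?thesis by (simp add: pderiv_pcompose pderiv_pCons poly_pcompose)
qed

text \<open>The coefficients of q(a + X) are the derivatives of q at a divided by factorials, and
  evaluation at X = 1 adds them up. Any \<open>N\<close> above the degree may serve as
  cutoff.\<close>

lemma poly_taylor_1:
  fixes q :: "complex poly"
  assumes "degree q < N" shows "poly q (a + 1) = (\<Sum>i<N. poly ((pderiv ^^ i) q) a / fact i)"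
proof -
  let ?r = "q \<circ>\<^sub>p [:a, 1:]"
  have "poly q (a + 1) = poly ?r 1" by (simp add: poly_pcompose)
  also have "\<dots> = (\<Sum>i\<le>degree ?r. coeff ?r i)" by (simp add: poly_altdef)
  also have "\<dots> = (\<Sum>i<N. coeff ?r i)"
    using assms by (intro sum.mono_neutral_left) (auto simp: coeff_eq_0)
  also have "\<dots> = (\<Sum>i<N. poly ((pderiv ^^ i) q) a / fact i)"
  proof (rule sum.cong[OF refl])
    fix i
    have "poly ((pderiv ^^ i) q) a = coeff ((pderiv ^^ i) ?r) 0"
      by (simp add: higher_pderiv_shift poly_pcompose flip: poly_0_coeff_0)
    also have "\<dots> = fact i * coeff ?r i" by (simp add: coeff_higher_pderiv pochhammer_fact)
    finally show "coeff ?r i = poly ((pderiv ^^ i) q) a / fact i" by simp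
  qed
  finally show ?thesis .
qed

definition binom_poly :: "nat \<Rightarrow> complex poly" where
  "binom_poly j = Polynomial.smult (1 / fact j) (\<Prod>i<j. [:- of_nat i, 1:])"

lemma poly_binom_poly: "poly (binom_poly j) t = t gchoose j"
  by (simp add: binom_poly_def poly_prod gbinomial_prod_rev field_simps atLeast0LessThan)

lemma degree_binom_poly: "degree (binom_poly j) \<le> j"
proof -
  have "degree (\<Prod>i<j. [:- of_nat i, 1 :: complex:]) \<le> (\<Sum>i<j. degree [:- of_nat i, 1 :: complex:])"
    by (rule degree_prod_sum_le[unfolded o_def]) simp
  then show ?thesis by (simp add: binom_poly_def)
qed

lemma poly_binom_poly_0: "poly (binom_poly j) 0 = of_bool (j = 0)"
  by (cases j) (simp_all add: poly_binom_poly gbinomial_0_left)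

text \<open>In X (X - 1) ... (X - j + 1) the linear coefficient is the product of the constants -1,
  ..., -(j - 1), that is (-1)^(j-1) (j-1)!. Dividing by j! gives the coefficients of the series of
  log(1 + X).\<close>

lemma lin_coeff_binom_poly: "lin_coeff (binom_poly j) = (if j = 0 then 0 else (- 1) ^ (j - 1) / of_nat j)"
proof (cases j)
  case 0
  then show ?thesis by (simp add: binom_poly_def lin_coeff_def)
next
  case (Suc l)
  have "lin_coeff (\<Prod>i<Suc l. [:- of_nat i, 1:]) = (- 1) ^ l * fact l" for l
  proof (induction l)
    case 0
    then show ?case by (simp add: lin_coeff_def)
  next
    case (Suc l)
    have "poly (\<Prod>i<Suc l. [:- of_nat i, 1:]) (0 :: complex) = 0"
      unfolding poly_prod by (rule prod_zero) auto
    then show ?case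
      using Suc by (subst prod.lessThan_Suc) (simp only: lin_coeff_simps, simp add: algebra_simps)
  qed
  then show ?thesis by (simp add: Suc binom_poly_def lin_coeff_simps del: prod.lessThan_Suc of_nat_Suc)
qed

text \<open>Newton's interpolation formula: with \<open>a j\<close> the value of a functional at N^j
  x, its value at t = m is that of the functional at (id - N)^m x.\<close>

definition newton_poly :: "nat \<Rightarrow> (nat \<Rightarrow> complex) \<Rightarrow> complex poly" where
  "newton_poly J a = (\<Sum>j<J. Polynomial.smult ((- 1) ^ j * a j) (binom_poly j))"

lemma newton_poly_0:
  assumes "\<And>j. j \<ge> J \<Longrightarrow> a j = 0" shows "poly (newton_poly J a) 0 = a 0"
proof -
  have "poly (newton_poly J a) 0 = (\<Sum>j<J. if j = 0 then a j else 0)"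
    unfolding newton_poly_def poly_sum by (intro sum.cong) (auto simp: poly_binom_poly_0)
  then show ?thesis using assms[of 0] by (cases J) auto
qed

text \<open>Pascal's rule for the binomials. Shifting the sequence \<open>a\<close> corresponds to
  applying N once more, so this is (id - N)^(m+1) = (id - N)^m - (id - N)^m N.\<close>

lemma newton_poly_Suc:
  assumes "\<And>j. j \<ge> J \<Longrightarrow> a j = 0"
  shows "poly (newton_poly J a) (t + 1) = poly (newton_poly J a) t - poly (newton_poly J (\<lambda>j. a (Suc j))) t"
proof (cases J)
  case (Suc l)
  have 1: "poly (newton_poly J a) s = a 0 + (\<Sum>j<l. (- 1) ^ Suc j * a (Suc j) * (s gchoose Suc j))" for s
    unfolding newton_poly_def Suc poly_sum by (subst sum.lessThan_Suc_shift) (simp add: poly_binom_poly)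
  \<comment> \<open>The summand for j = l contains \<open>a (Suc l)\<close>, that is
    \<open>a J\<close>, which is zero; this makes the two ranges of summation match.\<close>
  have 2: "poly (newton_poly J (\<lambda>j. a (Suc j))) t = (\<Sum>j<l. (- 1) ^ j * a (Suc j) * (t gchoose j))"
    using assms[of J] by (simp add: newton_poly_def Suc poly_sum poly_binom_poly)
  show ?thesis
    by (simp only: 1 2 gbinomial_Suc_Suc) (simp add: algebra_simps sum.distrib sum_negf sum_subtractf)
qed (simp add: newton_poly_def)

lemma lin_coeff_newton_poly:
  assumes "\<And>j. j \<ge> J \<Longrightarrow> a j = 0" shows "lin_coeff (newton_poly J a) = - (\<Sum>j=1..J. a j / of_nat j)"
proof -
  have "lin_coeff (newton_poly J a) = (\<Sum>j<J. if j = 0 then 0 else - (a j / of_nat j))"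
    unfolding newton_poly_def lin_coeff_simps
    by (intro sum.cong) (auto simp: lin_coeff_binom_poly gr0_conv_Suc)
  also have "\<dots> = (\<Sum>j=1..J. - (a j / of_nat j))"
    using assms by (intro sum.mono_neutral_cong) auto
  finally show ?thesis by (simp add: sum_negf)
qed

lemma degree_newton_poly:
  assumes "J > 0" shows "degree (newton_poly J a) < J"
  unfolding newton_poly_def
  using assms degree_binom_poly order_trans[OF degree_smult_le]
  by (intro degree_sum_less) (auto simp: less_le_trans intro: le_less_trans)

text \<open>With \<open>a j\<close> the value of a functional at D^j x, this is the functional of
  exp(t D) x as a polynomial in t. Differentiation shifts \<open>a\<close>, which corresponds to
  applying D.\<close>

definition exp_poly :: "nat \<Rightarrow> (nat \<Rightarrow> complex) \<Rightarrow> complex poly" where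
  "exp_poly J a = (\<Sum>i<J. monom (a i / fact i) i)"

lemma coeff_exp_poly: "coeff (exp_poly J a) i = (if i < J then a i / fact i else 0)"
  by (simp add: exp_poly_def coeff_sum coeff_monom if_distrib cong: if_cong)

lemma pderiv_exp_poly:
  assumes "\<And>j. j \<ge> J \<Longrightarrow> a j = 0"
  shows "pderiv (exp_poly J a) = exp_poly J (\<lambda>j. a (Suc j))"
  by (rule poly_eqI) (use assms in \<open>auto simp: coeff_pderiv coeff_exp_poly simp del: of_nat_Suc\<close>)

lemma higher_pderiv_exp_poly:
  assumes "\<And>j. j \<ge> J \<Longrightarrow> a j = 0"
  shows "(pderiv ^^ i) (exp_poly J a) = exp_poly J (\<lambda>j. a (i + j))"
  by (induction i) (simp_all add: pderiv_exp_poly assms)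

lemma degree_exp_poly: "J > 0 \<Longrightarrow> degree (exp_poly J a) < J"
  by (rule degree_lessI) (auto simp: coeff_exp_poly)

section \<open>Logarithms of unipotent maps\<close>

lemma khom_funpow:
  assumes "khom K V V T" shows "khom K V V (T ^^ m)"
proof -
  interpret khom K V V T by fact
  have c: "(T ^^ m) x \<in> carrier V" if "x \<in> carrier V" for x m using that by (induction m) simp_all
  have "T ^^ m \<in> module_hom (cfield K) V V"
  proof (rule module_homI)
    show "(T ^^ m) (x \<oplus>\<^bsub>V\<^esub> y) = (T ^^ m) x \<oplus>\<^bsub>V\<^esub> (T ^^ m) y" if "x \<in> carrier V" "y \<in> carrier V" for x y
      by (induction m) (use that c in \<open>simp_all add: hom_add\<close>)
    show "(T ^^ m) (a \<odot>\<^bsub>V\<^esub> x) = a \<odot>\<^bsub>V\<^esub> (T ^^ m) x" if "a \<in> K" "x \<in> carrier V" for a x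
      by (induction m) (use that c in \<open>simp_all add: hom_smult\<close>)
  qed (rule c)
  then show ?thesis by unfold_locales
qed

lemma khom_cong:
  assumes "khom K V W T" "\<And>x. x \<in> carrier V \<Longrightarrow> S x = T x" shows "khom K V W S"
proof -
  interpret khom K V W T by fact
  show ?thesis
    using assms(2) by unfold_locales (auto intro!: module_homI simp: hom_add hom_smult)
qed

lemma funpow_cong_on:
  assumes "\<And>x. x \<in> A \<Longrightarrow> S x = T x" "\<And>x. x \<in> A \<Longrightarrow> T x \<in> A" "x \<in> A"
  shows "(S ^^ m) x = (T ^^ m) x"
proof -
  have "(T ^^ m) x \<in> A \<and> (S ^^ m) x = (T ^^ m) x" using assms by (induction m) auto
  then show ?thesis by blast
qed

lemma (in kspace) khom_complement:
  assumes "khom K V V f" shows "khom K V V (\<lambda>y. y \<ominus> f y)"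
proof -
  interpret f: khom K V V f by fact
  have "(\<lambda>y. y \<ominus> f y) \<in> module_hom (cfield K) V V"
  proof (rule module_homI)
    fix x y assume "x \<in> carrier V" "y \<in> carrier V"
    then show "(x \<oplus> y) \<ominus> f (x \<oplus> y) = (x \<ominus> f x) \<oplus> (y \<ominus> f y)"
      by (intro functional_eqI) (auto simp: f.hom_add LF_simps)
  next
    fix c x assume "c \<in> K" "x \<in> carrier V"
    then show "(c \<odot> x) \<ominus> f (c \<odot> x) = c \<odot> (x \<ominus> f x)"
      by (intro functional_eqI) (auto simp: f.hom_smult LF_simps algebra_simps)
  qed auto
  then show ?thesis by unfold_locales
qed

lemma (in cx_field) K_fact [simp]: "1 / fact j \<in> K"
  by (metis K_divide K_of_nat K_one of_nat_fact)

lemma newton_poly_diff: "newton_poly J (\<lambda>j. a j - b j) = newton_poly J a - newton_poly J b"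
  by (simp add: newton_poly_def right_diff_distrib smult_diff_left sum_subtractf)

text \<open>A positive \<open>J\<close> is required so that the polynomials of f(\<Phi>^m x) can
  have degree strictly below \<open>J\<close>, even when they are zero.\<close>

locale unipotent = khom K V V \<Phi> for K and V :: "'a calg" and \<Phi> +
  fixes J :: nat
  assumes J_pos: "J > 0"
    and nilpotent: "x \<in> carrier V \<Longrightarrow> ((\<lambda>y. y \<ominus>\<^bsub>V\<^esub> \<Phi> y) ^^ J) x = \<zero>\<^bsub>V\<^esub>"
begin

abbreviation M :: "'a \<Rightarrow> 'a" where "M \<equiv> \<lambda>y. y \<ominus>\<^bsub>V\<^esub> \<Phi> y"

lemma khom_M: "khom K V V M"
  by (rule A.khom_complement[OF khom_axioms])

sublocale Mp: khom K V V "M ^^ m" for m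
  by (rule khom_funpow[OF khom_M])

sublocale \<Phi>p: khom K V V "\<Phi> ^^ m" for m
  by (rule khom_funpow[OF khom_axioms])

lemma M_pow_zero: "\<lbrakk>x \<in> carrier V; j \<ge> J\<rbrakk> \<Longrightarrow> (M ^^ j) x = \<zero>\<^bsub>V\<^esub>"
  using nilpotent[of "(M ^^ (j - J)) x"] by (simp flip: funpow_add[THEN fun_cong, unfolded o_def])

lemma M_pow_\<Phi>: "x \<in> carrier V \<Longrightarrow> (M ^^ j) (\<Phi> x) = (M ^^ j) x \<ominus>\<^bsub>V\<^esub> (M ^^ Suc j) x"
proof -
  assume x: "x \<in> carrier V"
  have "\<Phi> x = x \<ominus>\<^bsub>V\<^esub> M x" using x by (intro A.functional_eqI) (auto simp: A.LF_simps)
  then have "(M ^^ j) (\<Phi> x) = (M ^^ j) (x \<ominus>\<^bsub>V\<^esub> M x)" by (rule arg_cong)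
  also have "\<dots> = (M ^^ j) x \<ominus>\<^bsub>V\<^esub> (M ^^ j) (M x)" using x by (intro Mp.hom_diff) auto
  finally show ?thesis by (simp only: funpow_Suc_right o_apply)
qed

definition pow_poly :: "('a \<Rightarrow> complex) \<Rightarrow> 'a \<Rightarrow> complex poly" where
  "pow_poly f x = newton_poly J (\<lambda>j. f ((M ^^ j) x))"

lemma coeffs_zero: "\<lbrakk>f \<in> linear_functionals K V; x \<in> carrier V; j \<ge> J\<rbrakk> \<Longrightarrow> f ((M ^^ j) x) = 0"
  by (simp add: M_pow_zero A.LF_zero)

text \<open>The induction is over all \<open>x\<close>, since \<Phi>^(m+1) x is read as \<Phi>^m
  applied to \<Phi> x. Passing from x to \<Phi> x subtracts the shifted coefficient sequence, which
  is the situation of \<open>newton_poly_Suc\<close>.\<close>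

lemma poly_pow_poly:
  assumes f: "f \<in> linear_functionals K V" and x: "x \<in> carrier V"
  shows "poly (pow_poly f x) (of_nat m) = f ((\<Phi> ^^ m) x)"
  using x
proof (induction m arbitrary: x)
  case 0
  then show ?case using newton_poly_0[OF coeffs_zero[OF f 0]] by (simp add: pow_poly_def)
next
  case (Suc m)
  have "f ((\<Phi> ^^ Suc m) x) = f ((\<Phi> ^^ m) (\<Phi> x))" by (simp only: funpow_Suc_right o_apply)
  also have "\<dots> = poly (newton_poly J (\<lambda>j. f ((M ^^ j) (\<Phi> x)))) (of_nat m)"
    using Suc by (simp add: pow_poly_def)
  also have "(\<lambda>j. f ((M ^^ j) (\<Phi> x))) = (\<lambda>j. f ((M ^^ j) x) - f ((M ^^ Suc j) x))"
  proof (rule ext)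
    fix j
    have c: "(M ^^ i) x \<in> carrier V" for i using Suc.prems by (rule Mp.hom_closed)
    show "f ((M ^^ j) (\<Phi> x)) = f ((M ^^ j) x) - f ((M ^^ Suc j) x)"
      unfolding M_pow_\<Phi>[OF Suc.prems] by (rule A.LF_diff[OF f c c])
  qed
  also have "poly (newton_poly J \<dots>) (of_nat m) = poly (pow_poly f x) (of_nat m + 1)"
    unfolding pow_poly_def newton_poly_diff poly_diff
    by (rule newton_poly_Suc[symmetric]) (rule coeffs_zero[OF f Suc.prems])
  finally show ?case by (simp add: add.commute)
qed

text \<open>Cutting off at \<open>J\<close> loses nothing because all later powers of
  \<open>M\<close> vanish. The extensional version that \<open>lin_end\<close> asks for is
  introduced later as \<open>Log\<close>.\<close>

definition logm :: "'a \<Rightarrow> 'a" where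
  "logm x = \<ominus>\<^bsub>V\<^esub> (\<Oplus>\<^bsub>V\<^esub> i\<in>{1..J}. (1 / of_nat i) \<odot>\<^bsub>V\<^esub> (M ^^ i) x)"

lemma log_partial_sum:
  assumes "f \<in> linear_functionals K V" "x \<in> carrier V"
  shows "f (\<ominus>\<^bsub>V\<^esub> (\<Oplus>\<^bsub>V\<^esub> i\<in>{1..N}. (1 / of_nat i) \<odot>\<^bsub>V\<^esub> (M ^^ i) x)) = - (\<Sum>i=1..N. f ((M ^^ i) x) / of_nat i)"
    and "(\<Oplus>\<^bsub>V\<^esub> i\<in>{1..N}. (1 / of_nat i) \<odot>\<^bsub>V\<^esub> (M ^^ i) x) \<in> carrier V"
proof -
  have c: "(1 / of_nat i) \<odot>\<^bsub>V\<^esub> (M ^^ i) x \<in> carrier V" for i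
    using assms(2) by (intro A.smult_K_closed Mp.hom_closed) simp_all
  show s: "(\<Oplus>\<^bsub>V\<^esub> i\<in>{1..N}. (1 / of_nat i) \<odot>\<^bsub>V\<^esub> (M ^^ i) x) \<in> carrier V"
    using c by (intro A.finsum_closed) auto
  show "f (\<ominus>\<^bsub>V\<^esub> (\<Oplus>\<^bsub>V\<^esub> i\<in>{1..N}. (1 / of_nat i) \<odot>\<^bsub>V\<^esub> (M ^^ i) x)) = - (\<Sum>i=1..N. f ((M ^^ i) x) / of_nat i)"
    using s by (simp add: A.LF_neg[OF assms(1)] A.LF_finsum[OF assms(1)] c A.LF_smult[OF assms(1)] Mp.hom_closed assms(2))
qed

lemma logm_closed [simp]: "x \<in> carrier V \<Longrightarrow> logm x \<in> carrier V"
  unfolding logm_def using log_partial_sum(2)[OF A.LF_null] by simp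

lemma LF_logm:
  assumes "f \<in> linear_functionals K V" "x \<in> carrier V" shows "f (logm x) = lin_coeff (pow_poly f x)"
  unfolding logm_def pow_poly_def log_partial_sum(1)[OF assms]
  by (rule lin_coeff_newton_poly[symmetric]) (rule coeffs_zero[OF assms])

lemma LF_logm_sum:
  assumes "f \<in> linear_functionals K V" "x \<in> carrier V"
  shows "f (logm x) = - (\<Sum>i=1..J. f ((M ^^ i) x) / of_nat i)"
  unfolding logm_def by (rule log_partial_sum(1)[OF assms])

lemma khom_logm: "khom K V V logm"
proof -
  have "logm \<in> module_hom (cfield K) V V"
  proof (rule module_homI)
    fix x y assume xy: "x \<in> carrier V" "y \<in> carrier V"
    show "logm (x \<oplus>\<^bsub>V\<^esub> y) = logm x \<oplus>\<^bsub>V\<^esub> logm y"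
    proof (rule A.functional_eqI)
      fix f assume f: "f \<in> linear_functionals K V"
      show "f (logm (x \<oplus>\<^bsub>V\<^esub> y)) = f (logm x \<oplus>\<^bsub>V\<^esub> logm y)"
        using xy by (simp add: LF_logm_sum[OF f] A.LF_add[OF f] Mp.hom_add Mp.hom_closed add_divide_distrib sum.distrib)
    qed (use xy in auto)
  next
    fix c x assume cx: "c \<in> K" "x \<in> carrier V"
    show "logm (c \<odot>\<^bsub>V\<^esub> x) = c \<odot>\<^bsub>V\<^esub> logm x"
    proof (rule A.functional_eqI)
      fix f assume f: "f \<in> linear_functionals K V"
      show "f (logm (c \<odot>\<^bsub>V\<^esub> x)) = f (c \<odot>\<^bsub>V\<^esub> logm x)"
        using cx by (simp add: LF_logm_sum[OF f] A.LF_smult[OF f] Mp.hom_smult Mp.hom_closed sum_distrib_left)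
    qed (use cx in auto)
  qed auto
  then show ?thesis by unfold_locales
qed

sublocale Lp: khom K V V "logm ^^ i" for i
  by (rule khom_funpow[OF khom_logm])

lemma log_sums_logm: "log_sums K V \<Phi> (\<lambda>x\<in>carrier V. logm x)"
  unfolding log_sums_def vconverges_def
proof (intro ballI)
  fix x f assume x: "x \<in> carrier V" and f: "f \<in> linear_functionals K V"
  have "f (\<ominus>\<^bsub>V\<^esub> (\<Oplus>\<^bsub>V\<^esub> i\<in>{1..N}. (1 / of_nat i) \<odot>\<^bsub>V\<^esub> (M ^^ i) x)) = f (logm x)" if "N \<ge> J" for N
    unfolding log_partial_sum(1)[OF f x] LF_logm_sum[OF f x]
    using that coeffs_zero[OF f x] by (intro arg_cong[of _ _ uminus] sum.mono_neutral_right) auto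
  then have "eventually (\<lambda>N. f (\<ominus>\<^bsub>V\<^esub> (\<Oplus>\<^bsub>V\<^esub> i\<in>{1..N}. (1 / of_nat i) \<odot>\<^bsub>V\<^esub> (M ^^ i) x)) = f (logm x)) sequentially"
    unfolding eventually_sequentially by blast
  then show "(\<lambda>N. f (\<ominus>\<^bsub>V\<^esub> (\<Oplus>\<^bsub>V\<^esub> i\<in>{1..N}. (1 / of_nat i) \<odot>\<^bsub>V\<^esub> (M ^^ i) x))) \<longlonglongrightarrow> f ((\<lambda>x\<in>carrier V. logm x) x)"
    using x by (simp add: tendsto_eventually)
qed

text \<open>The semigroup law \<open>\<Phi>\<^sup>a\<^sup>+\<^sup>b = \<Phi>\<^sup>a \<Phi>\<^sup>b\<close> for natural exponents, differentiated in \<open>a\<close> at \<open>a = 0\<close>.\<close>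

lemma pderiv_pow_poly:
  assumes f: "f \<in> linear_functionals K V" and x: "x \<in> carrier V"
  shows "pderiv (pow_poly f x) = pow_poly (\<lambda>y. f (logm y)) x"
proof (rule poly_eq_on_nats)
  fix b :: nat
  interpret L: khom K V V logm by (rule khom_logm)
  \<comment> \<open>Translating the variable by b replaces x by \<Phi>^b x. The derivative at b thus
    becomes a linear coefficient at 0, which is known to be given by \<open>logm\<close>.\<close>
  have shift: "pow_poly f x \<circ>\<^sub>p [:of_nat b, 1:] = pow_poly f ((\<Phi> ^^ b) x)"
  proof (rule poly_eq_on_nats)
    fix a :: nat
    have "poly (pow_poly f x \<circ>\<^sub>p [:of_nat b, 1:]) (of_nat a) = poly (pow_poly f x) (of_nat (a + b))"
      by (simp add: poly_pcompose add.commute)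
    also have "\<dots> = f ((\<Phi> ^^ a) ((\<Phi> ^^ b) x))" using x by (simp only: poly_pow_poly[OF f] funpow_add o_apply)
    also have "\<dots> = poly (pow_poly f ((\<Phi> ^^ b) x)) (of_nat a)" using x by (simp add: poly_pow_poly[OF f] \<Phi>p.hom_closed)
    finally show "poly (pow_poly f x \<circ>\<^sub>p [:of_nat b, 1:]) (of_nat a) = poly (pow_poly f ((\<Phi> ^^ b) x)) (of_nat a)" .
  qed
  have "poly (pderiv (pow_poly f x)) (of_nat b) = lin_coeff (pow_poly f ((\<Phi> ^^ b) x))"
    by (simp flip: shift lin_coeff_shift)
  also have "\<dots> = f (logm ((\<Phi> ^^ b) x))" using x by (simp add: LF_logm[OF f] \<Phi>p.hom_closed)
  also have "\<dots> = poly (pow_poly (\<lambda>y. f (logm y)) x) (of_nat b)" using poly_pow_poly[OF L.LF_comp[OF f] x] by simp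
  finally show "poly (pderiv (pow_poly f x)) (of_nat b) = poly (pow_poly (\<lambda>y. f (logm y)) x) (of_nat b)" .
qed

lemma higher_pderiv_pow_poly:
  assumes f: "f \<in> linear_functionals K V" and x: "x \<in> carrier V"
  shows "(pderiv ^^ i) (pow_poly f x) = pow_poly (\<lambda>y. f ((logm ^^ i) y)) x"
proof (induction i)
  case (Suc i)
  have "(pderiv ^^ Suc i) (pow_poly f x) = pderiv (pow_poly (\<lambda>y. f ((logm ^^ i) y)) x)" using Suc by simp
  also have "\<dots> = pow_poly (\<lambda>y. f ((logm ^^ i) (logm y))) x" by (rule pderiv_pow_poly[OF Lp.LF_comp[OF f] x])
  finally show ?case by (simp only: funpow_Suc_right o_apply)
qed simp

lemma pow_poly_0:
  assumes f: "f \<in> linear_functionals K V" and x: "x \<in> carrier V"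
  shows "poly (pow_poly f x) 0 = f x"
  using poly_pow_poly[OF assms, of 0] by simp

lemma logm_pow_coeff:
  assumes f: "f \<in> linear_functionals K V" and x: "x \<in> carrier V"
  shows "poly ((pderiv ^^ i) (pow_poly f x)) 0 = f ((logm ^^ i) x)"
  unfolding higher_pderiv_pow_poly[OF assms] by (rule pow_poly_0[OF Lp.LF_comp[OF f] x])

text \<open>The value of f at the i-th power of \<open>logm\<close> is the i-th derivative at 0 of a
  polynomial of degree below \<open>J\<close>; so the exponent \<open>J\<close> of \<open>M\<close>
  also serves for \<open>logm\<close>.\<close>

lemma logm_nilpotent:
  assumes x: "x \<in> carrier V" shows "(logm ^^ J) x = \<zero>\<^bsub>V\<^esub>"
proof (rule A.functional_eqI)
  fix f assume f: "f \<in> linear_functionals K V"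
  have "degree (pow_poly f x) < J" unfolding pow_poly_def by (rule degree_newton_poly[OF J_pos])
  then have "poly ((pderiv ^^ J) (pow_poly f x)) 0 = 0"
    by (simp add: poly_0_coeff_0 coeff_higher_pderiv coeff_eq_0)
  then show "f ((logm ^^ J) x) = f \<zero>\<^bsub>V\<^esub>" using logm_pow_coeff[OF f x] A.LF_zero[OF f] by simp
qed (use x in \<open>auto intro: Lp.hom_closed\<close>)

lemma exp_sums_logm: "exp_sums K V logm \<Phi>"
  unfolding exp_sums_def vconverges_def
proof (intro ballI)
  fix x f assume x: "x \<in> carrier V" and f: "f \<in> linear_functionals K V"
  have c: "(logm ^^ j) x \<in> carrier V" for j using x by (rule Lp.hom_closed)
  have "f (\<Oplus>\<^bsub>V\<^esub> j\<in>{..<N}. (1 / fact j) \<odot>\<^bsub>V\<^esub> (logm ^^ j) x) = f (\<Phi> x)" if "N \<ge> J" for N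
  proof -
    have "degree (pow_poly f x) < N"
      using that degree_newton_poly[OF J_pos] unfolding pow_poly_def by (rule less_le_trans[rotated])
    then have "poly (pow_poly f x) (0 + 1) = (\<Sum>j<N. poly ((pderiv ^^ j) (pow_poly f x)) 0 / fact j)"
      by (rule poly_taylor_1)
    also have "poly (pow_poly f x) (0 + 1) = f (\<Phi> x)" using poly_pow_poly[OF f x, of 1] by simp
    finally have "f (\<Phi> x) = (\<Sum>j<N. f ((logm ^^ j) x) / fact j)" by (simp add: logm_pow_coeff[OF f x])
    then show ?thesis using c by (simp add: A.LF_finsum[OF f] A.LF_smult[OF f])
  qed
  then have "eventually (\<lambda>N. f (\<Oplus>\<^bsub>V\<^esub> j\<in>{..<N}. (1 / fact j) \<odot>\<^bsub>V\<^esub> (logm ^^ j) x) = f (\<Phi> x)) sequentially"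
    unfolding eventually_sequentially by blast
  then show "(\<lambda>N. f (\<Oplus>\<^bsub>V\<^esub> j\<in>{..<N}. (1 / fact j) \<odot>\<^bsub>V\<^esub> (logm ^^ j) x)) \<longlonglongrightarrow> f (\<Phi> x)"
    by (rule tendsto_eventually)
qed

text \<open>If \<open>D\<close> is nilpotent with \<open>exp D = \<Phi>\<close>, then \<open>f (\<Phi>\<^sup>m x)\<close> is also given by the exponential
  polynomial of \<open>D\<close>, whose linear coefficient is \<open>f (D x)\<close>.\<close>

lemma exp_unique:
  assumes D: "khom K V V D" and nil: "\<And>x. x \<in> carrier V \<Longrightarrow> (D ^^ I) x = \<zero>\<^bsub>V\<^esub>"
    and I: "I > 0" and exp: "exp_sums K V D \<Phi>" and x: "x \<in> carrier V"
  shows "D x = logm x"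
proof -
  interpret Dp: khom K V V "D ^^ i" for i by (rule khom_funpow[OF D])
  have z: "(D ^^ i) x = \<zero>\<^bsub>V\<^esub>" if "x \<in> carrier V" "i \<ge> I" for x i
    using that nil[of "(D ^^ (i - I)) x"] Dp.hom_closed by (simp flip: funpow_add[THEN fun_cong, unfolded o_def])
  \<comment> \<open>The partial sums of the exponential series are constant from \<open>I\<close>
    on, so convergence to \<Phi> x turns into an equation with a finite sum.\<close>
  have fin: "f (\<Phi> x) = (\<Sum>j<I. f ((D ^^ j) x) / fact j)"
    if f: "f \<in> linear_functionals K V" and x: "x \<in> carrier V" for f x
  proof -
    have c: "(D ^^ j) x \<in> carrier V" for j using x by (rule Dp.hom_closed)
    have "f (\<Oplus>\<^bsub>V\<^esub> j\<in>{..<N}. (1 / fact j) \<odot>\<^bsub>V\<^esub> (D ^^ j) x) = (\<Sum>j<I. f ((D ^^ j) x) / fact j)" if "N \<ge> I" for N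
    proof -
      have "f (\<Oplus>\<^bsub>V\<^esub> j\<in>{..<N}. (1 / fact j) \<odot>\<^bsub>V\<^esub> (D ^^ j) x) = (\<Sum>j<N. f ((D ^^ j) x) / fact j)"
        using c by (simp add: A.LF_finsum[OF f] A.LF_smult[OF f])
      also have "\<dots> = (\<Sum>j<I. f ((D ^^ j) x) / fact j)"
        using that z[OF x] by (intro sum.mono_neutral_right) (auto simp: A.LF_zero[OF f])
      finally show ?thesis .
    qed
    then have "eventually (\<lambda>N. f (\<Oplus>\<^bsub>V\<^esub> j\<in>{..<N}. (1 / fact j) \<odot>\<^bsub>V\<^esub> (D ^^ j) x) = (\<Sum>j<I. f ((D ^^ j) x) / fact j)) sequentially"
      unfolding eventually_sequentially by blast
    then have "(\<lambda>N. f (\<Oplus>\<^bsub>V\<^esub> j\<in>{..<N}. (1 / fact j) \<odot>\<^bsub>V\<^esub> (D ^^ j) x)) \<longlonglongrightarrow> (\<Sum>j<I. f ((D ^^ j) x) / fact j)"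
      by (rule tendsto_eventually)
    moreover have "(\<lambda>N. f (\<Oplus>\<^bsub>V\<^esub> j\<in>{..<N}. (1 / fact j) \<odot>\<^bsub>V\<^esub> (D ^^ j) x)) \<longlonglongrightarrow> f (\<Phi> x)"
      using exp f x by (auto simp: exp_sums_def vconverges_def)
    ultimately show ?thesis by (rule LIMSEQ_unique[rotated])
  qed
  define E where "E f x = exp_poly I (\<lambda>j. f ((D ^^ j) x))" for f x
  have E: "poly (E f x) (of_nat m) = f ((\<Phi> ^^ m) x)"
    if f: "f \<in> linear_functionals K V" and x: "x \<in> carrier V" for f x m
    using x
  proof (induction m arbitrary: x)
    case 0
    then show ?case using I by (simp add: E_def poly_0_coeff_0 coeff_exp_poly)
  next
    case (Suc m)
    have fz: "f ((D ^^ j) x) = 0" if "j \<ge> I" for j using z[OF Suc.prems that] A.LF_zero[OF f] by simp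
    \<comment> \<open>Taylor's formula with step 1: the i-th derivative of \<open>E f x\<close> is
      \<open>E f ((D ^^ i) x)\<close>, to which the induction hypothesis at m applies.\<close>
    have "poly (E f x) (of_nat m + 1) = (\<Sum>i<I. poly ((pderiv ^^ i) (E f x)) (of_nat m) / fact i)"
      unfolding E_def by (rule poly_taylor_1[OF degree_exp_poly[OF I]])
    also have "\<dots> = (\<Sum>i<I. poly (E f ((D ^^ i) x)) (of_nat m) / fact i)"
    proof -
      have "f ((D ^^ (i + j)) x) = f ((D ^^ j) ((D ^^ i) x))" for i j
        by (simp only: add.commute[of i] funpow_add o_apply)
      then show ?thesis unfolding E_def by (simp only: higher_pderiv_exp_poly[OF fz])
    qed
    also have "\<dots> = (\<Sum>i<I. f ((\<Phi> ^^ m) ((D ^^ i) x)) / fact i)"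
      using Suc Dp.hom_closed by simp
    \<comment> \<open>The finite exponential formula is used for the functional f composed with
      \<Phi>^m.\<close>
    also have "\<dots> = f ((\<Phi> ^^ m) (\<Phi> x))"
      using fin[OF \<Phi>p.LF_comp[OF f] Suc.prems] by simp
    finally show ?case by (simp only: funpow_Suc_right o_apply of_nat_Suc add.commute)
  qed
  show ?thesis
  proof (rule A.functional_eqI)
    fix f assume f: "f \<in> linear_functionals K V"
    have "E f x = pow_poly f x"
      by (rule poly_eq_on_nats) (simp add: E[OF f x] poly_pow_poly[OF f x])
    then have "lin_coeff (E f x) = f (logm x)" by (simp add: LF_logm[OF f x])
    moreover have "lin_coeff (E f x) = f (D x)"
    \<comment> \<open>For \<open>I = 1\<close> the polynomial is constant and shows no linear term,
      but then D itself is zero.\<close>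
    proof (cases "I = 1")
      case True
      then have "D x = \<zero>\<^bsub>V\<^esub>" using nil[OF x] by simp
      then show ?thesis using True by (simp add: E_def lin_coeff_def coeff_exp_poly A.LF_zero[OF f])
    next
      case False
      then show ?thesis using I by (simp add: E_def lin_coeff_def coeff_exp_poly)
    qed
    ultimately show "f (D x) = f (logm x)" by simp
  qed (use x Dp.hom_closed[of x 1] in auto)
qed

end

text \<open>Limits of complex sequences are unique and functionals separate points. This makes the
  description in \<open>lie_Log\<close> well defined.\<close>

lemma log_sums_unique:
  assumes "kspace K V" "log_sums K V \<Phi> D" "log_sums K V \<Phi> D'" "D \<in> lin_end K V" "D' \<in> lin_end K V"
  shows "D = D'"
proof (rule extensionalityI[of _ "carrier V"])
  interpret kspace K V by fact
  show "D \<in> extensional (carrier V)" "D' \<in> extensional (carrier V)" using assms by (auto simp: lin_end_def)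
  fix x assume x: "x \<in> carrier V"
  show "D x = D' x"
  proof (rule functional_eqI)
    show "D x \<in> carrier V" "D' x \<in> carrier V" using assms(4,5) x by (auto simp: lin_end_def module_hom_def)
    fix f assume "f \<in> linear_functionals K V"
    then show "f (D x) = f (D' x)"
      using assms(2,3) x unfolding log_sums_def vconverges_def by (meson LIMSEQ_unique)
  qed
qed

locale unipotent_aut = L: lie_alg K A + ahom K A A \<Phi> + unipotent K A \<Phi> J for K and A :: "'a calg" and \<Phi> J
begin

text \<open>Both sides of \<open>\<Phi>\<^sup>m [x, y] = [\<Phi>\<^sup>m x, \<Phi>\<^sup>m y]\<close> are polynomial in \<open>m\<close>; compare the linear coefficients.\<close>

lemma logm_br:
  assumes x: "x \<in> carrier A" and y: "y \<in> carrier A"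
  shows "logm (x \<otimes>\<^bsub>A\<^esub> y) = (logm x \<otimes>\<^bsub>A\<^esub> y) \<oplus>\<^bsub>A\<^esub> (x \<otimes>\<^bsub>A\<^esub> logm y)"
proof (rule L.functional_eqI)
  fix f assume f: "f \<in> linear_functionals K A"
  have left: "(\<lambda>u. f (u \<otimes>\<^bsub>A\<^esub> v)) \<in> linear_functionals K A" if "v \<in> carrier A" for v
    using that f by (auto simp: linear_functionals_def L.br_add_left L.br_smult_left)
  have right: "(\<lambda>v. f (u \<otimes>\<^bsub>A\<^esub> v)) \<in> linear_functionals K A" if "u \<in> carrier A" for u
    using that f by (auto simp: linear_functionals_def L.br_add_right L.br_smult_right)
  have pow_br: "(\<Phi> ^^ m) (x \<otimes>\<^bsub>A\<^esub> y) = (\<Phi> ^^ m) x \<otimes>\<^bsub>A\<^esub> (\<Phi> ^^ m) y" for m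
  proof (induction m)
    case (Suc m)
    have "(\<Phi> ^^ m) x \<in> carrier A" "(\<Phi> ^^ m) y \<in> carrier A" using x y by (auto intro: \<Phi>p.hom_closed)
    then show ?case using Suc by (simp add: hom_br)
  qed simp
  \<comment> \<open>The exponent m occurs in both factors of [\<Phi>^m x, \<Phi>^m y]. The left
    factor is expanded in binomials of m while the right one is kept; the coefficient of each
    binomial is then itself a polynomial in m.\<close>
  define r where "r = (\<Sum>j<J. Polynomial.smult ((- 1) ^ j) (pow_poly (\<lambda>v. f ((M ^^ j) x \<otimes>\<^bsub>A\<^esub> v)) y * binom_poly j))"
  have Mx: "(M ^^ j) x \<in> carrier A" for j using x by (rule Mp.hom_closed)
  have "pow_poly f (x \<otimes>\<^bsub>A\<^esub> y) = r"
  proof (rule poly_eq_on_nats)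
    fix m :: nat
    let ?y = "(\<Phi> ^^ m) y"
    have yc: "?y \<in> carrier A" using y by (rule \<Phi>p.hom_closed)
    have "poly (pow_poly f (x \<otimes>\<^bsub>A\<^esub> y)) (of_nat m) = f ((\<Phi> ^^ m) x \<otimes>\<^bsub>A\<^esub> ?y)"
      using x y by (simp add: poly_pow_poly[OF f] pow_br)
    also have "\<dots> = poly (pow_poly (\<lambda>u. f (u \<otimes>\<^bsub>A\<^esub> ?y)) x) (of_nat m)"
      using poly_pow_poly[OF left[OF yc] x] by simp
    also have "\<dots> = (\<Sum>j<J. (- 1) ^ j * f ((M ^^ j) x \<otimes>\<^bsub>A\<^esub> ?y) * poly (binom_poly j) (of_nat m))"
      by (simp add: pow_poly_def newton_poly_def poly_sum)
    also have "\<dots> = poly r (of_nat m)"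
      unfolding r_def poly_sum
      by (intro sum.cong) (simp_all add: poly_pow_poly[OF right[OF Mx] y])
    finally show "poly (pow_poly f (x \<otimes>\<^bsub>A\<^esub> y)) (of_nat m) = poly r (of_nat m)" .
  qed
  then have "f (logm (x \<otimes>\<^bsub>A\<^esub> y)) = lin_coeff r" using x y by (simp add: LF_logm[OF f])
  \<comment> \<open>Product rule at 0: the binomial polynomials vanish at 0 except for j = 0, so
    only this term contributes a derivative of the right factor.\<close>
  also have "\<dots> = (\<Sum>j<J. (- 1) ^ j * f ((M ^^ j) x \<otimes>\<^bsub>A\<^esub> y) * lin_coeff (binom_poly j) +
      (if j = 0 then f (x \<otimes>\<^bsub>A\<^esub> logm y) else 0))"
    unfolding r_def lin_coeff_simps
    by (intro sum.cong)
      (auto simp: pow_poly_0[OF right[OF Mx] y] poly_binom_poly_0 LF_logm[OF right[OF x] y] distrib_left)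
  also have "\<dots> = lin_coeff (pow_poly (\<lambda>u. f (u \<otimes>\<^bsub>A\<^esub> y)) x) + f (x \<otimes>\<^bsub>A\<^esub> logm y)"
    using J_pos by (simp add: sum.distrib pow_poly_def newton_poly_def lin_coeff_simps)
  also have "\<dots> = f (logm x \<otimes>\<^bsub>A\<^esub> y) + f (x \<otimes>\<^bsub>A\<^esub> logm y)"
    using LF_logm[OF left[OF y] x] by simp
  finally show "f (logm (x \<otimes>\<^bsub>A\<^esub> y)) = f ((logm x \<otimes>\<^bsub>A\<^esub> y) \<oplus>\<^bsub>A\<^esub> (x \<otimes>\<^bsub>A\<^esub> logm y))"
    using x y by (simp add: L.LF_add[OF f])
qed (use x y in auto)

definition Log :: "'a \<Rightarrow> 'a" where
  "Log = (\<lambda>x\<in>carrier A. logm x)"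

lemma Log_der: "Log \<in> lie_der K A"
proof -
  interpret l: khom K A A logm by (rule khom_logm)
  have "Log \<in> module_hom (cfield K) A A" by (rule module_homI) (simp_all add: Log_def l.hom_add l.hom_smult)
  then show ?thesis by (simp add: lie_der_def lin_end_def Log_def logm_br)
qed

lemma Log_sums: "log_sums K A \<Phi> Log"
  unfolding Log_def by (rule log_sums_logm)

lemma lie_Log_eq: "lie_Log K A \<Phi> = Log"
  unfolding lie_Log_def
proof (rule the_equality)
  show "Log \<in> lin_end K A \<and> log_sums K A \<Phi> Log" using Log_der Log_sums by (simp add: lie_der_def)
  then show "D = Log" if "D \<in> lin_end K A \<and> log_sums K A \<Phi> D" for D
    using that log_sums_unique[OF L.kspace_axioms] by blast
qed

lemma Log_exp: "exp_sums K A Log \<Phi>"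
proof -
  have "(Log ^^ j) x = (logm ^^ j) x" if "x \<in> carrier A" for j x
    by (rule funpow_cong_on[of "carrier A"]) (use that in \<open>simp_all add: Log_def\<close>)
  then show ?thesis using exp_sums_logm by (simp add: exp_sums_def)
qed

lemma Log_unique:
  assumes D: "D \<in> lie_der K A" and nil: "\<And>x. x \<in> carrier A \<Longrightarrow> (D ^^ I) x = \<zero>\<^bsub>A\<^esub>" "I > 0"
    and "exp_sums K A D \<Phi>"
  shows "D = Log"
proof (rule extensionalityI[of _ "carrier A"])
  show "D \<in> extensional (carrier A)" "Log \<in> extensional (carrier A)" using D by (auto simp: lie_der_def lin_end_def Log_def)
  have "khom K A A D" using D by unfold_locales (simp add: lie_der_def lin_end_def)
  then show "D x = Log x" if "x \<in> carrier A" for x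
    using exp_unique[OF _ nil assms(4) that] that by (simp add: Log_def)
qed

end

section \<open>Unipotent matrices and their logarithms\<close>

text \<open>Relations between blocks pass to the block diagonal matrix. The free index set
  \<open>I\<close> lets one statement serve for a difference of two matrices, for the logarithm
  series and, with \<open>I\<close> empty, for the zero matrix.\<close>

lemma diag_block_lincomb:
  fixes F :: "'x \<Rightarrow> complex mat" and H :: "'i \<Rightarrow> 'x \<Rightarrow> complex mat"
  assumes "\<And>x. x \<in> set xs \<Longrightarrow> F x \<in> carrier_mat (d x) (d x)"
    and "\<And>x i. \<lbrakk>x \<in> set xs; i \<in> I\<rbrakk> \<Longrightarrow> H i x \<in> carrier_mat (d x) (d x)"
    and "\<And>x r c. \<lbrakk>x \<in> set xs; r < d x; c < d x\<rbrakk> \<Longrightarrow> F x $$ (r, c) = (\<Sum>i\<in>I. k i * H i x $$ (r, c))"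
    and "r < sum_list (map d xs)" "c < sum_list (map d xs)"
  shows "diag_block_mat (map F xs) $$ (r, c) = (\<Sum>i\<in>I. k i * diag_block_mat (map (H i) xs) $$ (r, c))"
  using assms
proof (induction xs arbitrary: r c)
  case (Cons x xs)
  have dims: "dim_row (diag_block_mat (map Z ys)) = sum_list (map d ys)" "dim_col (diag_block_mat (map Z ys)) = sum_list (map d ys)"
    if "\<And>y. y \<in> set ys \<Longrightarrow> Z y \<in> carrier_mat (d y) (d y)" for Z :: "'x \<Rightarrow> complex mat" and ys
  proof -
    have "map dim_row (map Z ys) = map d ys" "map dim_col (map Z ys) = map d ys" using that by auto
    then show "dim_row (diag_block_mat (map Z ys)) = sum_list (map d ys)" "dim_col (diag_block_mat (map Z ys)) = sum_list (map d ys)"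
      unfolding dim_diag_block_mat by presburger+
  qed
  have entry: "diag_block_mat (map Z (x # xs)) $$ (r, c) =
      (if r < d x then if c < d x then Z x $$ (r, c) else 0
       else if c < d x then 0 else diag_block_mat (map Z xs) $$ (r - d x, c - d x))"
    if Z: "\<And>y. y \<in> set (x # xs) \<Longrightarrow> Z y \<in> carrier_mat (d y) (d y)" for Z :: "'x \<Rightarrow> complex mat"
  proof -
    have "dim_row (Z x) = d x" "dim_col (Z x) = d x" using Z[of x] by auto
    then show ?thesis using Cons.prems(4,5) dims[of xs Z] Z by (simp add: Let_def)
  qed
  have H: "diag_block_mat (map (H i) (x # xs)) $$ (r, c) =
      (if r < d x then if c < d x then H i x $$ (r, c) else 0
       else if c < d x then 0 else diag_block_mat (map (H i) xs) $$ (r - d x, c - d x))" if "i \<in> I" for i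
    using Cons.prems(2) that by (intro entry) auto
  have IH: "diag_block_mat (map F xs) $$ (r - d x, c - d x)
      = (\<Sum>i\<in>I. k i * diag_block_mat (map (H i) xs) $$ (r - d x, c - d x))" if "\<not> r < d x" "\<not> c < d x"
    using Cons.prems that by (intro Cons.IH) auto
  have F: "diag_block_mat (map F (x # xs)) $$ (r, c) =
      (if r < d x then if c < d x then F x $$ (r, c) else 0
       else if c < d x then 0 else diag_block_mat (map F xs) $$ (r - d x, c - d x))"
    using Cons.prems(1) by (intro entry)
  have "(\<Sum>i\<in>I. k i * diag_block_mat (map (H i) (x # xs)) $$ (r, c)) =
     (\<Sum>i\<in>I. k i * (if r < d x then if c < d x then H i x $$ (r, c) else 0
       else if c < d x then 0 else diag_block_mat (map (H i) xs) $$ (r - d x, c - d x)))"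
    using H by (intro sum.cong refl arg_cong2[of _ _ _ _ "(*)"])
  then show ?case
    unfolding F using Cons.prems(3)[of x r c] IH by (cases "r < d x"; cases "c < d x") simp_all
qed simp

lemma smult_mat_pow:
  assumes "A \<in> carrier_mat n n" shows "(k \<cdot>\<^sub>m A) ^\<^sub>m i = (k ^ i :: complex) \<cdot>\<^sub>m (A ^\<^sub>m i)"
proof (induction i)
  case (Suc i)
  have "(k ^ i \<cdot>\<^sub>m (A ^\<^sub>m i)) * (k \<cdot>\<^sub>m A) = (k ^ i * k) \<cdot>\<^sub>m (A ^\<^sub>m i * A)"
    using assms by (intro eq_matI) (auto simp: scalar_prod_def sum_distrib_left algebra_simps)
  then show ?case using Suc by (simp add: mult.commute)
qed (use assms in auto)

text \<open>The matrix logarithm is a series in A - 1, the logarithm of \<Phi> one in id - \<Phi>;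
  this converts between the two.\<close>

lemma one_minus_pow_sign:
  fixes A :: "complex mat"
  assumes "A \<in> carrier_mat n n" "r < n" "c < n"
  shows "((1\<^sub>m n - A) ^\<^sub>m i) $$ (r, c) = (- 1) ^ i * ((A - 1\<^sub>m n) ^\<^sub>m i) $$ (r, c)"
proof -
  have "1\<^sub>m n - A = (- 1) \<cdot>\<^sub>m (A - 1\<^sub>m n)" using assms by (intro eq_matI) auto
  moreover have "A - 1\<^sub>m n \<in> carrier_mat n n" by (intro minus_carrier_mat one_carrier_mat)
  ultimately show ?thesis using assms by (simp add: smult_mat_pow)
qed

lemma mat_entry_triple:
  assumes "P \<in> carrier_mat n n" "L \<in> carrier_mat n n" "Q \<in> carrier_mat n n" "r < n" "c < n"
  shows "(P * L * Q) $$ (r, c) = (\<Sum>t<n. \<Sum>s<n. P $$ (r, s) * L $$ (s, t) * Q $$ (t, c))"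
  using assms by (auto simp: scalar_prod_def sum_distrib_right atLeast0LessThan simp del: assoc_mult_mat intro!: sum.cong)

lemma jordan_matrix_minus_one:
  assumes "\<forall>x\<in>set n_as. snd x = (1 :: complex)"
  shows "jordan_matrix n_as - 1\<^sub>m (sum_list (map fst n_as)) = diag_block_mat (map (\<lambda>(l, z). jordan_block l 0) n_as)"
proof (rule eq_matI)
  let ?n = "sum_list (map fst n_as)"
  have dims: "dim_row (diag_block_mat (map (\<lambda>(l, z). jordan_block l (0 :: complex)) n_as)) = ?n"
     "dim_col (diag_block_mat (map (\<lambda>(l, z). jordan_block l (0 :: complex)) n_as)) = ?n"
    by (auto simp: dim_diag_block_mat intro!: arg_cong[of _ _ sum_list])
  then show "dim_row (jordan_matrix n_as - 1\<^sub>m ?n) = dim_row (diag_block_mat (map (\<lambda>(l, z). jordan_block l (0 :: complex)) n_as))"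
    "dim_col (jordan_matrix n_as - 1\<^sub>m ?n) = dim_col (diag_block_mat (map (\<lambda>(l, z). jordan_block l (0 :: complex)) n_as))"
    by simp_all
  fix r c assume "r < dim_row (diag_block_mat (map (\<lambda>(l, z). jordan_block l (0 :: complex)) n_as))"
    "c < dim_col (diag_block_mat (map (\<lambda>(l, z). jordan_block l (0 :: complex)) n_as))"
  then have rc: "r < ?n" "c < ?n" by (simp_all add: dims)
  \<comment> \<open>The two truth values index the two terms of a difference: the Jordan blocks with
    factor 1 and the identity blocks with factor -1.\<close>
  let ?H = "\<lambda>b x. if b then jordan_block (fst x) 1 else 1\<^sub>m (fst x) :: complex mat"
  have 1: "diag_block_mat (map (\<lambda>x. jordan_block (fst x) (0 :: complex)) n_as) $$ (r, c)
     = (\<Sum>b\<in>UNIV. (if b then 1 else - 1) * diag_block_mat (map (?H b) n_as) $$ (r, c))"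
    using rc by (intro diag_block_lincomb[where d = fst]) (auto simp: UNIV_bool)
  have 2: "map (?H True) n_as = map (\<lambda>(l, z). jordan_block l z) n_as" using assms by auto
  have 3: "map (?H False) n_as = map (\<lambda>A. 1\<^sub>m (dim_row A)) (map (\<lambda>x. 1\<^sub>m (fst x) :: complex mat) n_as)" by simp
  have "diag_block_mat (map (?H False) n_as) = 1\<^sub>m ?n"
    unfolding 3 diag_block_one_mat by (simp add: o_def)
  then have "diag_block_mat (map (\<lambda>x. jordan_block (fst x) (0 :: complex)) n_as) $$ (r, c)
     = jordan_matrix n_as $$ (r, c) - 1\<^sub>m ?n $$ (r, c)"
    unfolding 1 jordan_matrix_def 2[symmetric] by (simp add: UNIV_bool)
  then show "(jordan_matrix n_as - 1\<^sub>m ?n) $$ (r, c) = diag_block_mat (map (\<lambda>(l, z). jordan_block l 0) n_as) $$ (r, c)"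
    using rc by (simp add: case_prod_unfold)
qed

lemma fst_le_sum_list: "x \<in> set xs \<Longrightarrow> fst x \<le> sum_list (map fst xs)" for xs :: "(nat \<times> 'b) list"
  by (induction xs) auto

text \<open>Here \<open>ln 1 = 0\<close>, and the powers of the nilpotent block vanish from exponent
  \<open>l\<close> on. So the sum may run up to any \<open>D\<close> that is at least
  \<open>l\<close>, in particular to one bound for blocks of different sizes.\<close>

lemma ln_jordan_block_one:
  assumes "r < l" "c < l" "l \<le> D"
  shows "ln_jordan_block l 1 $$ (r, c) = (\<Sum>i\<in>{1..D}. (- 1) ^ (i - 1) / of_nat i * (jordan_block l 0 ^\<^sub>m i) $$ (r, c))"
proof -
  have "inverse 1 \<cdot>\<^sub>m jordan_block l 1 - 1\<^sub>m l = jordan_block l (0 :: complex)"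
    by (intro eq_matI) auto
  then have "ln_jordan_block l 1 $$ (r, c) = (\<Sum>i\<in>{1..<l}. (- 1) ^ (i - 1) / of_nat i * (jordan_block l 0 ^\<^sub>m i) $$ (r, c))"
    using assms by (simp add: ln_jordan_block_def)
  also have "\<dots> = (\<Sum>i\<in>{1..D}. (- 1) ^ (i - 1) / of_nat i * (jordan_block l 0 ^\<^sub>m i) $$ (r, c))"
    using assms by (intro sum.mono_neutral_left) (auto simp: jordan_block_zero_pow)
  finally show ?thesis .
qed

lemma ln_jordan_matrix_one:
  assumes one: "\<forall>x\<in>set n_as. snd x = (1 :: complex)"
    and D: "sum_list (map fst n_as) \<le> D"
    and rc: "r < sum_list (map fst n_as)" "c < sum_list (map fst n_as)"
  shows "diag_block_mat (map (\<lambda>(l, z). ln_jordan_block l z) n_as) $$ (r, c) =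
    (\<Sum>i\<in>{1..D}. (- 1) ^ (i - 1) / of_nat i * ((jordan_matrix n_as - 1\<^sub>m (sum_list (map fst n_as))) ^\<^sub>m i) $$ (r, c))"
proof -
  have "diag_block_mat (map (\<lambda>x. ln_jordan_block (fst x) 1) n_as) $$ (r, c) =
    (\<Sum>i\<in>{1..D}. (- 1) ^ (i - 1) / of_nat i * diag_block_mat (map (\<lambda>x. jordan_block (fst x) 0 ^\<^sub>m i) n_as) $$ (r, c))"
  proof (rule diag_block_lincomb[where d = fst])
    fix x r c assume "x \<in> set n_as" "r < fst x" "c < fst x"
    then show "ln_jordan_block (fst x) 1 $$ (r, c) = (\<Sum>i\<in>{1..D}. (- 1) ^ (i - 1) / of_nat i * (jordan_block (fst x) 0 ^\<^sub>m i) $$ (r, c))"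
      using D fst_le_sum_list[of x n_as] by (intro ln_jordan_block_one) auto
  qed (use rc in \<open>auto simp: ln_jordan_block_def\<close>)
  moreover have "map (\<lambda>x. ln_jordan_block (fst x) 1) n_as = map (\<lambda>(l, z). ln_jordan_block l z) n_as"
    using one by auto
  moreover have "diag_block_mat (map (\<lambda>x. jordan_block (fst x) 0 ^\<^sub>m i) n_as)
      = (jordan_matrix n_as - 1\<^sub>m (sum_list (map fst n_as))) ^\<^sub>m i" for i
    unfolding jordan_matrix_minus_one[OF one]
    by (subst diag_block_pow_mat) (auto simp: o_def case_prod_unfold)
  ultimately show ?thesis by simp
qed

text \<open>Each diagonal entry of the Jordan form is a root of the characteristic polynomial. That
  blocks have positive size enters here: an empty block would contribute the factor 1, without a
  root.\<close>

lemma jordan_blocks_one: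
  fixes A :: "complex mat"
  assumes A: "A \<in> carrier_mat n n" and ev: "\<And>z. eigenvalue A z \<Longrightarrow> z = 1"
    and nz: "0 \<notin> fst ` set n_as" and sim: "similar_mat_wit A (jordan_matrix n_as) P Q"
  shows "\<forall>x\<in>set n_as. snd x = 1" "sum_list (map fst n_as) = n"
proof -
  have "similar_mat A (jordan_matrix n_as)" using sim by (auto simp: similar_mat_def)
  then have cp: "char_poly A = (\<Prod>(l, a)\<leftarrow>n_as. [:- a, 1:] ^ l)"
    using char_poly_similar[of A "jordan_matrix n_as"] jordan_matrix_char_poly[of n_as] by simp
  show "\<forall>x\<in>set n_as. snd x = 1"
  proof
    fix x assume x: "x \<in> set n_as"
    then have "fst x \<noteq> 0" using nz by (metis imageI)
    then have "poly (case x of (l, a) \<Rightarrow> [:- a, 1:] ^ l) (snd x) = 0" by (cases x) (simp add: poly_power)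
    then have "poly (char_poly A) (snd x) = 0"
      unfolding cp poly_prod_list using x by (auto simp: prod_list_zero_iff image_iff intro!: bexI[of _ x])
    then show "snd x = 1" using ev eigenvalue_root_char_poly[OF A] by blast
  qed
  show "sum_list (map fst n_as) = n"
    using similar_mat_witD2(5)[OF A sim] by auto
qed

lemma similar_mat_wit_minus_one:
  fixes A :: "complex mat"
  assumes A: "A \<in> carrier_mat n n" and sim: "similar_mat_wit A B P Q"
  shows "similar_mat_wit (A - 1\<^sub>m n) (B - 1\<^sub>m n) P Q"
proof -
  note D = similar_mat_witD2[OF A sim]
  show ?thesis
  proof (rule similar_mat_witI[OF D(1,2)])
    have "P * (B - 1\<^sub>m n) * Q = P * B * Q - P * 1\<^sub>m n * Q"
      using D by (simp add: mult_minus_distrib_mat[of _ n n] minus_mult_distrib_mat[of _ n n])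
    then show "A - 1\<^sub>m n = P * (B - 1\<^sub>m n) * Q" using D by simp
  qed (use D in auto)
qed

text \<open>Conjugation commutes with powers, so the logarithm of any Jordan form becomes the same
  series in A. In particular \<open>B\<close> does not depend on the Jordan form that was
  chosen.\<close>

lemma is_mat_ln_unipotent:
  assumes A: "A \<in> carrier_mat n n" and ev: "\<And>z. eigenvalue A z \<Longrightarrow> z = 1" and ln: "is_mat_ln A B"
  shows "B \<in> carrier_mat n n"
    and "\<lbrakk>n \<le> D; r < n; c < n\<rbrakk> \<Longrightarrow> B $$ (r, c) = - (\<Sum>i=1..D. ((1\<^sub>m n - A) ^\<^sub>m i) $$ (r, c) / of_nat i)"
proof -
  from ln obtain n_as P Q where nz: "0 \<notin> fst ` set n_as" and sim: "similar_mat_wit A (jordan_matrix n_as) P Q"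
    and B: "B = P * diag_block_mat (map (\<lambda>(l, z). ln_jordan_block l z) n_as) * Q"
    unfolding is_mat_ln_def by blast
  have one: "\<forall>x\<in>set n_as. snd x = 1" "sum_list (map fst n_as) = n"
    using jordan_blocks_one[OF A _ nz sim] ev by auto
  note D2 = similar_mat_witD2[OF A sim]
  let ?J = "jordan_matrix n_as" and ?L = "diag_block_mat (map (\<lambda>(l, z). ln_jordan_block l z) n_as)"
  have L: "?L \<in> carrier_mat n n"
  proof -
    have "map dim_row (map (\<lambda>(l, z). ln_jordan_block l z) n_as) = map fst n_as"
      "map dim_col (map (\<lambda>(l, z). ln_jordan_block l z) n_as) = map fst n_as"
      by (auto simp: ln_jordan_block_def)
    then show ?thesis using one(2) by (simp only: carrier_mat_def dim_diag_block_mat mem_Collect_eq simp_thms)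
  qed
  show "B \<in> carrier_mat n n" unfolding B using L D2 by simp
  have pw: "(A - 1\<^sub>m n) ^\<^sub>m i = P * (?J - 1\<^sub>m n) ^\<^sub>m i * Q" for i
    by (rule similar_mat_wit_pow_id[OF similar_mat_wit_minus_one[OF A sim]])
  show "B $$ (r, c) = - (\<Sum>i=1..D. ((1\<^sub>m n - A) ^\<^sub>m i) $$ (r, c) / of_nat i)" if "n \<le> D" "r < n" "c < n"
  proof -
    let ?N = "\<lambda>i. (?J - 1\<^sub>m n) ^\<^sub>m i"
    have N: "?N i \<in> carrier_mat n n" for i by (intro pow_carrier_mat minus_carrier_mat one_carrier_mat)
    have "B $$ (r, c) = (\<Sum>t<n. \<Sum>s<n. P $$ (r, s) * ?L $$ (s, t) * Q $$ (t, c))"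
      unfolding B by (rule mat_entry_triple[OF D2(6) L D2(7) that(2,3)])
    also have "\<dots> = (\<Sum>t<n. \<Sum>s<n. \<Sum>i=1..D. (- 1) ^ (i - 1) / of_nat i * (P $$ (r, s) * ?N i $$ (s, t) * Q $$ (t, c)))"
      using one that ln_jordan_matrix_one[OF one(1), of D]
      by (intro sum.cong refl) (simp add: sum_distrib_left sum_distrib_right mult_ac)
    also have "\<dots> = (\<Sum>i=1..D. (- 1) ^ (i - 1) / of_nat i * (\<Sum>t<n. \<Sum>s<n. P $$ (r, s) * ?N i $$ (s, t) * Q $$ (t, c)))"
      unfolding sum_distrib_left by (rule trans[OF sum.cong[OF refl sum.swap] sum.swap])
    also have "\<dots> = (\<Sum>i=1..D. (- 1) ^ (i - 1) / of_nat i * ((A - 1\<^sub>m n) ^\<^sub>m i) $$ (r, c))"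
      unfolding pw mat_entry_triple[OF D2(6) N D2(7) that(2,3)] ..
    also have "\<dots> = (\<Sum>i=1..D. - (((1\<^sub>m n - A) ^\<^sub>m i) $$ (r, c) / of_nat i))"
    proof (rule sum.cong[OF refl])
      fix i assume "i \<in> {1..D}"
      then obtain j where "i = Suc j" by (cases i) auto
      then show "(- 1) ^ (i - 1) / of_nat i * ((A - 1\<^sub>m n) ^\<^sub>m i) $$ (r, c) = - (((1\<^sub>m n - A) ^\<^sub>m i) $$ (r, c) / of_nat i)"
        unfolding one_minus_pow_sign[OF A that(2,3)] by simp
    qed
    finally show ?thesis by (simp add: sum_negf)
  qed
qed

text \<open>Both parts use a Jordan form, in which all eigenvalues are one. No block is larger than
  \<open>n\<close>, hence the n-th power of the nilpotent part is zero.\<close>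

lemma unipotent_matrix:
  fixes A :: "complex mat"
  assumes A: "A \<in> carrier_mat n n" and ev: "\<And>z. eigenvalue A z \<Longrightarrow> z = 1"
  shows "\<exists>B. is_mat_ln A B" and "(1\<^sub>m n - A) ^\<^sub>m n = 0\<^sub>m n n"
proof -
  obtain as where "char_poly A = (\<Prod>a\<leftarrow>as. [:- a, 1:])" using char_poly_factorized[OF A] by blast
  from jordan_nf_exists[OF A this] obtain n_as where nf: "jordan_nf A n_as" by blast
  then obtain P Q where nz: "0 \<notin> fst ` set n_as" and sim: "similar_mat_wit A (jordan_matrix n_as) P Q"
    unfolding jordan_nf_def similar_mat_def by blast
  have one: "\<forall>x\<in>set n_as. snd x = 1" "sum_list (map fst n_as) = n"
    using jordan_blocks_one[OF A _ nz sim] ev by auto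
  have "0 \<notin> snd ` set n_as" using one(1) by auto
  then show "\<exists>B. is_mat_ln A B" unfolding is_mat_ln_def using nz sim by blast
  note D2 = similar_mat_witD2[OF A sim]
  let ?J = "jordan_matrix n_as"
  have pw: "(A - 1\<^sub>m n) ^\<^sub>m n = P * (?J - 1\<^sub>m n) ^\<^sub>m n * Q"
    by (rule similar_mat_wit_pow_id[OF similar_mat_wit_minus_one[OF A sim]])
  have J0: "(?J - 1\<^sub>m n) ^\<^sub>m n = 0\<^sub>m n n"
  proof (rule eq_matI)
    fix r c assume "r < dim_row (0\<^sub>m n n)" "c < dim_col (0\<^sub>m n n)"
    then have rc: "r < n" "c < n" by auto
    have "(?J - 1\<^sub>m n) ^\<^sub>m n = diag_block_mat (map (\<lambda>x. jordan_block (fst x) 0 ^\<^sub>m n) n_as)"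
      using jordan_matrix_minus_one[OF one(1)] one(2)
      by (simp, subst diag_block_pow_mat) (auto simp: o_def case_prod_unfold)
    \<comment> \<open>The empty sum stands for the entry 0: every block of the power
      vanishes.\<close>
    also have "\<dots> $$ (r, c) = (\<Sum>i\<in>{}. (0 :: complex) * diag_block_mat (map (\<lambda>x. 0\<^sub>m (fst x) (fst x)) n_as) $$ (r, c))"
    proof (rule diag_block_lincomb[where d = fst])
      fix x r c assume "x \<in> set n_as" "r < fst x" "c < fst x"
      then show "(jordan_block (fst x) (0 :: complex) ^\<^sub>m n) $$ (r, c) = (\<Sum>i\<in>{}. 0 * 0\<^sub>m (fst x) (fst x) $$ (r, c :: nat))"
        using fst_le_sum_list[of x n_as] one(2) by (auto simp: jordan_block_zero_pow)
    qed (use rc one(2) in auto)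
    finally show "((?J - 1\<^sub>m n) ^\<^sub>m n) $$ (r, c) = 0\<^sub>m n n $$ (r, c)" using rc by simp
  qed (use D2 in auto)
  have "(A - 1\<^sub>m n) ^\<^sub>m n = 0\<^sub>m n n" unfolding pw J0 using D2 by simp
  then show "(1\<^sub>m n - A) ^\<^sub>m n = 0\<^sub>m n n"
    using A by (intro eq_matI) (auto simp: one_minus_pow_sign)
qed

text \<open>An eigenvector for z is an eigenvector of 1 - A for 1 - z, whence (1 - z)^p = 0.\<close>

lemma nilpotent_eigenvalue:
  fixes A :: "complex mat"
  assumes A: "A \<in> carrier_mat n n" and nil: "(1\<^sub>m n - A) ^\<^sub>m p = 0\<^sub>m n n" and ev: "eigenvalue A z"
  shows "z = 1"
proof -
  obtain v where v: "v \<in> carrier_vec n" "v \<noteq> 0\<^sub>v n" "A *\<^sub>v v = z \<cdot>\<^sub>v v"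
    using ev A by (auto simp: eigenvalue_def eigenvector_def)
  have A1: "1\<^sub>m n - A \<in> carrier_mat n n" by (rule minus_carrier_mat[OF A])
  have "(1\<^sub>m n - A) *\<^sub>v v = 1\<^sub>m n *\<^sub>v v - A *\<^sub>v v" using A v by (intro minus_mult_distrib_mat_vec) auto
  also have "\<dots> = (1 - z) \<cdot>\<^sub>v v" using v by (intro eq_vecI) (auto simp: algebra_simps)
  finally have "eigenvector (1\<^sub>m n - A) v (1 - z)" using A v by (simp add: eigenvector_def)
  from eigenvector_pow[OF A1 this, of p] have "0\<^sub>m n n *\<^sub>v v = (1 - z) ^ p \<cdot>\<^sub>v v" unfolding nil .
  moreover have "0\<^sub>m n n *\<^sub>v v = 0\<^sub>v n" using v(1) by (intro eq_vecI) (auto simp: scalar_prod_def)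
  ultimately have 0: "0\<^sub>v n = (1 - z) ^ p \<cdot>\<^sub>v v" by simp
  obtain i where i: "i < n" "v $ i \<noteq> 0"
  proof (rule ccontr)
    assume "\<not> thesis"
    then have "v = 0\<^sub>v n" using v(1) that by (intro eq_vecI) auto
    then show False using v(2) by simp
  qed
  have "0\<^sub>v n $ i = ((1 - z) ^ p \<cdot>\<^sub>v v) $ i" using 0 by (rule arg_cong)
  then have "(1 - z) ^ p * v $ i = 0" using v(1) i(1) by simp
  then show ?thesis using i by simp
qed

section \<open>Matrices of linear maps\<close>

context kspace
begin

lemma lbasis_iff: "lbasis K V B \<longleftrightarrow> lin_indpt B \<and> span B = carrier V \<and> B \<subseteq> carrier V"
  by (rule vectorspace.basis_def[OF vectorspace])

lemma lbasis_span:
  assumes "lbasis K V B" "linsub K V U" "B \<subseteq> U" "x \<in> carrier V" shows "x \<in> U"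
proof -
  have "lspan K V B = carrier V" using assms(1) unfolding lbasis_iff by blast
  then show ?thesis using lspan_least[OF assms(2,3)] assms(4) by blast
qed

lemma lbasis_exists:
  assumes "finite S" "S \<subseteq> carrier V" "\<And>U. \<lbrakk>linsub K V U; S \<subseteq> U\<rbrakk> \<Longrightarrow> carrier V \<subseteq> U"
  shows "\<exists>bs. distinct bs \<and> lbasis K V (set bs)"
proof -
  have "carrier V \<subseteq> lspan K V S" using assms(3)[OF lspan_linsub[OF assms(2)] lspan_superset[OF assms(2)]] .
  then have "lspan K V S = carrier V" using linsub_subset[OF lspan_linsub[OF assms(2)]] by blast
  then have "vectorspace.fin_dim (cfield K) V"
    using assms unfolding vectorspace.fin_dim_def[OF vectorspace] by blast
  from vectorspace.finite_basis_exists[OF vectorspace this]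
  obtain B where "finite B" "lbasis K V B" by blast
  then show ?thesis using finite_distinct_list[of B] by blast
qed

text \<open>The i-th coordinate is a functional that vanishes on the span of the other basis vectors
  and is 1 at \<open>bs ! i\<close>. The expansion formula is tested by functionals, and for each of
  them only on the basis.\<close>

lemma dual_basis:
  assumes bs: "distinct bs" "lbasis K V (set bs)"
  shows "\<exists>c. (\<forall>i<length bs. c i \<in> linear_functionals K V \<and> (\<forall>j<length bs. c i (bs ! j) = of_bool (i = j))) \<and>
    (\<forall>x\<in>carrier V. x = (\<Oplus>i\<in>{..<length bs}. c i x \<odot> bs ! i))"
proof -
  have ind: "lin_indpt (set bs)" and sub: "set bs \<subseteq> carrier V" using bs(2) unfolding lbasis_iff by blast+
  have bc: "bs ! i \<in> carrier V" if "i < length bs" for i using that sub by auto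
  have "\<exists>f. i < length bs \<longrightarrow> f \<in> linear_functionals K V \<and> (\<forall>j<length bs. f (bs ! j) = of_bool (i = j))" for i
  proof (cases "i < length bs")
    case True
    let ?S = "set bs - {bs ! i}"
    have S: "?S \<subseteq> carrier V" "lin_indpt ?S" using sub ind subset_li_is_li[OF ind] by blast+
    have "?S \<union> {bs ! i} = set bs" using True by auto
    then have "bs ! i \<notin> lspan K V ?S"
      using vectorspace.lin_dep_iff_in_span[OF vectorspace S bc[OF True]] ind by auto
    from linear_functional_separates[OF lspan_linsub[OF S(1)] bc[OF True] this]
    obtain f where f: "f \<in> linear_functionals K V" "\<forall>u\<in>lspan K V ?S. f u = 0" "f (bs ! i) = 1" by blast
    have "f (bs ! j) = of_bool (i = j)" if "j < length bs" for j
    proof (cases "i = j")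
      case False
      then have "bs ! j \<in> ?S" using that True bs(1) by (auto simp: nth_eq_iff_index_eq)
      then show ?thesis using f(2) lspan_superset[OF S(1)] False by auto
    qed (use f in simp)
    then show ?thesis using f(1) by blast
  qed simp
  then obtain c where c: "\<And>i. i < length bs \<Longrightarrow> c i \<in> linear_functionals K V"
    "\<And>i j. \<lbrakk>i < length bs; j < length bs\<rbrakk> \<Longrightarrow> c i (bs ! j) = of_bool (i = j)"
    using choice[of "\<lambda>i f. i < length bs \<longrightarrow> f \<in> linear_functionals K V \<and> (\<forall>j<length bs. f (bs ! j) = of_bool (i = j))"]
    by metis
  have sc: "c i x \<odot> bs ! i \<in> carrier V" if "i < length bs" "x \<in> carrier V" for i x
    using that bc LF_closed[OF c(1)] by simp
  have sumc: "(\<Oplus>i\<in>{..<length bs}. c i x \<odot> bs ! i) \<in> carrier V" if "x \<in> carrier V" for x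
    using sc that by (intro finsum_closed) auto
  have LFs: "f (\<Oplus>i\<in>{..<length bs}. c i x \<odot> bs ! i) = (\<Sum>i<length bs. c i x * f (bs ! i))"
    if f: "f \<in> linear_functionals K V" and x: "x \<in> carrier V" for f x
  proof -
    have "f (\<Oplus>i\<in>{..<length bs}. c i x \<odot> bs ! i) = (\<Sum>i<length bs. f (c i x \<odot> bs ! i))"
      using sc x by (intro LF_finsum[OF f]) auto
    also have "\<dots> = (\<Sum>i<length bs. c i x * f (bs ! i))"
      using x bc LF_closed[OF c(1)] by (intro sum.cong) (auto simp: LF_smult[OF f])
    finally show ?thesis .
  qed
  have "x = (\<Oplus>i\<in>{..<length bs}. c i x \<odot> bs ! i)" if x: "x \<in> carrier V" for x
  proof (rule functional_eqI[OF x sumc[OF x]])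
    fix f assume f: "f \<in> linear_functionals K V"
    have "(\<lambda>x. \<Sum>i<length bs. c i x * f (bs ! i)) \<in> linear_functionals K V"
      unfolding linear_functionals_def
    proof (intro CollectI conjI ballI funcsetI)
      show "(\<Sum>i<length bs. c i x * f (bs ! i)) \<in> K" if "x \<in> carrier V" for x
        using that bc LF_closed[OF c(1)] LF_closed[OF f] by (intro K_sum K_mult) auto
      show "(\<Sum>i<length bs. c i (x \<oplus> y) * f (bs ! i)) = (\<Sum>i<length bs. c i x * f (bs ! i)) + (\<Sum>i<length bs. c i y * f (bs ! i))"
        if "x \<in> carrier V" "y \<in> carrier V" for x y
        using that by (simp add: LF_add[OF c(1)] distrib_right sum.distrib)
      show "(\<Sum>i<length bs. c i (a \<odot> x) * f (bs ! i)) = a * (\<Sum>i<length bs. c i x * f (bs ! i))"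
        if "a \<in> K" "x \<in> carrier V" for a x
        using that by (simp add: LF_smult[OF c(1)] sum_distrib_left mult.assoc)
    qed
    from LF_equalizer[OF f this]
    have "x \<in> {x \<in> carrier V. f x = (\<Sum>i<length bs. c i x * f (bs ! i))}"
    proof (rule lbasis_span[OF bs(2) _ _ x], intro subsetI)
      fix b assume "b \<in> set bs"
      then obtain j where j: "j < length bs" "b = bs ! j" by (metis in_set_conv_nth)
      then have "(\<Sum>i<length bs. c i b * f (bs ! i)) = f b" by (simp add: c(2))
      then show "b \<in> {x \<in> carrier V. f x = (\<Sum>i<length bs. c i x * f (bs ! i))}" using bc j by simp
    qed
    then show "f x = f (\<Oplus>i\<in>{..<length bs}. c i x \<odot> bs ! i)" by (simp add: LFs[OF f x])
  qed
  then show ?thesis using c by (intro exI[of _ c]) simp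
qed

lemma elements_mat_subset: "elements_mat A \<subseteq> K \<longleftrightarrow> (\<forall>i<dim_row A. \<forall>j<dim_col A. A $$ (i, j) \<in> K)"
  by (force simp: elements_mat_def)

lemma represents_exists:
  assumes f: "khom K V V f" and bs: "distinct bs" "lbasis K V (set bs)"
  shows "\<exists>A. represents K V bs f A"
proof -
  interpret f: khom K V V f by fact
  obtain c where c: "\<And>i. i < length bs \<Longrightarrow> c i \<in> linear_functionals K V"
    "\<And>x. x \<in> carrier V \<Longrightarrow> x = (\<Oplus>i\<in>{..<length bs}. c i x \<odot> bs ! i)"
    using dual_basis[OF bs] by blast
  have bc: "bs ! j \<in> carrier V" if "j < length bs" for j using that bs(2) unfolding lbasis_iff by auto
  let ?A = "mat (length bs) (length bs) (\<lambda>(i, j). c i (f (bs ! j)))"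
  have "f (bs ! j) = (\<Oplus>i\<in>{..<length bs}. ?A $$ (i, j) \<odot> bs ! i)" if j: "j < length bs" for j
  proof -
    have "f (bs ! j) = (\<Oplus>i\<in>{..<length bs}. c i (f (bs ! j)) \<odot> bs ! i)"
      using c(2)[of "f (bs ! j)"] bc[OF j] by simp
    also have "\<dots> = (\<Oplus>i\<in>{..<length bs}. ?A $$ (i, j) \<odot> bs ! i)"
      using j bc LF_closed[OF c(1)] by (intro finsum_cong') auto
    finally show ?thesis .
  qed
  moreover have "?A $$ (i, j) \<in> K" if "i < length bs" "j < length bs" for i j
    using LF_closed[OF c(1)[OF that(1)]] bc[OF that(2)] that by simp
  ultimately have "represents K V bs f ?A"
    unfolding represents_def elements_mat_subset using bs by simp
  then show ?thesis by (rule exI)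
qed

lemma representsD:
  assumes "represents K V bs f A"
  shows "distinct bs" "lbasis K V (set bs)" "A \<in> carrier_mat (length bs) (length bs)"
    "\<And>i j. \<lbrakk>i < length bs; j < length bs\<rbrakk> \<Longrightarrow> A $$ (i, j) \<in> K"
    "\<And>j. j < length bs \<Longrightarrow> bs ! j \<in> carrier V"
proof -
  show "distinct bs" and b: "lbasis K V (set bs)" and A: "A \<in> carrier_mat (length bs) (length bs)"
    using assms by (simp_all add: represents_def)
  have "elements_mat A \<subseteq> K" using assms by (simp add: represents_def)
  then show "\<And>i j. \<lbrakk>i < length bs; j < length bs\<rbrakk> \<Longrightarrow> A $$ (i, j) \<in> K"
    using A unfolding elements_mat_subset by auto
  from b show "\<And>j. j < length bs \<Longrightarrow> bs ! j \<in> carrier V" unfolding lbasis_iff by auto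
qed

lemma represents_LF:
  assumes rep: "represents K V bs f A" and \<phi>: "\<phi> \<in> linear_functionals K V" and j: "j < length bs"
  shows "\<phi> (f (bs ! j)) = (\<Sum>i<length bs. \<phi> (bs ! i) * A $$ (i, j))"
proof -
  note D = representsD[OF rep]
  have "\<phi> (f (bs ! j)) = \<phi> (\<Oplus>i\<in>{..<length bs}. A $$ (i, j) \<odot> bs ! i)"
    using rep j unfolding represents_def by simp
  also have "\<dots> = (\<Sum>i<length bs. \<phi> (A $$ (i, j) \<odot> bs ! i))" using D j by (intro LF_finsum[OF \<phi>]) auto
  also have "\<dots> = (\<Sum>i<length bs. \<phi> (bs ! i) * A $$ (i, j))"
    using D j by (intro sum.cong) (auto simp: LF_smult[OF \<phi>])
  finally show ?thesis .
qed

text \<open>One application of \<open>f\<close> is split off on the inside, so that the functional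
  \<phi> composed with the remaining power of \<open>f\<close> can be fed to
  \<open>represents_LF\<close>.\<close>

lemma represents_pow:
  assumes f: "khom K V V f" and rep: "represents K V bs f A" and \<phi>: "\<phi> \<in> linear_functionals K V" and j: "j < length bs"
  shows "\<phi> ((f ^^ m) (bs ! j)) = (\<Sum>i<length bs. \<phi> (bs ! i) * (A ^\<^sub>m m) $$ (i, j))"
  using j
proof (induction m arbitrary: j)
  case 0
  then have "(\<Sum>i<length bs. \<phi> (bs ! i) * (A ^\<^sub>m 0) $$ (i, j)) = (\<Sum>i<length bs. if i = j then \<phi> (bs ! i) else 0)"
    using representsD(3)[OF rep] by (intro sum.cong) auto
  then show ?case using 0 by simp
next
  case (Suc m)
  interpret fm: khom K V V "f ^^ m" by (rule khom_funpow[OF f])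
  note D = representsD[OF rep]
  have "\<phi> ((f ^^ Suc m) (bs ! j)) = \<phi> ((f ^^ m) (f (bs ! j)))" by (simp only: funpow_Suc_right o_apply)
  also have "\<dots> = (\<Sum>i<length bs. \<phi> ((f ^^ m) (bs ! i)) * A $$ (i, j))"
    by (rule represents_LF[OF rep fm.LF_comp[OF \<phi>] Suc.prems])
  also have "\<dots> = (\<Sum>i<length bs. \<Sum>l<length bs. \<phi> (bs ! l) * (A ^\<^sub>m m) $$ (l, i) * A $$ (i, j))"
    by (intro sum.cong) (auto simp: Suc.IH sum_distrib_right)
  also have "\<dots> = (\<Sum>l<length bs. \<phi> (bs ! l) * (\<Sum>i<length bs. (A ^\<^sub>m m) $$ (l, i) * A $$ (i, j)))"
    unfolding sum_distrib_left by (subst sum.swap) (simp add: mult.assoc)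
  also have "\<dots> = (\<Sum>l<length bs. \<phi> (bs ! l) * (A ^\<^sub>m Suc m) $$ (l, j))"
    using D(3) Suc.prems pow_carrier_mat[OF D(3), of m]
    by (intro sum.cong) (auto simp: scalar_prod_def atLeast0LessThan)
  finally show ?case .
qed

lemma represents_complement:
  assumes f: "khom K V V f" and rep: "represents K V bs f A"
  shows "represents K V bs (\<lambda>y. y \<ominus> f y) (1\<^sub>m (length bs) - A)"
proof -
  interpret f: khom K V V f by fact
  note D = representsD[OF rep]
  let ?A = "1\<^sub>m (length bs) - A"
  have e: "?A $$ (i, j) = of_bool (i = j) - A $$ (i, j)" if "i < length bs" "j < length bs" for i j
    using D(3) that by auto
  have K: "?A $$ (i, j) \<in> K" if "i < length bs" "j < length bs" for i j
    using D(4)[OF that] by (simp add: e that)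
  have "bs ! j \<ominus> f (bs ! j) = (\<Oplus>i\<in>{..<length bs}. ?A $$ (i, j) \<odot> bs ! i)" if j: "j < length bs" for j
  proof (rule functional_eqI)
    show "bs ! j \<ominus> f (bs ! j) \<in> carrier V" using D(5)[OF j] by simp
    show "(\<Oplus>i\<in>{..<length bs}. ?A $$ (i, j) \<odot> bs ! i) \<in> carrier V" using K j D(5) by (intro finsum_closed) auto
    fix \<phi> assume \<phi>: "\<phi> \<in> linear_functionals K V"
    have "\<phi> (\<Oplus>i\<in>{..<length bs}. ?A $$ (i, j) \<odot> bs ! i) = (\<Sum>i<length bs. \<phi> (?A $$ (i, j) \<odot> bs ! i))"
      using K j D(5) by (intro LF_finsum[OF \<phi>]) auto
    also have "\<dots> = (\<Sum>i<length bs. (if i = j then \<phi> (bs ! i) else 0) - \<phi> (bs ! i) * A $$ (i, j))"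
    proof (rule sum.cong[OF refl])
      fix i assume "i \<in> {..<length bs}"
      then have i: "i < length bs" by simp
      show "\<phi> (?A $$ (i, j) \<odot> bs ! i) = (if i = j then \<phi> (bs ! i) else 0) - \<phi> (bs ! i) * A $$ (i, j)"
        unfolding LF_smult[OF \<phi> K[OF i j] D(5)[OF i]] unfolding e[OF i j] by (simp add: algebra_simps)
    qed
    also have "\<dots> = \<phi> (bs ! j) - \<phi> (f (bs ! j))"
      using j by (simp add: sum_subtractf represents_LF[OF rep \<phi>])
    finally show "\<phi> (bs ! j \<ominus> f (bs ! j)) = \<phi> (\<Oplus>i\<in>{..<length bs}. ?A $$ (i, j) \<odot> bs ! i)"
      using D(5)[OF j] by (simp add: LF_diff[OF \<phi>])
  qed
  moreover have "?A \<in> carrier_mat (length bs) (length bs)" by (rule minus_carrier_mat[OF D(3)])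
  ultimately show ?thesis
    unfolding represents_def elements_mat_subset using D K by auto
qed

lemma represents_nilpotent:
  assumes f: "khom K V V f" and rep: "represents K V bs f A"
  shows "(\<forall>x\<in>carrier V. (f ^^ p) x = \<zero>) \<longleftrightarrow> A ^\<^sub>m p = 0\<^sub>m (length bs) (length bs)"
proof
  interpret fp: khom K V V "f ^^ p" by (rule khom_funpow[OF f])
  note D = representsD[OF rep]
  have Ap: "A ^\<^sub>m p \<in> carrier_mat (length bs) (length bs)" by (rule pow_carrier_mat[OF D(3)])
  {
    assume z: "\<forall>x\<in>carrier V. (f ^^ p) x = \<zero>"
    obtain c where c: "\<And>i. i < length bs \<Longrightarrow> c i \<in> linear_functionals K V"
      "\<And>i j. \<lbrakk>i < length bs; j < length bs\<rbrakk> \<Longrightarrow> c i (bs ! j) = of_bool (i = j)"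
      using dual_basis[OF D(1,2)] by blast
    show "A ^\<^sub>m p = 0\<^sub>m (length bs) (length bs)"
    proof (rule eq_matI)
      fix i j assume "i < dim_row (0\<^sub>m (length bs) (length bs))" "j < dim_col (0\<^sub>m (length bs) (length bs))"
      then have ij: "i < length bs" "j < length bs" by auto
      have "0 = c i ((f ^^ p) (bs ! j))" using z D(5)[OF ij(2)] LF_zero[OF c(1)[OF ij(1)]] by simp
      also have "\<dots> = (\<Sum>l<length bs. if i = l then (A ^\<^sub>m p) $$ (l, j) else 0)"
        unfolding represents_pow[OF f rep c(1)[OF ij(1)] ij(2)] using ij c(2) by (intro sum.cong) auto
      finally show "(A ^\<^sub>m p) $$ (i, j) = 0\<^sub>m (length bs) (length bs) $$ (i, j)" using ij by simp
    qed (use Ap in auto)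
  }
  {
    assume z: "A ^\<^sub>m p = 0\<^sub>m (length bs) (length bs)"
    show "\<forall>x\<in>carrier V. (f ^^ p) x = \<zero>"
    proof
      fix x assume x: "x \<in> carrier V"
      have "x \<in> {x \<in> carrier V. (f ^^ p) x \<in> {\<zero>}}"
      proof (rule lbasis_span[OF D(2) fp.linsub_vimage[OF linsub_zero_set] _ x], intro subsetI)
        fix b assume "b \<in> set bs"
        then obtain j where j: "j < length bs" "b = bs ! j" by (metis in_set_conv_nth)
        have bc: "b \<in> carrier V" using D(5) j by simp
        have "(f ^^ p) b = \<zero>"
        proof (rule functional_eqI)
          fix \<phi> assume \<phi>: "\<phi> \<in> linear_functionals K V"
          show "\<phi> ((f ^^ p) b) = \<phi> \<zero>"
            using j z by (simp add: represents_pow[OF f rep \<phi>] LF_zero[OF \<phi>])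
        qed (use fp.hom_closed[OF bc] in auto)
        then show "b \<in> {x \<in> carrier V. (f ^^ p) x \<in> {\<zero>}}" using bc by simp
      qed
      then show "(f ^^ p) x = \<zero>" by simp
    qed
  }
qed

text \<open>The set \<open>eigenvalues\<close> ranges over all bases. One basis suffices to deduce
  nilpotency, but it has to exist: without a finite basis the set is empty and tells nothing. The
  converse treats every representing matrix.\<close>

lemma eigenvalues_unipotent:
  assumes f: "khom K V V f"
  shows "\<lbrakk>distinct bs; lbasis K V (set bs); eigenvalues K V f \<subseteq> {1}\<rbrakk> \<Longrightarrow> \<exists>p. \<forall>x\<in>carrier V. ((\<lambda>y. y \<ominus> f y) ^^ p) x = \<zero>"
    and "\<forall>x\<in>carrier V. ((\<lambda>y. y \<ominus> f y) ^^ p) x = \<zero> \<Longrightarrow> eigenvalues K V f \<subseteq> {1}"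
proof -
  assume bs: "distinct bs" "lbasis K V (set bs)" and ev: "eigenvalues K V f \<subseteq> {1}"
  obtain A where A: "represents K V bs f A" using represents_exists[OF f bs] by blast
  have "z = 1" if "eigenvalue A z" for z using ev A that by (auto simp: eigenvalues_def)
  from unipotent_matrix(2)[OF representsD(3)[OF A] this]
  show "\<exists>p. \<forall>x\<in>carrier V. ((\<lambda>y. y \<ominus> f y) ^^ p) x = \<zero>"
    using represents_nilpotent[OF khom_complement[OF f] represents_complement[OF f A]] by blast
next
  assume z: "\<forall>x\<in>carrier V. ((\<lambda>y. y \<ominus> f y) ^^ p) x = \<zero>"
  show "eigenvalues K V f \<subseteq> {1}"
  proof
    fix z' assume "z' \<in> eigenvalues K V f"
    then obtain bs A where A: "represents K V bs f A" "eigenvalue A z'" unfolding eigenvalues_def by blast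
    have "(1\<^sub>m (length bs) - A) ^\<^sub>m p = 0\<^sub>m (length bs) (length bs)"
      using represents_nilpotent[OF khom_complement[OF f] represents_complement[OF f A(1)]] z by blast
    from nilpotent_eigenvalue[OF representsD(3)[OF A(1)] this A(2)] show "z' \<in> {1}" by simp
  qed
qed

end

lemma exp_solvable_one:
  assumes "E \<subseteq> {1}" shows "exp_solvable E"
proof -
  interpret cx_field UNIV by (rule cx_field_subfields) simp
  interpret G: group "mult_of (cfield UNIV)" by (rule Kf.field_mult_group)
  have "x = 1" if "x \<in> generate (mult_of (cfield UNIV)) (E \<union> cnj ` E)" for x
    using that
  proof induction
    case (inv h)
    then have "h = \<one>\<^bsub>mult_of (cfield UNIV)\<^esub>" using assms by auto
    then have "inv\<^bsub>mult_of (cfield UNIV)\<^esub> h = \<one>\<^bsub>mult_of (cfield UNIV)\<^esub>" using G.inv_one by simp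
    then show ?case by simp
  qed (use assms in auto)
  moreover have "1 \<in> generate (mult_of (cfield UNIV)) (E \<union> cnj ` E)"
    using generate.one[of "mult_of (cfield UNIV)"] by simp
  ultimately have "generate (mult_of (cfield UNIV)) (E \<union> cnj ` E) = {1}" by blast
  then show ?thesis unfolding exp_solvable_def by simp
qed

section \<open>Nilpotency from the abelianization\<close>

text \<open>The parameter covers id - \<Phi> with c = -1 and derivations with c = 0. If T^p maps A
  into L_2 and T^q maps L_i into L_(i+1), then T^(p+q) [x, y] with y in L_i expands into brackets
  [T^a x, T^b y] with a + b at least p + q; so a is at least p or b at least q, and either way the
  bracket gains a step.\<close>

lemma (in lie_alg) leibniz_nilpotent:
  assumes T: "khom K A A T" and c: "c \<in> K"
    and T_br: "\<And>x y. \<lbrakk>x \<in> carrier A; y \<in> carrier A\<rbrakk> \<Longrightarrow>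
      T (x \<otimes> y) = (T x \<otimes> y \<oplus> x \<otimes> T y) \<oplus> c \<odot> (T x \<otimes> T y)"
    and T2: "\<And>x. x \<in> carrier A \<Longrightarrow> (T ^^ p) x \<in> lower_central K A 2" and k: "k \<ge> 1"
  shows "\<exists>J. \<forall>x\<in>carrier A. (T ^^ J) x \<in> lower_central K A k"
proof -
  interpret T: khom K A A T by fact
  interpret Tp: khom K A A "T ^^ m" for m by (rule khom_funpow[OF T])
  note lcc = subsetD[OF lc_subset]
  have T_lc: "T y \<in> lower_central K A i" if "i \<ge> 1" "y \<in> lower_central K A i" for i y
    using that
  proof (induction i arbitrary: y rule: nat_induct_at_least)
    case base
    then show ?case by simp
  next
    case (Suc i)
    have "lower_central K A (Suc i) \<subseteq> {y \<in> carrier A. T y \<in> lower_central K A (Suc i)}"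
    proof (rule lc_Suc_least[OF T.linsub_vimage[OF lc_linsub] Suc.hyps])
      fix x y assume x: "x \<in> carrier A" and y: "y \<in> lower_central K A i"
      have "T x \<otimes> y \<in> lower_central K A (Suc i)" "x \<otimes> T y \<in> lower_central K A (Suc i)" "T x \<otimes> T y \<in> lower_central K A (Suc i)"
        using x y Suc.hyps Suc.IH[OF y] by (auto intro: lc_br)
      then have "T (x \<otimes> y) \<in> lower_central K A (Suc i)"
        using T_br[OF x lcc[OF y]] linsub_add[OF lc_linsub] linsub_smult[OF lc_linsub c] by simp
      then show "x \<otimes> y \<in> {y \<in> carrier A. T y \<in> lower_central K A (Suc i)}" using x lcc[OF y] by simp
    qed
    then show ?case using Suc.prems by blast
  qed
  have Tp_lc: "(T ^^ m) y \<in> lower_central K A i" if "i \<ge> 1" "y \<in> lower_central K A i" for i y m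
    using that by (induction m) (simp_all add: T_lc)
  have step: "\<exists>q. \<forall>y\<in>lower_central K A i. (T ^^ q) y \<in> lower_central K A (Suc i)" if "i \<ge> 1" for i
    using that
  proof (induction i rule: nat_induct_at_least)
    case base
    then show ?case using T2 by (intro exI[of _ p]) (simp add: numeral_2_eq_2)
  next
    case (Suc i)
    then obtain q where q: "\<And>y. y \<in> lower_central K A i \<Longrightarrow> (T ^^ q) y \<in> lower_central K A (Suc i)" by blast
    \<comment> \<open>Here \<open>m\<close> counts the applications of T still to be distributed.
      Each use of the rule lowers \<open>m\<close> by one and raises \<open>a\<close>,
      \<open>b\<close> or both, so the bound on a + b + m persists.\<close>
    have claim: "(T ^^ m) ((T ^^ a) x \<otimes> (T ^^ b) y) \<in> lower_central K A (Suc (Suc i))"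
      if x: "x \<in> carrier A" and y: "y \<in> lower_central K A i" and "a + b + m \<ge> p + q" for m a b x y
      using that(3)
    proof (induction m arbitrary: a b)
      case 0
      then consider "a \<ge> p" | "b \<ge> q" by linarith
      then show ?case
      proof cases
        case 1
        then have "(T ^^ a) x = (T ^^ p) ((T ^^ (a - p)) x)" by (simp flip: funpow_add[THEN fun_cong, unfolded o_def])
        then have "(T ^^ a) x \<in> lower_central K A 2" using T2 Tp.hom_closed[OF x] by simp
        then show ?thesis using lc_2_br[OF Suc.hyps _ Tp_lc[OF Suc.hyps y]] by simp
      next
        case 2
        then have "(T ^^ b) y = (T ^^ q) ((T ^^ (b - q)) y)" by (simp flip: funpow_add[THEN fun_cong, unfolded o_def])
        then have "(T ^^ b) y \<in> lower_central K A (Suc i)" using q Tp_lc[OF Suc.hyps y] by simp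
        then show ?thesis using lc_br[of "Suc i"] Tp.hom_closed[OF x] by simp
      qed
    next
      case (Suc m)
      have c1: "(T ^^ l) x \<in> carrier A" "(T ^^ l) y \<in> carrier A" for l
        using x lcc[OF y] by (auto intro: Tp.hom_closed)
      have "(T ^^ Suc m) ((T ^^ a) x \<otimes> (T ^^ b) y) = (T ^^ m) (T ((T ^^ a) x \<otimes> (T ^^ b) y))"
        by (simp only: funpow_Suc_right o_apply)
      also have "T ((T ^^ a) x \<otimes> (T ^^ b) y) = ((T ^^ Suc a) x \<otimes> (T ^^ b) y \<oplus> (T ^^ a) x \<otimes> (T ^^ Suc b) y)
          \<oplus> c \<odot> ((T ^^ Suc a) x \<otimes> (T ^^ Suc b) y)"
        using T_br[OF c1(1) c1(2), of a b] by simp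
      also have "(T ^^ m) \<dots> = ((T ^^ m) ((T ^^ Suc a) x \<otimes> (T ^^ b) y) \<oplus> (T ^^ m) ((T ^^ a) x \<otimes> (T ^^ Suc b) y))
          \<oplus> c \<odot> (T ^^ m) ((T ^^ Suc a) x \<otimes> (T ^^ Suc b) y)"
        using c c1[of a] c1[of b] c1[of "Suc a"] c1[of "Suc b"]
        by (simp add: Tp.hom_add Tp.hom_smult del: funpow.simps)
      also have "\<dots> \<in> lower_central K A (Suc (Suc i))"
        using Suc.prems by (intro linsub_add[OF lc_linsub] linsub_smult[OF lc_linsub c] Suc.IH) auto
      finally show ?case .
    qed
    have "lower_central K A (Suc i) \<subseteq> {y \<in> carrier A. (T ^^ (p + q)) y \<in> lower_central K A (Suc (Suc i))}"
    proof (rule lc_Suc_least[OF Tp.linsub_vimage[OF lc_linsub] Suc.hyps])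
      fix x y assume "x \<in> carrier A" "y \<in> lower_central K A i"
      then show "x \<otimes> y \<in> {y \<in> carrier A. (T ^^ (p + q)) y \<in> lower_central K A (Suc (Suc i))}"
        using claim[of x y 0 0 "p + q"] lcc by simp
    qed
    then show ?case by blast
  qed
  show ?thesis
    using k
  proof (induction k rule: nat_induct_at_least)
    case base
    show ?case using Tp.hom_closed[of _ 0] by (intro exI[of _ 0]) simp
  next
    case (Suc k)
    then obtain J where J: "\<And>x. x \<in> carrier A \<Longrightarrow> (T ^^ J) x \<in> lower_central K A k" by blast
    obtain q where "\<And>y. y \<in> lower_central K A k \<Longrightarrow> (T ^^ q) y \<in> lower_central K A (Suc k)" using step[OF Suc.hyps] by blast
    then show ?case using J by (intro exI[of _ "q + J"]) (simp add: funpow_add)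
  qed
qed

section \<open>Unipotent automorphisms of nilpotent Lie algebras\<close>

lemma (in lie_alg) derived_kalg_ideal: "kalg_ideal K A (derived K A)"
  unfolding lc_2[symmetric] by (intro kalg_idealI kalg_axioms lc_alg_ideal) simp

locale fg_nilpotent_lie_alg = lie_alg K A for K and A :: "'a calg" (structure) +
  fixes S :: "'a set" and k :: nat
  assumes S_finite: "finite S" and S_gen: "lie_generators K A S"
    and k_pos: "k \<ge> 1" and lc_k: "lower_central K A k = {\<zero>}"
begin

sublocale I: kalg_ideal K A "derived K A"
  by (rule derived_kalg_ideal)

abbreviation ab :: "'a set calg" where "ab \<equiv> abelianization K A"

definition \<pi> :: "'a \<Rightarrow> 'a set" where "\<pi> x = derived K A +> x"

lemma ab_eq: "ab = quot_alg A (derived K A)"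
  by (simp add: abelianization_def)

sublocale ab: kalg K ab
  unfolding ab_eq by (rule I.kalg_quot)

sublocale \<pi>: ahom K A ab \<pi>
  unfolding ab_eq \<pi>_def by (rule I.ahom_quot)

lemma carrier_ab: "carrier ab = \<pi> ` carrier A"
  unfolding ab_eq \<pi>_def by (rule I.carrier_quot)

lemma \<pi>_zero: "x \<in> carrier A \<Longrightarrow> \<pi> x = \<zero>\<^bsub>ab\<^esub> \<longleftrightarrow> x \<in> lower_central K A 2"
  unfolding ab_eq \<pi>_def lc_2 by (rule I.quot_eq_zero)

text \<open>Finite generation makes the abelianization finite-dimensional, which gives the
  hypothesis on its eigenvalues content.\<close>

lemma ab_basis: "\<exists>bs. distinct bs \<and> lbasis K ab (set bs)"
proof (rule ab.lbasis_exists)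
  show "finite (\<pi> ` S)" using S_finite by simp
  show "\<pi> ` S \<subseteq> carrier ab" using lie_generators_subset[OF S_gen] by auto
  fix U assume U: "linsub K ab U" "\<pi> ` S \<subseteq> U"
  have lc: "lower_central K A 2 \<subseteq> {x \<in> carrier A. \<pi> x \<in> U}"
  proof
    fix x assume x: "x \<in> lower_central K A 2"
    then have xc: "x \<in> carrier A" using subsetD[OF lc_subset] by blast
    then have "\<pi> x = \<zero>\<^bsub>ab\<^esub>" using x \<pi>_zero by simp
    then show "x \<in> {x \<in> carrier A. \<pi> x \<in> U}" using xc linsub_zero[OF U(1)] by simp
  qed
  have S: "S \<subseteq> {x \<in> carrier A. \<pi> x \<in> U}" using U(2) lie_generators_subset[OF S_gen] by auto
  have "\<pi> x \<in> U" if "x \<in> carrier A" for x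
    using lie_generators_span[OF S_gen \<pi>.linsub_vimage[OF U(1)] S lc that] by simp
  then show "carrier ab \<subseteq> U" unfolding carrier_ab by blast
qed

lemma ab_map:
  assumes T: "khom K A A T" and lc: "T ` lower_central K A 2 \<subseteq> lower_central K A 2"
  shows khom_ab_map: "khom K ab ab (ab_map K A T)"
    and ab_map_\<pi>: "x \<in> carrier A \<Longrightarrow> ab_map K A T (\<pi> x) = \<pi> (T x)"
proof -
  interpret T: khom K A A T by fact
  interpret q: quot_khom K A "derived K A" A "derived K A" T
    by unfold_locales (use lc in \<open>auto simp: lc_2\<close>)
  show "khom K ab ab (ab_map K A T)" unfolding ab_map_def ab_eq by (rule q.khom_quot_map)
  show "x \<in> carrier A \<Longrightarrow> ab_map K A T (\<pi> x) = \<pi> (T x)"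
    unfolding ab_map_def \<pi>_def by (rule q.quot_map_rcos)
qed

lemma \<pi>_funpow:
  assumes T: "khom K A A T" and eq: "\<And>x. x \<in> carrier A \<Longrightarrow> f (\<pi> x) = \<pi> (T x)" and x: "x \<in> carrier A"
  shows "(f ^^ m) (\<pi> x) = \<pi> ((T ^^ m) x)"
proof (induction m)
  case (Suc m)
  interpret khom K A A "T ^^ m" by (rule khom_funpow[OF T])
  show ?case using Suc eq[of "(T ^^ m) x"] hom_closed[OF x] by simp
qed simp

lemma der_lc_2:
  assumes D: "D \<in> lie_der K A" shows "D ` lower_central K A 2 \<subseteq> lower_central K A 2"
proof -
  interpret D: khom K A A D using D by unfold_locales (simp add: lie_der_def lin_end_def)
  have "lower_central K A (Suc 1) \<subseteq> {x \<in> carrier A. D x \<in> lower_central K A 2}"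
  proof (rule lc_Suc_least[OF D.linsub_vimage[OF lc_linsub]])
    fix u v assume "u \<in> carrier A" "v \<in> lower_central K A 1"
    then have uv: "u \<in> carrier A" "v \<in> carrier A" by simp_all
    have "D u \<otimes> v \<in> lower_central K A (Suc 1)" "u \<otimes> D v \<in> lower_central K A (Suc 1)"
      using uv by (intro lc_br; simp)+
    then have "(D u \<otimes> v) \<oplus> (u \<otimes> D v) \<in> lower_central K A 2"
      using linsub_add[OF lc_linsub] by (simp add: numeral_2_eq_2)
    moreover have "D (u \<otimes> v) = (D u \<otimes> v) \<oplus> (u \<otimes> D v)" using D uv by (simp add: lie_der_def)
    ultimately show "u \<otimes> v \<in> {x \<in> carrier A. D x \<in> lower_central K A 2}" using uv by simp
  qed simp
  then show ?thesis by (auto simp: numeral_2_eq_2)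
qed

lemma der_nilpotent:
  assumes D: "D \<in> lie_der K A" and p: "\<And>x. x \<in> carrier A \<Longrightarrow> (D ^^ p) x \<in> lower_central K A 2"
  shows "\<exists>J. \<forall>x\<in>carrier A. (D ^^ J) x = \<zero>"
proof -
  interpret D: khom K A A D using D by unfold_locales (simp add: lie_der_def lin_end_def)
  have "D (x \<otimes> y) = (D x \<otimes> y \<oplus> x \<otimes> D y) \<oplus> 0 \<odot> (D x \<otimes> D y)" if "x \<in> carrier A" "y \<in> carrier A" for x y
    using D that by (simp add: lie_der_def)
  from leibniz_nilpotent[OF D.khom_axioms K_zero this p k_pos] show ?thesis by (simp add: lc_k)
qed

end

locale fg_nilpotent_aut = fg_nilpotent_lie_alg K A S k for K and A :: "'a calg" (structure) and S k +
  fixes \<Phi> :: "'a \<Rightarrow> 'a"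
  assumes \<Phi>_aut: "\<Phi> \<in> lie_aut K A"
begin

sublocale \<Phi>: ahom K A A \<Phi>
  by (rule lie_aut_ahom(1)[OF kalg_axioms \<Phi>_aut])

abbreviation N :: "'a \<Rightarrow> 'a" where "N \<equiv> \<lambda>y. y \<ominus> \<Phi> y"

abbreviation \<Phi>ab :: "'a set \<Rightarrow> 'a set" where "\<Phi>ab \<equiv> ab_map K A \<Phi>"

abbreviation Nab :: "'a set \<Rightarrow> 'a set" where "Nab \<equiv> \<lambda>y. y \<ominus>\<^bsub>ab\<^esub> \<Phi>ab y"

lemmas khom_\<Phi>ab = khom_ab_map[OF \<Phi>.khom_axioms \<Phi>.image_lc_subset]
lemmas \<Phi>ab_\<pi> = ab_map_\<pi>[OF \<Phi>.khom_axioms \<Phi>.image_lc_subset]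

lemma Nab_pow_\<pi>: "x \<in> carrier A \<Longrightarrow> (Nab ^^ m) (\<pi> x) = \<pi> ((N ^^ m) x)"
  by (rule \<pi>_funpow[OF khom_complement[OF \<Phi>.khom_axioms]]) (simp_all add: \<Phi>ab_\<pi> \<pi>.hom_diff)

lemma Nab_pow_zero: "(\<forall>X\<in>carrier ab. (Nab ^^ p) X = \<zero>\<^bsub>ab\<^esub>) \<longleftrightarrow> (\<forall>x\<in>carrier A. (N ^^ p) x \<in> lower_central K A 2)"
proof -
  interpret Np: khom K A A "N ^^ p" by (rule khom_funpow[OF khom_complement[OF \<Phi>.khom_axioms]])
  have "(\<forall>X\<in>carrier ab. (Nab ^^ p) X = \<zero>\<^bsub>ab\<^esub>) \<longleftrightarrow> (\<forall>x\<in>carrier A. (Nab ^^ p) (\<pi> x) = \<zero>\<^bsub>ab\<^esub>)"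
    unfolding carrier_ab by blast
  then show ?thesis using \<pi>_zero Np.hom_closed by (simp add: Nab_pow_\<pi>)
qed

lemma eigenvalues_one_nilpotent:
  assumes "eigenvalues K ab \<Phi>ab \<subseteq> {1}" shows "\<exists>p. \<forall>x\<in>carrier A. (N ^^ p) x \<in> lower_central K A 2"
proof -
  obtain bs where "distinct bs" "lbasis K ab (set bs)" using ab_basis by blast
  from ab.eigenvalues_unipotent(1)[OF khom_\<Phi>ab this assms] show ?thesis unfolding Nab_pow_zero .
qed

lemma N_nilpotent:
  assumes "\<forall>x\<in>carrier A. (N ^^ p) x \<in> lower_central K A 2"
  shows "\<exists>J. unipotent_aut K A \<Phi> J"
proof -
  have "N (x \<otimes> y) = (N x \<otimes> y \<oplus> x \<otimes> N y) \<oplus> (- 1) \<odot> (N x \<otimes> N y)" if "x \<in> carrier A" "y \<in> carrier A" for x y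
  proof (rule functional_eqI)
    fix f assume f: "f \<in> linear_functionals K A"
    show "f (N (x \<otimes> y)) = f ((N x \<otimes> y \<oplus> x \<otimes> N y) \<oplus> (- 1) \<odot> (N x \<otimes> N y))"
      using that by (simp add: LF_simps[OF f] br_diff_left br_diff_right \<Phi>.hom_br)
  qed (use that in auto)
  from leibniz_nilpotent[OF khom_complement[OF \<Phi>.khom_axioms] _ this _ k_pos, of p] assms
  obtain J where "\<And>x. x \<in> carrier A \<Longrightarrow> (N ^^ J) x = \<zero>" using lc_k by auto
  \<comment> \<open>\<open>unipotent\<close> wants a positive exponent, so one more application of N
    is added, which fixes zero.\<close>
  moreover have "N \<zero> = \<zero>" by (simp add: minus_self)
  ultimately have "(N ^^ Suc J) x = \<zero>" if "x \<in> carrier A" for x using that by simp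
  then have "unipotent_aut K A \<Phi> (Suc J)" by unfold_locales simp_all
  then show ?thesis by blast
qed

end

locale fg_unipotent_aut = fg_nilpotent_aut K A S k \<Phi> + U: unipotent_aut K A \<Phi> J
  for K and A :: "'a calg" (structure) and S k \<Phi> J
begin

lemma log_domain: "\<Phi> \<in> log_domain K A"
  unfolding log_domain_def using \<Phi>_aut U.Log_der U.Log_sums by blast

lemma eigenvalues_one: "eigenvalues K ab \<Phi>ab \<subseteq> {1}"
proof -
  have "\<forall>x\<in>carrier A. (N ^^ J) x \<in> lower_central K A 2"
    using U.nilpotent linsub_zero[OF lc_linsub] by simp
  then show ?thesis unfolding Nab_pow_zero[symmetric] by (rule ab.eigenvalues_unipotent(2)[OF khom_\<Phi>ab])
qed

lemma Log_khom: "khom K A A U.Log"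
  by (rule khom_cong[OF U.khom_logm]) (simp add: U.Log_def)

lemmas Log_ab = ab_map[OF Log_khom der_lc_2[OF U.Log_der]]

text \<open>The matrix logarithm and the induced map are the same series, once in 1 - P and once in
  id minus the induced automorphism. The identity is stated for an arbitrary basis and logarithm
  \<open>B\<close>, so that it serves both for existence and for uniqueness of
  \<open>lie_ln\<close>.\<close>

lemma mat_ln_represents_Log:
  assumes P: "represents K ab bs \<Phi>ab P" and ln: "is_mat_ln P B"
    and \<phi>: "\<phi> \<in> linear_functionals K ab" and j: "j < length bs"
  shows "(\<Sum>i<length bs. \<phi> (bs ! i) * B $$ (i, j)) = \<phi> (ab_map K A U.Log (bs ! j))"
proof -
  let ?n = "length bs"
  \<comment> \<open>A common cutoff: the matrix formula asks for at least the dimension, and the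
    series on \<open>A\<close> ends at \<open>J\<close>.\<close>
  let ?D = "max ?n J"
  note D = ab.representsD[OF P]
  have ev: "z = 1" if "eigenvalue P z" for z using eigenvalues_one P that by (auto simp: eigenvalues_def)
  have "bs ! j \<in> \<pi> ` carrier A" using D(5)[OF j] unfolding carrier_ab .
  then obtain x where x: "bs ! j = \<pi> x" "x \<in> carrier A" by (rule imageE)
  note f = \<pi>.LF_comp[OF \<phi>]
  have B: "B $$ (i, j) = - (\<Sum>m=1..?D. ((1\<^sub>m ?n - P) ^\<^sub>m m) $$ (i, j) / of_nat m)" if "i < ?n" for i
    by (rule is_mat_ln_unipotent(2)[OF D(3) _ ln _ that j]) (use ev in auto)
  have "(\<Sum>i<?n. \<phi> (bs ! i) * B $$ (i, j))
      = - (\<Sum>i<?n. \<Sum>m=1..?D. \<phi> (bs ! i) * ((1\<^sub>m ?n - P) ^\<^sub>m m) $$ (i, j) / of_nat m)"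
    by (simp add: B sum_distrib_left sum_negf)
  also have "\<dots> = - (\<Sum>m=1..?D. (\<Sum>i<?n. \<phi> (bs ! i) * ((1\<^sub>m ?n - P) ^\<^sub>m m) $$ (i, j)) / of_nat m)"
    unfolding sum_divide_distrib by (subst sum.swap) (rule refl)
  also have "\<dots> = - (\<Sum>m=1..?D. \<phi> ((Nab ^^ m) (bs ! j)) / of_nat m)"
    unfolding ab.represents_pow[OF ab.khom_complement[OF khom_\<Phi>ab] ab.represents_complement[OF khom_\<Phi>ab P] \<phi> j] ..
  also have "\<dots> = - (\<Sum>m=1..?D. \<phi> (\<pi> ((N ^^ m) x)) / of_nat m)"
    unfolding x(1) Nab_pow_\<pi>[OF x(2)] ..
  also have "\<dots> = - (\<Sum>m=1..J. \<phi> (\<pi> ((N ^^ m) x)) / of_nat m)"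
    using U.coeffs_zero[OF f x(2)] by (intro arg_cong[of _ _ uminus] sum.mono_neutral_right) auto
  also have "\<dots> = \<phi> (\<pi> (U.logm x))" using U.LF_logm_sum[OF f x(2)] by simp
  also have "\<dots> = \<phi> (ab_map K A U.Log (bs ! j))" unfolding x(1) Log_ab(2)[OF x(2)] using x(2) by (simp add: U.Log_def)
  finally show ?thesis .
qed

text \<open>Existence and uniqueness of ln(\<Phi>) in one statement. The field is all of the complex
  numbers here, so every matrix logarithm has its entries in \<open>K\<close>.\<close>

lemma is_lie_ln_iff:
  assumes K: "K = UNIV" shows "is_lie_ln A \<Phi> D \<longleftrightarrow> D = U.Log"
proof
  assume D: "D = U.Log"
  obtain bs where bs: "distinct bs" "lbasis K ab (set bs)" using ab_basis by blast
  obtain P where P: "represents K ab bs \<Phi>ab P" using ab.represents_exists[OF khom_\<Phi>ab bs] by blast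
  note PD = ab.representsD[OF P]
  have ev: "z = 1" if "eigenvalue P z" for z using eigenvalues_one P that by (auto simp: eigenvalues_def)
  then obtain B where ln: "is_mat_ln P B" using unipotent_matrix(1)[OF PD(3)] by blast
  have Bc: "B \<in> carrier_mat (length bs) (length bs)"
    by (rule is_mat_ln_unipotent(1)[OF PD(3) _ ln]) (use ev in auto)
  have KU: "c \<in> K" for c :: complex using K by simp
  interpret Lab: khom K ab ab "ab_map K A U.Log" by (rule Log_ab(1))
  have "ab_map K A U.Log (bs ! j) = (\<Oplus>\<^bsub>ab\<^esub> i\<in>{..<length bs}. (B $$ (i, j)) \<odot>\<^bsub>ab\<^esub> (bs ! i))"
    if j: "j < length bs" for j
  proof (rule ab.functional_eqI)
    show "ab_map K A U.Log (bs ! j) \<in> carrier ab" using Lab.hom_closed PD(5)[OF j] .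
    have c: "(B $$ (i, j)) \<odot>\<^bsub>ab\<^esub> (bs ! i) \<in> carrier ab" if "i < length bs" for i by (rule ab.smult_K_closed[OF KU PD(5)[OF that]])
    then show "(\<Oplus>\<^bsub>ab\<^esub> i\<in>{..<length bs}. (B $$ (i, j)) \<odot>\<^bsub>ab\<^esub> (bs ! i)) \<in> carrier ab"
      by (intro ab.finsum_closed) auto
    fix \<phi> assume \<phi>: "\<phi> \<in> linear_functionals K ab"
    have "\<phi> (\<Oplus>\<^bsub>ab\<^esub> i\<in>{..<length bs}. (B $$ (i, j)) \<odot>\<^bsub>ab\<^esub> (bs ! i)) = (\<Sum>i<length bs. \<phi> ((B $$ (i, j)) \<odot>\<^bsub>ab\<^esub> (bs ! i)))"
      using c by (intro ab.LF_finsum[OF \<phi>]) auto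
    also have "\<dots> = (\<Sum>i<length bs. \<phi> (bs ! i) * B $$ (i, j))"
      using PD(5) by (intro sum.cong) (auto simp: ab.LF_smult[OF \<phi> KU])
    also have "\<dots> = \<phi> (ab_map K A U.Log (bs ! j))" by (rule mat_ln_represents_Log[OF P ln \<phi> j])
    finally show "\<phi> (ab_map K A U.Log (bs ! j)) = \<phi> (\<Oplus>\<^bsub>ab\<^esub> i\<in>{..<length bs}. (B $$ (i, j)) \<odot>\<^bsub>ab\<^esub> (bs ! i))" ..
  qed
  then have "represents K ab bs (ab_map K A U.Log) B"
    unfolding represents_def using bs Bc KU by blast
  with P ln have "\<exists>bs P Q. represents K ab bs \<Phi>ab P \<and> represents K ab bs (ab_map K A U.Log) Q \<and> is_mat_ln P Q"
    by blast
  then show "is_lie_ln A \<Phi> D"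
    using exp_solvable_one[OF eigenvalues_one] U.Log_der U.Log_exp unfolding is_lie_ln_def D K by simp
next
  assume "is_lie_ln A \<Phi> D"
  then obtain bs P Q where D: "D \<in> lie_der K A" "exp_sums K A D \<Phi>"
    and P: "represents K ab bs \<Phi>ab P" and Q: "represents K ab bs (ab_map K A D) Q" and ln: "is_mat_ln P Q"
    unfolding is_lie_ln_def K by blast
  have Dk: "khom K A A D" using D(1) by unfold_locales (simp add: lie_der_def lin_end_def)
  note Dab = ab_map[OF Dk der_lc_2[OF D(1)]]
  interpret Dk: khom K A A D by (rule Dk)
  interpret Dab: khom K ab ab "ab_map K A D" by (rule Dab(1))
  interpret Lab: khom K ab ab "ab_map K A U.Log" by (rule Log_ab(1))
  note PD = ab.representsD[OF P]
  \<comment> \<open>Both induced maps have the matrix logarithm of \<open>P\<close> as matrix in the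
    basis \<open>bs\<close>, so they agree on that basis.\<close>
  have eq: "ab_map K A D X = ab_map K A U.Log X" if X: "X \<in> carrier ab" for X
  proof (rule ab.functional_eqI)
    show "ab_map K A D X \<in> carrier ab" "ab_map K A U.Log X \<in> carrier ab"
      using X by (rule Dab.hom_closed, rule Lab.hom_closed)
    fix \<phi> assume \<phi>: "\<phi> \<in> linear_functionals K ab"
    have "X \<in> {X \<in> carrier ab. \<phi> (ab_map K A D X) = \<phi> (ab_map K A U.Log X)}"
    proof (rule ab.lbasis_span[OF PD(2) ab.LF_equalizer[OF Dab.LF_comp[OF \<phi>] Lab.LF_comp[OF \<phi>]] _ X], intro subsetI)
      fix b assume "b \<in> set bs"
      then obtain j where j: "j < length bs" "b = bs ! j" by (auto simp: in_set_conv_nth)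
      have "\<phi> (ab_map K A D b) = \<phi> (ab_map K A U.Log b)"
        unfolding j(2) ab.represents_LF[OF Q \<phi> j(1)] by (rule mat_ln_represents_Log[OF P ln \<phi> j(1)])
      then show "b \<in> {X \<in> carrier ab. \<phi> (ab_map K A D X) = \<phi> (ab_map K A U.Log X)}" using PD(5)[OF j(1)] j(2) by simp
    qed
    then show "\<phi> (ab_map K A D X) = \<phi> (ab_map K A U.Log X)" by simp
  qed
  interpret DJ: khom K A A "D ^^ J" by (rule khom_funpow[OF Dk])
  \<comment> \<open>Since \<open>D\<close> and \<open>U.Log\<close> agree on the abelianization, so
    do their J-th powers, and the J-th power of \<open>logm\<close> is zero.\<close>
  have "(D ^^ J) x \<in> lower_central K A 2" if x: "x \<in> carrier A" for x
  proof -
    have "\<pi> ((D ^^ J) x) = (ab_map K A D ^^ J) (\<pi> x)"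
      by (rule \<pi>_funpow[symmetric, OF Dk _ x]) (rule Dab(2))
    also have "\<dots> = (ab_map K A U.Log ^^ J) (\<pi> x)"
      by (rule funpow_cong_on[of "carrier ab"]) (use eq Lab.hom_closed x in auto)
    also have "\<dots> = \<pi> ((U.Log ^^ J) x)" by (rule \<pi>_funpow[OF Log_khom _ x]) (rule Log_ab(2))
    also have "(U.Log ^^ J) x = (U.logm ^^ J) x"
      by (rule funpow_cong_on[of "carrier A"]) (use x in \<open>simp_all add: U.Log_def\<close>)
    also have "\<pi> \<dots> = \<zero>\<^bsub>ab\<^esub>" using U.logm_nilpotent[OF x] by simp
    finally show ?thesis using \<pi>_zero[OF DJ.hom_closed[OF x]] by simp
  qed
  from der_nilpotent[OF D(1) this] obtain I where I: "\<And>x. x \<in> carrier A \<Longrightarrow> (D ^^ I) x = \<zero>" by blast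
  \<comment> \<open>\<open>Log_unique\<close> asks for a positive exponent.\<close>
  have "(D ^^ Suc I) x = \<zero>" if "x \<in> carrier A" for x using I[OF that] by simp
  from U.Log_unique[OF D(1) this _ D(2)] show "D = U.Log" by simp
qed

lemma lie_ln_eq: "K = UNIV \<Longrightarrow> lie_ln A \<Phi> = U.Log"
  unfolding lie_ln_def using is_lie_ln_iff by (intro the_equality) blast+

end

theorem (in fg_nilpotent_aut) unipotent_log:
  assumes "\<forall>x\<in>carrier A. (N ^^ p) x \<in> lower_central K A 2"
  shows "\<Phi> \<in> log_domain K A" "log_sums K A \<Phi> (lie_Log K A \<Phi>)" "lie_Log K A \<Phi> \<in> lie_der K A"
    "K = UNIV \<Longrightarrow> \<exists>!D. is_lie_ln A \<Phi> D" "K = UNIV \<Longrightarrow> lie_Log K A \<Phi> = lie_ln A \<Phi>"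
proof -
  obtain J where "unipotent_aut K A \<Phi> J" using N_nilpotent[OF assms] by blast
  then interpret U: unipotent_aut K A \<Phi> J .
  interpret F: fg_unipotent_aut K A S k \<Phi> J by unfold_locales
  show "\<Phi> \<in> log_domain K A" by (rule F.log_domain)
  show "log_sums K A \<Phi> (lie_Log K A \<Phi>)" "lie_Log K A \<Phi> \<in> lie_der K A"
    unfolding U.lie_Log_eq by (rule U.Log_sums, rule U.Log_der)
  show "K = UNIV \<Longrightarrow> \<exists>!D. is_lie_ln A \<Phi> D" using F.is_lie_ln_iff by simp
  show "K = UNIV \<Longrightarrow> lie_Log K A \<Phi> = lie_ln A \<Phi>" unfolding U.lie_Log_eq using F.lie_ln_eq by simp
qed

text \<open>Logarithms are compatible with homomorphisms because their partial sums are.\<close>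

lemma log_sums_natural:
  assumes h: "khom K A B h" and \<Phi>: "khom K A A \<Phi>" and \<Psi>: "khom K B B \<Psi>"
    and comm: "\<And>x. x \<in> carrier A \<Longrightarrow> h (\<Phi> x) = \<Psi> (h x)"
    and D: "log_sums K A \<Phi> D" "D \<in> carrier A \<rightarrow> carrier A"
    and E: "log_sums K B \<Psi> E" "E \<in> carrier B \<rightarrow> carrier B"
    and x: "x \<in> carrier A"
  shows "h (D x) = E (h x)"
proof -
  interpret h: khom K A B h by fact
  interpret \<Phi>: khom K A A \<Phi> by fact
  interpret Np: khom K A A "(\<lambda>y. y \<ominus>\<^bsub>A\<^esub> \<Phi> y) ^^ i" for i by (rule khom_funpow[OF h.A.khom_complement[OF \<Phi>]])
  have pow: "h (((\<lambda>y. y \<ominus>\<^bsub>A\<^esub> \<Phi> y) ^^ i) x) = ((\<lambda>y. y \<ominus>\<^bsub>B\<^esub> \<Psi> y) ^^ i) (h x)" for i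
  proof (induction i)
    case (Suc i)
    then show ?case using Np.hom_closed[OF x, of i] by (simp add: h.hom_diff comm)
  qed simp
  show ?thesis
  proof (rule h.B.functional_eqI)
    show "h (D x) \<in> carrier B" "E (h x) \<in> carrier B"
      using h.hom_closed funcset_mem[OF D(2)] funcset_mem[OF E(2)] x by simp_all
    fix f assume f: "f \<in> linear_functionals K B"
    have c: "(1 / of_nat i) \<odot>\<^bsub>A\<^esub> ((\<lambda>y. y \<ominus>\<^bsub>A\<^esub> \<Phi> y) ^^ i) x \<in> carrier A" for i
      using Np.hom_closed[OF x] by simp
    have s: "(\<Oplus>\<^bsub>A\<^esub> i\<in>{1..N}. (1 / of_nat i) \<odot>\<^bsub>A\<^esub> ((\<lambda>y. y \<ominus>\<^bsub>A\<^esub> \<Phi> y) ^^ i) x) \<in> carrier A" for N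
      using c by (intro h.A.finsum_closed) auto
    have eq: "h (\<ominus>\<^bsub>A\<^esub> (\<Oplus>\<^bsub>A\<^esub> i\<in>{1..N}. (1 / of_nat i) \<odot>\<^bsub>A\<^esub> ((\<lambda>y. y \<ominus>\<^bsub>A\<^esub> \<Phi> y) ^^ i) x))
        = \<ominus>\<^bsub>B\<^esub> (\<Oplus>\<^bsub>B\<^esub> i\<in>{1..N}. (1 / of_nat i) \<odot>\<^bsub>B\<^esub> ((\<lambda>y. y \<ominus>\<^bsub>B\<^esub> \<Psi> y) ^^ i) (h x))" for N
      unfolding h.hom_neg[OF s] h.hom_finsum[OF c] using Np.hom_closed[OF x] by (simp add: h.hom_smult pow)
    have "(\<lambda>N. f (h (\<ominus>\<^bsub>A\<^esub> (\<Oplus>\<^bsub>A\<^esub> i\<in>{1..N}. (1 / of_nat i) \<odot>\<^bsub>A\<^esub> ((\<lambda>y. y \<ominus>\<^bsub>A\<^esub> \<Phi> y) ^^ i) x)))) \<longlonglongrightarrow> f (h (D x))"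
      by (rule bspec[OF bspec[OF D(1)[unfolded log_sums_def vconverges_def] x] h.LF_comp[OF f]])
    moreover have "(\<lambda>N. f (\<ominus>\<^bsub>B\<^esub> (\<Oplus>\<^bsub>B\<^esub> i\<in>{1..N}. (1 / of_nat i) \<odot>\<^bsub>B\<^esub> ((\<lambda>y. y \<ominus>\<^bsub>B\<^esub> \<Psi> y) ^^ i) (h x)))) \<longlonglongrightarrow> f (E (h x))"
      by (rule bspec[OF bspec[OF E(1)[unfolded log_sums_def vconverges_def] h.hom_closed[OF x]] f])
    ultimately show "f (h (D x)) = f (E (h x))" unfolding eq by (rule LIMSEQ_unique)
  qed
qed

section \<open>Passage to the inverse limit\<close>

context lie_tower
begin

lemma fg_nilpotent_level: "k \<ge> 1 \<Longrightarrow> fg_nilpotent_lie_alg K (G k) (g k ` {..<n}) k"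
  using tower_lie tower_nil tower_gen
  by (intro fg_nilpotent_lie_alg.intro fg_nilpotent_lie_alg_axioms.intro) auto

lemma fg_nilpotent_aut_level: "\<lbrakk>k \<ge> 1; \<phi> \<in> lie_aut K (G k)\<rbrakk> \<Longrightarrow> fg_nilpotent_aut K (G k) (g k ` {..<n}) k \<phi>"
  by (intro fg_nilpotent_aut.intro fg_nilpotent_level fg_nilpotent_aut_axioms.intro)

definition level :: "nat \<Rightarrow> ((nat \<Rightarrow> 'a) \<Rightarrow> (nat \<Rightarrow> 'a)) \<Rightarrow> ('a \<Rightarrow> 'a) \<Rightarrow> bool" where
  "level k \<Phi> \<phi> \<longleftrightarrow> \<phi> \<in> extensional (carrier (G k)) \<and> (\<forall>s\<in>carrier lim. \<phi> (s k) = \<Phi> s k)"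

lemma level_unique:
  assumes k: "k \<ge> 1" and "level k \<Phi> \<phi>" "level k \<Phi> \<psi>" shows "\<phi> = \<psi>"
proof (rule extensionalityI[of _ "carrier (G k)"])
  show "\<phi> \<in> extensional (carrier (G k))" "\<psi> \<in> extensional (carrier (G k))" using assms by (auto simp: level_def)
  fix x assume "x \<in> carrier (G k)"
  then have "x \<in> (\<lambda>s. s k) ` carrier lim" using lim_surj[OF k] by simp
  then obtain s where "x = s k" "s \<in> carrier lim" by (rule imageE)
  then show "\<phi> x = \<psi> x" using assms by (simp add: level_def)
qed

lemma level_exists:
  assumes "\<Phi> \<in> lie_aut K lim" "k \<ge> 1" shows "\<exists>\<phi>\<in>lie_aut K (G k). level k \<Phi> \<phi>"
proof -
  obtain \<phi> where \<phi>: "\<phi> \<in> lie_aut K (G k)" "\<forall>s\<in>carrier lim. \<phi> (s k) = \<Phi> s k"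
    using lim_induced[OF assms] by blast
  have "level k \<Phi> \<phi>" unfolding level_def using lie_aut_ahom(4)[OF tower_kalg[OF assms(2)] \<phi>(1)] \<phi>(2) by blast
  then show ?thesis using \<phi>(1) by blast
qed

lemma level_complement_pow:
  assumes \<Phi>: "\<Phi> \<in> lie_aut K lim" and k: "k \<ge> 1" and \<phi>: "level k \<Phi> \<phi>" and s: "s \<in> carrier lim"
  shows "((\<lambda>y. y \<ominus>\<^bsub>G k\<^esub> \<phi> y) ^^ m) (s k) = ((\<lambda>y. y \<ominus>\<^bsub>lim\<^esub> \<Phi> y) ^^ m) s k"
    and "((\<lambda>y. y \<ominus>\<^bsub>lim\<^esub> \<Phi> y) ^^ m) s \<in> carrier lim"
proof -
  interpret P: ahom K lim lim \<Phi> by (rule lie_aut_ahom(1)[OF lim.kalg_axioms \<Phi>])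
  interpret c: ahom K lim "G k" "\<lambda>s. s k" by (rule lim_ahom[OF k])
  interpret Np: khom K lim lim "(\<lambda>y. y \<ominus>\<^bsub>lim\<^esub> \<Phi> y) ^^ i" for i
    by (rule khom_funpow[OF lim.khom_complement[OF P.khom_axioms]])
  show cl: "((\<lambda>y. y \<ominus>\<^bsub>lim\<^esub> \<Phi> y) ^^ m) s \<in> carrier lim" for m by (rule Np.hom_closed[OF s])
  show "((\<lambda>y. y \<ominus>\<^bsub>G k\<^esub> \<phi> y) ^^ m) (s k) = ((\<lambda>y. y \<ominus>\<^bsub>lim\<^esub> \<Phi> y) ^^ m) s k"
  proof (induction m)
    case (Suc m)
    have "\<phi> (((\<lambda>y. y \<ominus>\<^bsub>lim\<^esub> \<Phi> y) ^^ m) s k) = \<Phi> (((\<lambda>y. y \<ominus>\<^bsub>lim\<^esub> \<Phi> y) ^^ m) s) k"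
      using \<phi> cl[of m] by (simp add: level_def)
    then show ?case using Suc cl[of m] by (simp add: c.hom_diff)
  qed simp
qed

text \<open>The eigenvalue condition lives on \<open>G 2\<close>, which has trivial second term,
  while the nilpotency criterion is needed on every \<open>G k\<close>. The transfer runs through
  the limit: a thread that vanishes on level 2 lies in the second term of the limit, and this maps
  to the second term of \<open>G k\<close>.\<close>

lemma level_nilpotent:
  assumes \<Phi>: "\<Phi> \<in> lie_aut K lim" and \<phi>2: "level 2 \<Phi> \<phi>2" and ev: "eigenvalues K (G 2) \<phi>2 \<subseteq> {1}"
    and k: "k \<ge> 1" and \<phi>: "level k \<Phi> \<phi>"
  shows "\<exists>q. \<forall>x\<in>carrier (G k). ((\<lambda>y. y \<ominus>\<^bsub>G k\<^esub> \<phi> y) ^^ q) x \<in> lower_central K (G k) 2"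
proof -
  interpret G2: lie_alg K "G 2" by (rule tower_lie) simp
  have "\<phi>2 \<in> lie_aut K (G 2)" using level_exists[OF \<Phi>, of 2] level_unique[OF _ \<phi>2] by auto
  then interpret p2: ahom K "G 2" "G 2" \<phi>2 by (rule lie_aut_ahom(1)[OF G2.kalg_axioms])
  have "\<exists>bs. distinct bs \<and> lbasis K (G 2) (set bs)"
  proof (rule G2.lbasis_exists)
    show "finite (g 2 ` {..<n})" by simp
    show gc: "g 2 ` {..<n} \<subseteq> carrier (G 2)" by (rule lie_generators_subset[OF tower_gen]) simp
    fix U assume U: "linsub K (G 2) U" "g 2 ` {..<n} \<subseteq> U"
    have "lower_central K (G 2) 2 \<subseteq> U" using tower_nil[of 2] linsub_zero[OF U(1)] by simp
    then show "carrier (G 2) \<subseteq> U" using lie_generators_span[OF tower_gen U(1,2)] by auto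
  qed
  then obtain bs where "distinct bs" "lbasis K (G 2) (set bs)" by blast
  from G2.eigenvalues_unipotent(1)[OF p2.khom_axioms this ev]
  obtain q where q: "\<And>x. x \<in> carrier (G 2) \<Longrightarrow> ((\<lambda>y. y \<ominus>\<^bsub>G 2\<^esub> \<phi>2 y) ^^ q) x = \<zero>\<^bsub>G 2\<^esub>" by blast
  have "((\<lambda>y. y \<ominus>\<^bsub>G k\<^esub> \<phi> y) ^^ q) x \<in> lower_central K (G k) 2" if "x \<in> carrier (G k)" for x
  proof -
    have "x \<in> (\<lambda>s. s k) ` carrier lim" using that lim_surj[OF k] by simp
    then obtain s where s: "x = s k" "s \<in> carrier lim" by (rule imageE)
    let ?t = "((\<lambda>y. y \<ominus>\<^bsub>lim\<^esub> \<Phi> y) ^^ q) s"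
    have "?t 2 = \<zero>\<^bsub>G 2\<^esub>"
      using level_complement_pow(1)[OF \<Phi> _ \<phi>2 s(2), of q] q[OF lim_comp[OF s(2)]] by simp
    then have "?t \<in> lower_central K lim 2"
      using lim_kernel[of 2] level_complement_pow(2)[OF \<Phi> k \<phi> s(2), of q] by auto
    then have "?t k \<in> (\<lambda>s. s k) ` lower_central K lim 2" by (rule imageI)
    then show ?thesis
      unfolding image_lc_lim[OF k] s(1) level_complement_pow(1)[OF \<Phi> k \<phi> s(2)] .
  qed
  then show ?thesis by blast
qed

text \<open>Naturality of the logarithm along the projections makes the levelwise logarithms of a
  thread a thread again; the laws of a derivation are then checked level by level.\<close>

lemma limit_log_der:
  assumes \<Phi>: "\<Phi> \<in> lie_aut K lim"
    and \<phi>: "\<And>k. k \<ge> 1 \<Longrightarrow> \<phi> k \<in> lie_aut K (G k)" "\<And>k. k \<ge> 1 \<Longrightarrow> level k \<Phi> (\<phi> k)"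
    and D: "\<And>k. k \<ge> 1 \<Longrightarrow> D k \<in> lie_der K (G k)" "\<And>k. k \<ge> 1 \<Longrightarrow> log_sums K (G k) (\<phi> k) (D k)"
  shows "(\<lambda>s\<in>carrier lim. \<lambda>k\<in>{1..}. D k (s k)) \<in> lie_der K lim"
proof -
  have Dk: "khom K (G k) (G k) (D k)" if "k \<ge> 1" for k
  proof -
    interpret kspace K "G k" by (rule tower_kspace[OF that])
    show ?thesis using D(1)[OF that] by unfold_locales (simp add: lie_der_def lin_end_def)
  qed
  have \<phi>k: "khom K (G k) (G k) (\<phi> k)" if "k \<ge> 1" for k
    using lie_aut_ahom(1)[OF tower_kalg[OF that] \<phi>(1)[OF that]] by (simp add: ahom_def)
  \<comment> \<open>That the induced maps commute with the projections is not part of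
    \<open>level\<close>. It holds because every element of a level is a component of a thread, to
    which \<Phi> can be applied.\<close>
  have comm: "p k (\<phi> (Suc k) x) = \<phi> k (p k x)" if k: "k \<ge> 1" and x: "x \<in> carrier (G (Suc k))" for k x
  proof -
    have "x \<in> (\<lambda>s. s (Suc k)) ` carrier lim" using x lim_surj[of "Suc k"] by simp
    then obtain s where s: "x = s (Suc k)" "s \<in> carrier lim" by (rule imageE)
    have "\<Phi> s \<in> carrier lim" using lie_aut_ahom(3)[OF lim.kalg_axioms \<Phi>] s(2) by blast
    then show ?thesis
      using \<phi>(2)[of k] \<phi>(2)[of "Suc k"] k s lim_proj[of "\<Phi> s" k] lim_proj[OF s(2) k] by (simp add: level_def)
  qed
  have nat: "p k (D (Suc k) x) = D k (p k x)" if k: "k \<ge> 1" and x: "x \<in> carrier (G (Suc k))" for k x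
  proof (rule log_sums_natural[OF tower_khom[OF k] \<phi>k \<phi>k[OF k] comm[OF k] D(2) _ D(2)[OF k] _ x])
    show "D (Suc k) \<in> carrier (G (Suc k)) \<rightarrow> carrier (G (Suc k))" using khom.hom_closed[OF Dk[of "Suc k"]] by simp
    show "D k \<in> carrier (G k) \<rightarrow> carrier (G k)" using khom.hom_closed[OF Dk[OF k]] by simp
  qed simp_all
  let ?E = "\<lambda>s\<in>carrier lim. \<lambda>k\<in>{1..}. D k (s k)"
  have ext: "?E s \<in> extensional {1..}" if "s \<in> carrier lim" for s using that by simp
  have comp: "?E s k = D k (s k)" if "s \<in> carrier lim" "k \<ge> 1" for s k using that by simp
  have closed: "?E s \<in> carrier lim" if s: "s \<in> carrier lim" for s
  proof (rule limI[OF ext[OF s]])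
    fix k :: nat assume k: "k \<ge> 1"
    show "?E s k \<in> carrier (G k)" unfolding comp[OF s k] by (rule khom.hom_closed[OF Dk[OF k] lim_comp[OF s k]])
    have "p k (D (Suc k) (s (Suc k))) = D k (p k (s (Suc k)))" by (rule nat[OF k lim_comp[OF s]]) simp
    then show "p k (?E s (Suc k)) = ?E s k" using s k lim_proj[OF s k] by simp
  qed
  show ?thesis
    unfolding lie_der_def lin_end_def
  proof (intro CollectI conjI IntI ballI)
    show "?E \<in> extensional (carrier lim)" by simp
    show "?E \<in> module_hom (cfield K) lim lim"
    proof (rule module_homI[OF closed])
      fix s t assume st: "s \<in> carrier lim" "t \<in> carrier lim"
      show "?E (s \<oplus>\<^bsub>lim\<^esub> t) = ?E s \<oplus>\<^bsub>lim\<^esub> ?E t"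
      proof (rule lim_eqI[OF ext[OF lim_closed(3)[OF st]] lim_ext(3)])
        fix k :: nat assume k: "k \<ge> 1"
        show "?E (s \<oplus>\<^bsub>lim\<^esub> t) k = (?E s \<oplus>\<^bsub>lim\<^esub> ?E t) k"
          unfolding lim_ops(3)[OF k] comp[OF st(1) k] comp[OF st(2) k] comp[OF lim_closed(3)[OF st] k]
          by (rule khom.hom_add[OF Dk[OF k] lim_comp[OF st(1) k] lim_comp[OF st(2) k]])
      qed
    next
      fix c s assume cs: "c \<in> K" "s \<in> carrier lim"
      show "?E (c \<odot>\<^bsub>lim\<^esub> s) = c \<odot>\<^bsub>lim\<^esub> ?E s"
      proof (rule lim_eqI[OF ext[OF lim_closed(4)[OF cs]] lim_ext(4)])
        fix k :: nat assume k: "k \<ge> 1"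
        show "?E (c \<odot>\<^bsub>lim\<^esub> s) k = (c \<odot>\<^bsub>lim\<^esub> ?E s) k"
          unfolding lim_ops(4)[OF k] comp[OF cs(2) k] comp[OF lim_closed(4)[OF cs] k]
          by (rule khom.hom_smult[OF Dk[OF k] cs(1) lim_comp[OF cs(2) k]])
      qed
    qed
    fix s t assume st: "s \<in> carrier lim" "t \<in> carrier lim"
    show "?E (s \<otimes>\<^bsub>lim\<^esub> t) = (?E s \<otimes>\<^bsub>lim\<^esub> t) \<oplus>\<^bsub>lim\<^esub> (s \<otimes>\<^bsub>lim\<^esub> ?E t)"
    proof (rule lim_eqI[OF ext[OF lim_closed(1)[OF st]] lim_ext(3)])
      fix k :: nat assume k: "k \<ge> 1"
      show "?E (s \<otimes>\<^bsub>lim\<^esub> t) k = ((?E s \<otimes>\<^bsub>lim\<^esub> t) \<oplus>\<^bsub>lim\<^esub> (s \<otimes>\<^bsub>lim\<^esub> ?E t)) k"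
        unfolding lim_ops(3)[OF k] lim_ops(1)[OF k] comp[OF st(1) k] comp[OF st(2) k] comp[OF lim_closed(1)[OF st] k]
        using D(1)[OF k] lim_comp[OF st(1) k] lim_comp[OF st(2) k] by (simp add: lie_der_def)
    qed
  qed
qed

end

text \<open>The clauses with unique existence and with membership in \<open>lie_der\<close> ensure
  that the equations between \<open>lie_Log\<close> and \<open>lie_ln\<close>, both of them definite
  descriptions, are equations between actual derivations. In the limit, level 2 plays the part of
  the abelianization.\<close>

theorem theorem2p6:
  fixes K :: "complex set" and n k :: nat
  assumes "K \<in> {\<rat>, \<real>, UNIV}" and "n \<ge> 1" and "k \<ge> 1"
  shows "(\<forall>\<Phi>\<in>lie_aut K (lie_level K n k).
            eigenvalues K (abelianization K (lie_level K n k)) (ab_map K (lie_level K n k) \<Phi>) \<subseteq> {1} \<longrightarrow>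
              \<Phi> \<in> M_circ K n k \<and>
              (K = UNIV \<longrightarrow>
                 (\<exists>!D. is_lie_ln (lie_level K n k) \<Phi> D) \<and>
                 lie_Log K (lie_level K n k) \<Phi> \<in> lie_der K (lie_level K n k) \<and>
                 lie_Log K (lie_level K n k) \<Phi> = lie_ln (lie_level K n k) \<Phi>)) \<and>
         (\<forall>\<Phi>\<in>lie_aut K (lie_limit K n).
            (\<exists>\<phi>. induces K n 2 \<Phi> \<phi> \<and> eigenvalues K (lie_level K n 2) \<phi> \<subseteq> {1}) \<longrightarrow>
              \<Phi> \<in> M_circ_limit K n \<and>
              (K = UNIV \<longrightarrow>
                 (\<forall>j\<ge>1. \<exists>!D. is_lie_ln (lie_level K n j) (level_map K n j \<Phi>) D) \<and>
                 limit_Log K n \<Phi> \<in> lie_der K (lie_limit K n) \<and>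
                 limit_Log K n \<Phi> = limit_ln n \<Phi>))"
proof -
  interpret T: lie_tower K "lie_level K n" "level_proj K n" n "level_gen n K"
    by (rule lie_tower_level[OF cx_field_subfields[OF assms(1)]])
  have lim: "lie_limit K n = T.lim" by (simp add: lie_limit_def T.lim_def)
  have ind: "induces K n j \<Phi> \<phi> \<longleftrightarrow> T.level j \<Phi> \<phi>" for j \<Phi> \<phi>
    by (simp add: induces_def T.level_def lim)
  show ?thesis
  proof (intro conjI ballI impI)
    fix \<Phi> assume \<Phi>: "\<Phi> \<in> lie_aut K (lie_level K n k)"
      and ev: "eigenvalues K (abelianization K (lie_level K n k)) (ab_map K (lie_level K n k) \<Phi>) \<subseteq> {1}"
    interpret F: fg_nilpotent_aut K "lie_level K n k" "level_gen n K k ` {..<n}" k \<Phi>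
      by (rule T.fg_nilpotent_aut_level[OF assms(3) \<Phi>])
    obtain p where p: "\<forall>x\<in>carrier (lie_level K n k). (F.N ^^ p) x \<in> lower_central K (lie_level K n k) 2"
      using F.eigenvalues_one_nilpotent[OF ev] by blast
    show "\<Phi> \<in> M_circ K n k" unfolding M_circ_def by (rule F.unipotent_log(1)[OF p])
    assume UNIV: "K = UNIV"
    show "\<exists>!D. is_lie_ln (lie_level K n k) \<Phi> D" by (rule F.unipotent_log(4)[OF p UNIV])
    show "lie_Log K (lie_level K n k) \<Phi> \<in> lie_der K (lie_level K n k)" by (rule F.unipotent_log(3)[OF p])
    show "lie_Log K (lie_level K n k) \<Phi> = lie_ln (lie_level K n k) \<Phi>" by (rule F.unipotent_log(5)[OF p UNIV])
  next
    fix \<Phi> assume "\<Phi> \<in> lie_aut K (lie_limit K n)"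
      and "\<exists>\<phi>. induces K n 2 \<Phi> \<phi> \<and> eigenvalues K (lie_level K n 2) \<phi> \<subseteq> {1}"
    then obtain \<phi>2 where \<Phi>: "\<Phi> \<in> lie_aut K T.lim"
      and \<phi>2: "T.level 2 \<Phi> \<phi>2" "eigenvalues K (lie_level K n 2) \<phi>2 \<subseteq> {1}" unfolding ind lim by blast
    \<comment> \<open>The description in \<open>level_map\<close> denotes an automorphism of the
      level: one inducing automorphism exists, and extensionality with surjectivity of the limit
      onto the level makes it the only induced map.\<close>
    define \<phi> where "\<phi> j = level_map K n j \<Phi>" for j
    have \<phi>: "\<phi> j \<in> lie_aut K (lie_level K n j)" "T.level j \<Phi> (\<phi> j)" if j: "j \<ge> 1" for j
    proof -
      obtain \<psi> where \<psi>: "\<psi> \<in> lie_aut K (lie_level K n j)" "T.level j \<Phi> \<psi>" using T.level_exists[OF \<Phi> j] by blast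
      have "\<phi> j = \<psi>"
        unfolding \<phi>_def level_map_def ind using \<psi>(2) T.level_unique[OF j _ \<psi>(2)] by (rule the_equality)
      then show "\<phi> j \<in> lie_aut K (lie_level K n j)" "T.level j \<Phi> (\<phi> j)" using \<psi> by simp_all
    qed
    have log: "\<phi> j \<in> log_domain K (lie_level K n j)"
      "log_sums K (lie_level K n j) (\<phi> j) (lie_Log K (lie_level K n j) (\<phi> j))"
      "lie_Log K (lie_level K n j) (\<phi> j) \<in> lie_der K (lie_level K n j)"
      "K = UNIV \<Longrightarrow> \<exists>!D. is_lie_ln (lie_level K n j) (\<phi> j) D"
      "K = UNIV \<Longrightarrow> lie_Log K (lie_level K n j) (\<phi> j) = lie_ln (lie_level K n j) (\<phi> j)" if j: "j \<ge> 1" for j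
    proof -
      interpret F: fg_nilpotent_aut K "lie_level K n j" "level_gen n K j ` {..<n}" j "\<phi> j"
        by (rule T.fg_nilpotent_aut_level[OF j \<phi>(1)[OF j]])
      obtain p where "\<forall>x\<in>carrier (lie_level K n j). (F.N ^^ p) x \<in> lower_central K (lie_level K n j) 2"
        using T.level_nilpotent[OF \<Phi> \<phi>2 j \<phi>(2)[OF j]] by blast
      note F.unipotent_log[OF this]
      then show "\<phi> j \<in> log_domain K (lie_level K n j)"
        "log_sums K (lie_level K n j) (\<phi> j) (lie_Log K (lie_level K n j) (\<phi> j))"
        "lie_Log K (lie_level K n j) (\<phi> j) \<in> lie_der K (lie_level K n j)"
        "K = UNIV \<Longrightarrow> \<exists>!D. is_lie_ln (lie_level K n j) (\<phi> j) D"
        "K = UNIV \<Longrightarrow> lie_Log K (lie_level K n j) (\<phi> j) = lie_ln (lie_level K n j) (\<phi> j)"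
        by blast+
    qed
    show "\<Phi> \<in> M_circ_limit K n"
      unfolding M_circ_limit_def M_circ_def ind lim using \<Phi> \<phi>(2) log(1) by blast
    have Log: "limit_Log K n \<Phi> = (\<lambda>s\<in>carrier T.lim. \<lambda>j\<in>{1..}. lie_Log K (lie_level K n j) (\<phi> j) (s j))"
      unfolding limit_Log_def limit_map_def lim \<phi>_def ..
    have "(\<lambda>s\<in>carrier T.lim. \<lambda>j\<in>{1..}. lie_Log K (lie_level K n j) (\<phi> j) (s j)) \<in> lie_der K T.lim"
      by (rule T.limit_log_der[OF \<Phi>, of \<phi>]) (use \<phi> log(2,3) in auto)
    then show "limit_Log K n \<Phi> \<in> lie_der K (lie_limit K n)" unfolding Log lim .
    assume UNIV: "K = UNIV"
    show "\<forall>j\<ge>1. \<exists>!D. is_lie_ln (lie_level K n j) (level_map K n j \<Phi>) D"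
      using log(4)[OF _ UNIV] unfolding \<phi>_def by blast
    show "limit_Log K n \<Phi> = limit_ln n \<Phi>"
    proof -
      have "limit_ln n \<Phi> = (\<lambda>s\<in>carrier (lie_limit K n). \<lambda>j\<in>{1..}. lie_ln (lie_level K n j) (\<phi> j) (s j))"
        unfolding limit_ln_def limit_map_def \<phi>_def UNIV ..
      also have "\<dots> = limit_Log K n \<Phi>"
        unfolding Log lim by (intro restrict_ext) (simp add: log(5)[OF _ UNIV])
      finally show ?thesis ..
    qed
  qed
qed

end
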